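(* Let $F\colon\Sigma\to M$ be a (possibly branched) minimal immersion of a closed two-real-dimensional oriented surface into a Riemannian manifold $M$. For any smooth section $s$ of the normal bundle $\nu$ and any smooth section $\sigma$ of the ramified tangent bundle $\xi$ one has $$ (\delta^2A)(s)\leqslant(\delta^2E)(s+\sigma), $$ with equality if and only if $\sigma$ satisfies $$ D'\sigma^{0,1}=-(\nabla' s)^\top . $$
   Context: $\Sigma$ carries the conformal structure induced by $F$, so that $F$ is a nonconstant harmonic map which is conformal away from the branch points (the isolated points where $dF=0$). "Closed" means compact without boundary. Write $\langle\cdot,\cdot\rangle$ for the metric of $M$, extended complex bilinearly to $TM\otimes_{\mathbb R}\mathbb C$, $|\cdot|$ for the associated (Hermitian) norm, $\nabla$ for the Levi-Civita connection of $M$ pulled back to $F^*(TM)$ (extended complex linearly), and $R$ for the curvature tensor, with sign such that $\langle R(X,Y)Y,X\rangle$ is the sectional curvature for orthonormal $X,Y$. In a local complex coordinate $z=x+iy$ put $F_x=F_*(\partial_x)$, $F_y=F_*(\partial_y)$, $F_z=F_*(\partial_z)$, $F_{\bar z}=F_*(\partial_{\bar z})$. $F^*(TM)=\xi\oplus\nu$ (orthogonal sum over all of $\Sigma$), where $\xi$ is the ramified tangent bundle (the tangent bundle of $\Sigma$ twisted at the branch points by the order of branching; away from branch points its fibre is the image of $dF$) and $\nu$ is the normal bundle. Superscripts $\top$ and $\perp$ denote orthogonal projection onto $\xi_{\mathbb C}=\xi\otimes\mathbb C$ and $\nu\otimes\mathbb C$. There is a splitting $\xi_{\mathbb C}=\xi^{1,0}\oplus\xi^{0,1}$,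 where away from the branch points $\xi^{1,0}$ is locally spanned by $F_z$ and $\xi^{0,1}$ by $F_{\bar z}$; accordingly $\sigma=\sigma^{1,0}+\sigma^{0,1}$. $D$ is the connection on $\xi_{\mathbb C}$ induced by $\nabla$ and orthogonal projection onto $\xi_{\mathbb C}$; $\nabla'=dz\otimes\nabla_{\partial_z}$ and $D'=dz\otimes D_{\partial_z}$. The second variations are, for smooth sections $v$ of $F^*(TM)$ and $s$ of $\nu$, $$(\delta^2E)(v)=\int_\Sigma\big(|\nabla_{\partial_x}v|^2+|\nabla_{\partial_y}v|^2-\langle R(v,F_x)F_x,v\rangle-\langle R(v,F_y)F_y,v\rangle\big)\,dx\,dy,$$ $$(\delta^2A)(s)=4\int_\Sigma\big(|(\nabla_{\partial_z}s)^\perp|^2-|(\nabla_{\partial_z}s)^\top|^2-\langle R(s,F_z)F_{\bar z},s\rangle\big)\,dx\,dy.$$ *)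

theory Defs
  imports "HOL-Analysis.Analysis"
begin

section \<open>Smooth maps and atlases\<close>

text \<open>Meaningful on open sets \<open>U\<close> only; all uses below are of that kind.\<close>

primrec C_k_on :: "nat \<Rightarrow> 'a::euclidean_space set \<Rightarrow> ('a \<Rightarrow> 'b::real_normed_vector) \<Rightarrow> bool" where
  "C_k_on 0 U f \<longleftrightarrow> continuous_on U f"
| "C_k_on (Suc k) U f \<longleftrightarrow> (\<forall>x\<in>U. f differentiable (at x)) \<and>
     (\<forall>e\<in>Basis. C_k_on k U (\<lambda>x. frechet_derivative f (at x) e))"

definition C_inf_on :: "'a::euclidean_space set \<Rightarrow> ('a \<Rightarrow> 'b::real_normed_vector) \<Rightarrow> bool" where
  "C_inf_on U f \<longleftrightarrow> (\<forall>k. C_k_on k U f)"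

text \<open>A chart is a pair of its domain and its coordinate map. A manifold is a whole type
  (Hausdorff and second countable by its type class) together with an atlas, which need not be
  maximal.\<close>

type_synonym ('a, 'e) chart = "'a set \<times> ('a \<Rightarrow> 'e)"

definition chart_inv :: "('a, 'e) chart \<Rightarrow> 'e \<Rightarrow> 'a" where
  "chart_inv c = inv_into (fst c) (snd c)"

definition is_chart :: "('a::topological_space, 'e::euclidean_space) chart \<Rightarrow> bool" where
  "is_chart c \<longleftrightarrow> open (fst c) \<and> open (snd c ` fst c) \<and>
     homeomorphism (fst c) (snd c ` fst c) (snd c) (chart_inv c)"

definition smooth_manifold :: "('a::topological_space, 'e::euclidean_space) chart set \<Rightarrow> bool" where
  "smooth_manifold A \<longleftrightarrow> (\<forall>c\<in>A. is_chart c) \<and> (\<Union>c\<in>A. fst c) = UNIV \<and>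
     (\<forall>c\<in>A. \<forall>d\<in>A. C_inf_on (snd c ` (fst c \<inter> fst d)) (snd d \<circ> chart_inv c))"

text \<open>A closed oriented surface with a conformal structure is given by a complex atlas; the
  orientation is the one induced by the charts.\<close>

definition closed_riemann_surface :: "('s::topological_space, complex) chart set \<Rightarrow> bool" where
  "closed_riemann_surface S \<longleftrightarrow> compact (UNIV :: 's set) \<and>
     (\<forall>c\<in>S. is_chart c) \<and> (\<Union>c\<in>S. fst c) = UNIV \<and>
     (\<forall>c\<in>S. \<forall>d\<in>S. (snd d \<circ> chart_inv c) holomorphic_on (snd c ` (fst c \<inter> fst d)))"


section \<open>Tangent vectors and Riemannian metrics\<close>

text \<open>A tangent vector at \<open>q\<close> is the family of its coordinate vectors in all charts of the atlas
  around \<open>q\<close> (and \<open>0\<close> in all other charts), related by the Jacobians of the transition maps. The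
  scalars \<open>'k\<close> are \<open>real\<close> for \<open>TM\<close> and \<open>complex\<close> for its complexification.\<close>

type_synonym ('m, 'n, 'k) tvec = "('m, real^'n) chart \<Rightarrow> 'k^'n"

definition tfamily ::
  "('m, real^'n) chart set \<Rightarrow> 'm \<Rightarrow> ('m, 'n, 'k::real_normed_field) tvec \<Rightarrow> ('m, 'n, 'k) tvec" where
  "tfamily A q f = (\<lambda>c. if c \<in> A \<and> q \<in> fst c then f c else 0)"

definition tvec_at ::
  "('m, real^'n) chart set \<Rightarrow> ('m, real^'n) chart \<Rightarrow> 'm \<Rightarrow> 'k^'n \<Rightarrow> ('m, 'n, 'k::real_normed_field) tvec" where
  "tvec_at A c q u = tfamily A q (\<lambda>d. \<chi> i. \<Sum>j\<in>UNIV.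
     of_real (frechet_derivative (snd d \<circ> chart_inv c) (at (snd c q)) (axis j 1) $ i) * u $ j)"

definition tangent_space ::
  "('m, real^'n) chart set \<Rightarrow> 'm \<Rightarrow> ('m, 'n, 'k::real_normed_field) tvec set" where
  "tangent_space A q = {v. \<forall>c\<in>A. q \<in> fst c \<longrightarrow> v = tvec_at A c q (v c)}"

text \<open>The matrix of the metric in the chart \<open>c\<close>, at the coordinate point \<open>x\<close>.\<close>

definition gram ::
  "('m, real^'n) chart set \<Rightarrow> ('m \<Rightarrow> ('m, 'n, real) tvec \<Rightarrow> ('m, 'n, real) tvec \<Rightarrow> real) \<Rightarrow>
   ('m, real^'n) chart \<Rightarrow> real^'n \<Rightarrow> real^'n^'n" where
  "gram A g c x = (\<chi> i j. g (chart_inv c x)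
     (tvec_at A c (chart_inv c x) (axis i 1)) (tvec_at A c (chart_inv c x) (axis j 1)))"

definition riemannian_metric ::
  "('m, real^'n) chart set \<Rightarrow> ('m \<Rightarrow> ('m, 'n, real) tvec \<Rightarrow> ('m, 'n, real) tvec \<Rightarrow> real) \<Rightarrow> bool" where
  "riemannian_metric A g \<longleftrightarrow>
     (\<forall>q. \<forall>u\<in>tangent_space A q. \<forall>v\<in>tangent_space A q. \<forall>w\<in>tangent_space A q. \<forall>a.
        g q u v = g q v u \<and>
        g q (\<lambda>c. a *\<^sub>R u c + v c) w = a * g q u w + g q v w \<and>
        (u \<noteq> (\<lambda>c. 0) \<longrightarrow> g q u u > 0)) \<and>
     (\<forall>c\<in>A. \<forall>i j. C_inf_on (snd c ` fst c) (\<lambda>x. gram A g c x $ i $ j))"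

definition christoffel ::
  "('m, real^'n) chart set \<Rightarrow> ('m \<Rightarrow> ('m, 'n, real) tvec \<Rightarrow> ('m, 'n, real) tvec \<Rightarrow> real) \<Rightarrow>
   ('m, real^'n) chart \<Rightarrow> real^'n \<Rightarrow> 'n \<Rightarrow> 'n \<Rightarrow> 'n \<Rightarrow> real" where
  "christoffel A g c x k i j = (1/2) * (\<Sum>l\<in>UNIV. matrix_inv (gram A g c x) $ k $ l *
     (frechet_derivative (\<lambda>y. gram A g c y $ j $ l) (at x) (axis i 1)
      + frechet_derivative (\<lambda>y. gram A g c y $ i $ l) (at x) (axis j 1)
      - frechet_derivative (\<lambda>y. gram A g c y $ i $ j) (at x) (axis l 1)))"

text \<open>The \<open>l\<close>-th coordinate of \<open>R(\<partial>\<^sub>i, \<partial>\<^sub>j)\<partial>\<^sub>k\<close>, where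
  \<open>R(X,Y)Z = \<nabla>\<^sub>X\<nabla>\<^sub>Y Z - \<nabla>\<^sub>Y\<nabla>\<^sub>X Z - \<nabla>\<^bsub>[X,Y]\<^esub> Z\<close>; thus \<open>\<langle>R(X,Y)Y,X\<rangle>\<close> is the sectional curvature
  for orthonormal \<open>X, Y\<close>.\<close>

definition riemann_coeff ::
  "('m, real^'n) chart set \<Rightarrow> ('m \<Rightarrow> ('m, 'n, real) tvec \<Rightarrow> ('m, 'n, real) tvec \<Rightarrow> real) \<Rightarrow>
   ('m, real^'n) chart \<Rightarrow> real^'n \<Rightarrow> 'n \<Rightarrow> 'n \<Rightarrow> 'n \<Rightarrow> 'n \<Rightarrow> real" where
  "riemann_coeff A g c x l i j k =
     frechet_derivative (\<lambda>y. christoffel A g c y l j k) (at x) (axis i 1)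
     - frechet_derivative (\<lambda>y. christoffel A g c y l i k) (at x) (axis j 1)
     + (\<Sum>m\<in>UNIV. christoffel A g c x l i m * christoffel A g c x m j k
                 - christoffel A g c x l j m * christoffel A g c x m i k)"

definition curvature ::
  "('m, real^'n) chart set \<Rightarrow> ('m \<Rightarrow> ('m, 'n, real) tvec \<Rightarrow> ('m, 'n, real) tvec \<Rightarrow> real) \<Rightarrow> 'm \<Rightarrow>
   ('m, 'n, 'k) tvec \<Rightarrow> ('m, 'n, 'k) tvec \<Rightarrow> ('m, 'n, 'k) tvec \<Rightarrow> ('m, 'n, 'k::real_normed_field) tvec" where
  "curvature A g q X Y Z = tfamily A q (\<lambda>c. \<chi> l. \<Sum>i\<in>UNIV. \<Sum>j\<in>UNIV. \<Sum>k\<in>UNIV.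
     of_real (riemann_coeff A g c (snd c q) l i j k) * X c $ i * Y c $ j * Z c $ k)"


section \<open>Complexification\<close>

definition tcomplex :: "('m, 'n::finite, real) tvec \<Rightarrow> ('m, 'n, real) tvec \<Rightarrow> ('m, 'n, complex) tvec" where
  "tcomplex u v = (\<lambda>c. \<chi> i. Complex (u c $ i) (v c $ i))"

definition tof_real :: "('m, 'n::finite, real) tvec \<Rightarrow> ('m, 'n, complex) tvec" where
  "tof_real u = (\<lambda>c. \<chi> i. of_real (u c $ i))"

definition tRe :: "('m, 'n::finite, complex) tvec \<Rightarrow> ('m, 'n, real) tvec" where
  "tRe V = (\<lambda>c. \<chi> i. Re (V c $ i))"

definition tIm :: "('m, 'n::finite, complex) tvec \<Rightarrow> ('m, 'n, real) tvec" where
  "tIm V = (\<lambda>c. \<chi> i. Im (V c $ i))"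

definition tcnj :: "('m, 'n::finite, complex) tvec \<Rightarrow> ('m, 'n, complex) tvec" where
  "tcnj V = (\<lambda>c. \<chi> i. cnj (V c $ i))"

definition metric_bilinear ::
  "('m \<Rightarrow> ('m, 'n::finite, real) tvec \<Rightarrow> ('m, 'n, real) tvec \<Rightarrow> real) \<Rightarrow> 'm \<Rightarrow>
   ('m, 'n, complex) tvec \<Rightarrow> ('m, 'n, complex) tvec \<Rightarrow> complex" where
  "metric_bilinear g q V W = Complex
     (g q (tRe V) (tRe W) - g q (tIm V) (tIm W)) (g q (tRe V) (tIm W) + g q (tIm V) (tRe W))"

definition hermitian_norm_sq ::
  "('m \<Rightarrow> ('m, 'n::finite, real) tvec \<Rightarrow> ('m, 'n, real) tvec \<Rightarrow> real) \<Rightarrow> 'm \<Rightarrow> ('m, 'n, complex) tvec \<Rightarrow> real" where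
  "hermitian_norm_sq g q V = Re (metric_bilinear g q V (tcnj V))"


section \<open>Maps of the surface and sections along them\<close>

text \<open>Derivative at \<open>p\<close> in the coordinate direction \<open>e\<close> of the complex chart \<open>z = x + iy\<close>:
  \<open>e = 1\<close> gives \<open>\<partial>\<^sub>x\<close> and \<open>e = \<i>\<close> gives \<open>\<partial>\<^sub>y\<close>.\<close>

definition coord_deriv ::
  "('s, complex) chart \<Rightarrow> complex \<Rightarrow> ('s \<Rightarrow> 'b::real_normed_vector) \<Rightarrow> 's \<Rightarrow> 'b" where
  "coord_deriv z e f p = frechet_derivative (f \<circ> chart_inv z) (at (snd z p)) e"

definition smooth_map ::
  "('s::topological_space, complex) chart set \<Rightarrow> ('m::topological_space, real^'n) chart set \<Rightarrow>
   ('s \<Rightarrow> 'm) \<Rightarrow> bool" where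
  "smooth_map S A F \<longleftrightarrow> continuous_on UNIV F \<and>
     (\<forall>z\<in>S. \<forall>c\<in>A. C_inf_on (snd z ` (fst z \<inter> F -` fst c)) (snd c \<circ> F \<circ> chart_inv z))"

text \<open>Smooth sections of the pulled back (complexified) tangent bundle over the open set \<open>N\<close>.\<close>

definition smooth_section_on ::
  "('s, complex) chart set \<Rightarrow> ('m, real^'n) chart set \<Rightarrow> ('s \<Rightarrow> 'm) \<Rightarrow> 's set \<Rightarrow>
   ('s \<Rightarrow> ('m, 'n, 'k::{real_normed_field, euclidean_space}) tvec) \<Rightarrow> bool" where
  "smooth_section_on S A F N v \<longleftrightarrow> (\<forall>p\<in>N. v p \<in> tangent_space A (F p)) \<and>
     (\<forall>z\<in>S. \<forall>c\<in>A. C_inf_on (snd z ` (N \<inter> fst z \<inter> F -` fst c)) (\<lambda>w. v (chart_inv z w) c))"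

definition pushforward ::
  "('m, real^'n) chart set \<Rightarrow> ('s \<Rightarrow> 'm) \<Rightarrow> ('s, complex) chart \<Rightarrow> complex \<Rightarrow> 's \<Rightarrow> ('m, 'n, real) tvec" where
  "pushforward A F z e p = tfamily A (F p) (\<lambda>c. coord_deriv z e (snd c \<circ> F) p)"

definition F_z ::
  "('m, real^'n) chart set \<Rightarrow> ('s \<Rightarrow> 'm) \<Rightarrow> ('s, complex) chart \<Rightarrow> 's \<Rightarrow> ('m, 'n, complex) tvec" where
  "F_z A F z p = tcomplex (\<lambda>c. (1/2) *\<^sub>R pushforward A F z 1 p c)
                          (\<lambda>c. - (1/2) *\<^sub>R pushforward A F z \<i> p c)"

text \<open>The pulled back Levi-Civita connection in the direction \<open>e\<close> of the chart \<open>z\<close>; for complex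
  scalars this is its complex linear extension.\<close>

definition nabla ::
  "('m, real^'n) chart set \<Rightarrow> ('m \<Rightarrow> ('m, 'n, real) tvec \<Rightarrow> ('m, 'n, real) tvec \<Rightarrow> real) \<Rightarrow>
   ('s \<Rightarrow> 'm) \<Rightarrow> ('s, complex) chart \<Rightarrow> complex \<Rightarrow>
   ('s \<Rightarrow> ('m, 'n, 'k) tvec) \<Rightarrow> 's \<Rightarrow> ('m, 'n, 'k::{real_normed_field, euclidean_space}) tvec" where
  "nabla A g F z e v p = tfamily A (F p) (\<lambda>c. \<chi> k. coord_deriv z e (\<lambda>q. v q c) p $ k +
     (\<Sum>i\<in>UNIV. \<Sum>j\<in>UNIV. of_real (christoffel A g c (snd c (F p)) k i j
        * pushforward A F z e p c $ i) * v p c $ j))"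

definition nabla_z ::
  "('m, real^'n) chart set \<Rightarrow> ('m \<Rightarrow> ('m, 'n, real) tvec \<Rightarrow> ('m, 'n, real) tvec \<Rightarrow> real) \<Rightarrow>
   ('s \<Rightarrow> 'm) \<Rightarrow> ('s, complex) chart \<Rightarrow>
   ('s \<Rightarrow> ('m, 'n, complex) tvec) \<Rightarrow> 's \<Rightarrow> ('m, 'n, complex) tvec" where
  "nabla_z A g F z V p = (\<lambda>c. (1/2) *s (nabla A g F z 1 V p c - \<i> *s nabla A g F z \<i> V p c))"


section \<open>Branched minimal immersions and the ramified tangent bundle\<close>

definition branch_point ::
  "('s, complex) chart set \<Rightarrow> ('m, real^'n) chart set \<Rightarrow> ('s \<Rightarrow> 'm) \<Rightarrow> 's \<Rightarrow> bool" where
  "branch_point S A F p \<longleftrightarrow> (\<forall>z\<in>S. p \<in> fst z \<longrightarrow>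
     pushforward A F z 1 p = (\<lambda>c. 0) \<and> pushforward A F z \<i> p = (\<lambda>c. 0))"

text \<open>Nonconstant, harmonic (the tension field vanishes), conformal, with isolated branch points.
  The conformality equations hold trivially at the branch points.\<close>

definition branched_minimal_immersion ::
  "('s::topological_space, complex) chart set \<Rightarrow> ('m::topological_space, real^'n) chart set \<Rightarrow>
   ('m \<Rightarrow> ('m, 'n, real) tvec \<Rightarrow> ('m, 'n, real) tvec \<Rightarrow> real) \<Rightarrow> ('s \<Rightarrow> 'm) \<Rightarrow> bool" where
  "branched_minimal_immersion S A g F \<longleftrightarrow> smooth_map S A F \<and> (\<exists>p q. F p \<noteq> F q) \<and>
     (\<forall>z\<in>S. \<forall>p\<in>fst z.
        (\<forall>c. nabla A g F z 1 (pushforward A F z 1) p c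
           + nabla A g F z \<i> (pushforward A F z \<i>) p c = 0) \<and>
        g (F p) (pushforward A F z 1 p) (pushforward A F z 1 p)
          = g (F p) (pushforward A F z \<i> p) (pushforward A F z \<i> p) \<and>
        g (F p) (pushforward A F z 1 p) (pushforward A F z \<i> p) = 0) \<and>
     (\<forall>p. branch_point S A F p \<longrightarrow>
        (\<exists>N. open N \<and> p \<in> N \<and> (\<forall>q\<in>N. branch_point S A F q \<longrightarrow> q = p)))"

text \<open>\<open>\<Xi>\<close> is the (1,0) part of the complexified ramified tangent bundle: the smooth complex line
  subbundle of the pulled back complexified tangent bundle which around each point \<open>p\<close> is spanned by
  \<open>(z - z(p))\<^sup>-\<^sup>m F\<^sub>z\<close>, extended smoothly over \<open>p\<close>, where \<open>m\<close> is the order of branching at \<open>p\<close>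
  (\<open>m = 0\<close> unless \<open>p\<close> is a branch point). These conditions determine \<open>\<Xi>\<close>.\<close>

definition ramified_tangent_bundle ::
  "('s::topological_space, complex) chart set \<Rightarrow> ('m::topological_space, real^'n) chart set \<Rightarrow>
   ('s \<Rightarrow> 'm) \<Rightarrow> ('s \<Rightarrow> ('m, 'n, complex) tvec set) \<Rightarrow> bool" where
  "ramified_tangent_bundle S A F \<Xi> \<longleftrightarrow>
     (\<forall>p. \<exists>z\<in>S. \<exists>N W m. open N \<and> p \<in> N \<and> N \<subseteq> fst z \<and> smooth_section_on S A F N W \<and>
        (\<forall>q\<in>N. W q \<noteq> (\<lambda>c. 0) \<and>
           F_z A F z q = (\<lambda>c. (snd z q - snd z p) ^ m *s W q c) \<and>
           \<Xi> q = {(\<lambda>c. a *s W q c) | a. True}))"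

text \<open>The following fibres at a point are determined by the fibre \<open>L\<close> of the (1,0) part.\<close>

definition xi01 :: "('m, 'n::finite, complex) tvec set \<Rightarrow> ('m, 'n, complex) tvec set" where
  "xi01 L = tcnj ` L"

definition xi_complex :: "('m, 'n::finite, complex) tvec set \<Rightarrow> ('m, 'n, complex) tvec set" where
  "xi_complex L = {(\<lambda>c. U c + V c) | U V. U \<in> L \<and> V \<in> xi01 L}"

definition xi :: "('m, 'n::finite, complex) tvec set \<Rightarrow> ('m, 'n, real) tvec set" where
  "xi L = {u. tof_real u \<in> xi_complex L}"

definition nu ::
  "('m, real^'n) chart set \<Rightarrow> ('m \<Rightarrow> ('m, 'n, real) tvec \<Rightarrow> ('m, 'n, real) tvec \<Rightarrow> real) \<Rightarrow> 'm \<Rightarrow>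
   ('m, 'n, complex) tvec set \<Rightarrow> ('m, 'n, real) tvec set" where
  "nu A g q L = {v \<in> tangent_space A q. \<forall>u \<in> xi L. g q u v = 0}"

definition nu_complex ::
  "('m, real^'n) chart set \<Rightarrow> ('m \<Rightarrow> ('m, 'n, real) tvec \<Rightarrow> ('m, 'n, real) tvec \<Rightarrow> real) \<Rightarrow> 'm \<Rightarrow>
   ('m, 'n, complex) tvec set \<Rightarrow> ('m, 'n, complex) tvec set" where
  "nu_complex A g q L = {V. tRe V \<in> nu A g q L \<and> tIm V \<in> nu A g q L}"

definition tangential ::
  "('m, real^'n) chart set \<Rightarrow> ('m \<Rightarrow> ('m, 'n, real) tvec \<Rightarrow> ('m, 'n, real) tvec \<Rightarrow> real) \<Rightarrow> 'm \<Rightarrow>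
   ('m, 'n, complex) tvec set \<Rightarrow> ('m, 'n, complex) tvec \<Rightarrow> ('m, 'n, complex) tvec" where
  "tangential A g q L V =
     (THE T. T \<in> xi_complex L \<and> (\<lambda>c. V c - T c) \<in> nu_complex A g q L)"

definition normal ::
  "('m, real^'n) chart set \<Rightarrow> ('m \<Rightarrow> ('m, 'n, real) tvec \<Rightarrow> ('m, 'n, real) tvec \<Rightarrow> real) \<Rightarrow> 'm \<Rightarrow>
   ('m, 'n, complex) tvec set \<Rightarrow> ('m, 'n, complex) tvec \<Rightarrow> ('m, 'n, complex) tvec" where
  "normal A g q L V = (\<lambda>c. V c - tangential A g q L V c)"

definition part01 ::
  "('m, 'n::finite, complex) tvec set \<Rightarrow> ('m, 'n, real) tvec \<Rightarrow> ('m, 'n, complex) tvec" where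
  "part01 L u = (THE V. V \<in> xi01 L \<and> (\<lambda>c. tof_real u c - V c) \<in> L)"

text \<open>The connection \<open>D\<close> on the complexified ramified tangent bundle in the direction \<open>\<partial>\<^sub>z\<close>.\<close>

definition D_z ::
  "('m, real^'n) chart set \<Rightarrow> ('m \<Rightarrow> ('m, 'n, real) tvec \<Rightarrow> ('m, 'n, real) tvec \<Rightarrow> real) \<Rightarrow>
   ('s \<Rightarrow> 'm) \<Rightarrow> ('s \<Rightarrow> ('m, 'n, complex) tvec set) \<Rightarrow> ('s, complex) chart \<Rightarrow>
   ('s \<Rightarrow> ('m, 'n, complex) tvec) \<Rightarrow> 's \<Rightarrow> ('m, 'n, complex) tvec" where
  "D_z A g F \<Xi> z V p = tangential A g (F p) (\<Xi> p) (nabla_z A g F z V p)"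

definition smooth_normal_section ::
  "('s, complex) chart set \<Rightarrow> ('m, real^'n) chart set \<Rightarrow>
   ('m \<Rightarrow> ('m, 'n, real) tvec \<Rightarrow> ('m, 'n, real) tvec \<Rightarrow> real) \<Rightarrow> ('s \<Rightarrow> 'm) \<Rightarrow>
   ('s \<Rightarrow> ('m, 'n, complex) tvec set) \<Rightarrow> ('s \<Rightarrow> ('m, 'n, real) tvec) \<Rightarrow> bool" where
  "smooth_normal_section S A g F \<Xi> s \<longleftrightarrow>
     smooth_section_on S A F UNIV s \<and> (\<forall>p. s p \<in> nu A g (F p) (\<Xi> p))"

definition smooth_tangential_section ::
  "('s, complex) chart set \<Rightarrow> ('m, real^'n) chart set \<Rightarrow> ('s \<Rightarrow> 'm) \<Rightarrow>
   ('s \<Rightarrow> ('m, 'n, complex) tvec set) \<Rightarrow> ('s \<Rightarrow> ('m, 'n, real) tvec) \<Rightarrow> bool" where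
  "smooth_tangential_section S A F \<Xi> \<sigma> \<longleftrightarrow>
     smooth_section_on S A F UNIV \<sigma> \<and> (\<forall>p. \<sigma> p \<in> xi (\<Xi> p))"


section \<open>Integration over the surface and the second variations\<close>

definition partition_of_unity ::
  "('s::topological_space, complex) chart set \<Rightarrow> ('s, complex) chart set \<Rightarrow>
   (('s, complex) chart \<Rightarrow> 's \<Rightarrow> real) \<Rightarrow> bool" where
  "partition_of_unity S C \<rho> \<longleftrightarrow> finite C \<and> C \<subseteq> S \<and>
     (\<forall>c\<in>C. (\<forall>p. \<rho> c p \<ge> 0) \<and> closure {p. \<rho> c p \<noteq> 0} \<subseteq> fst c \<and>
        (\<forall>z\<in>S. C_inf_on (snd z ` fst z) (\<rho> c \<circ> chart_inv z))) \<and>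
     (\<forall>p. (\<Sum>c\<in>C. \<rho> c p) = 1)"

text \<open>The integral of a continuous 2-form on a closed surface, where \<open>\<omega> z\<close> is the coefficient of
  \<open>dx dy\<close> in the chart \<open>z = x + iy\<close>. It does not depend on the choice of the partition of unity.\<close>

definition surface_integral ::
  "('s::topological_space, complex) chart set \<Rightarrow> (('s, complex) chart \<Rightarrow> 's \<Rightarrow> real) \<Rightarrow> real" where
  "surface_integral S \<omega> = (SOME I. \<exists>C \<rho>. partition_of_unity S C \<rho> \<and>
     I = (\<Sum>c\<in>C. set_lebesgue_integral lborel (snd c ` fst c)
            (\<lambda>w. \<rho> c (chart_inv c w) * \<omega> c (chart_inv c w))))"

definition second_variation_energy ::
  "('s::topological_space, complex) chart set \<Rightarrow> ('m, real^'n) chart set \<Rightarrow>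
   ('m \<Rightarrow> ('m, 'n, real) tvec \<Rightarrow> ('m, 'n, real) tvec \<Rightarrow> real) \<Rightarrow> ('s \<Rightarrow> 'm) \<Rightarrow>
   ('s \<Rightarrow> ('m, 'n, real) tvec) \<Rightarrow> real" where
  "second_variation_energy S A g F v = surface_integral S (\<lambda>z p.
     g (F p) (nabla A g F z 1 v p) (nabla A g F z 1 v p)
     + g (F p) (nabla A g F z \<i> v p) (nabla A g F z \<i> v p)
     - g (F p) (curvature A g (F p) (v p) (pushforward A F z 1 p) (pushforward A F z 1 p)) (v p)
     - g (F p) (curvature A g (F p) (v p) (pushforward A F z \<i> p) (pushforward A F z \<i> p)) (v p))"

text \<open>The curvature term below is real by the symmetries of the curvature tensor, hence \<open>Re\<close>.\<close>

definition second_variation_area ::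
  "('s::topological_space, complex) chart set \<Rightarrow> ('m, real^'n) chart set \<Rightarrow>
   ('m \<Rightarrow> ('m, 'n, real) tvec \<Rightarrow> ('m, 'n, real) tvec \<Rightarrow> real) \<Rightarrow> ('s \<Rightarrow> 'm) \<Rightarrow>
   ('s \<Rightarrow> ('m, 'n, complex) tvec set) \<Rightarrow> ('s \<Rightarrow> ('m, 'n, real) tvec) \<Rightarrow> real" where
  "second_variation_area S A g F \<Xi> s = 4 * surface_integral S (\<lambda>z p.
     let ds = nabla_z A g F z (tof_real \<circ> s) p in
     hermitian_norm_sq g (F p) (normal A g (F p) (\<Xi> p) ds)
     - hermitian_norm_sq g (F p) (tangential A g (F p) (\<Xi> p) ds)
     - Re (metric_bilinear g (F p)
         (curvature A g (F p) (tof_real (s p)) (F_z A F z p) (tcnj (F_z A F z p)))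
         (tof_real (s p))))"

end

theory Submission
  imports Defs "HOL-Complex_Analysis.Cauchy_Integral_Formula"
begin

text \<open>
  Write \<open>\<tau> = \<sigma>\<^sup>0\<^sup>,\<^sup>1\<close> and let \<open>\<kappa>\<close> be twice its imaginary part, which up to sign is the section \<open>J\<sigma>\<close> of \<open>\<xi>\<close>.
  Away from the branch points \<open>\<xi>\<^sup>1\<^sup>,\<^sup>0\<close> is spanned by \<open>F\<^sub>z\<close>, which is null since \<open>F\<close> is conformal and satisfies
  \<open>\<nabla>\<^bsub>zbar\<^esub> F\<^sub>z = 0\<close> since \<open>F\<close> is harmonic; by continuity a smooth local frame \<open>W\<close> of \<open>\<xi>\<^sup>1\<^sup>,\<^sup>0\<close> has both
  properties everywhere. Hence \<open>\<nabla>\<^sub>z\<tau>\<close> is tangential, and with the symmetries of the curvature tensor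
  the integrand of the second variation of the energy at \<open>s + \<sigma>\<close> is, in every chart of the surface,
  the integrand of the second variation of the area at \<open>s\<close> plus
  \<open>8 |D\<^sub>z\<tau> + (\<nabla>\<^sub>z s)\<^sup>T|\<^sup>2 + \<partial>\<^sub>x \<alpha>\<^sub>y - \<partial>\<^sub>y \<alpha>\<^sub>x\<close> for the global 1-form \<open>\<alpha> = - \<langle>\<sigma> + 2 s, \<nabla>\<kappa>\<rangle>\<close>.
  By Stokes' theorem the last two terms integrate to \<open>0\<close>.
\<close>

section \<open>Calculus of smooth maps\<close>

text \<open>The difference between the energy integrand at \<open>s + \<sigma>\<close> and at
  \<open>s\<close> contains terms linear and terms quadratic in \<open>\<sigma>\<close>, and neither
  group has a sign. The rotated section \<open>\<kappa>\<close> repairs this: it turns the curvature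
  terms into \<open>R(F_x, F_y)\<kappa>\<close>, which is the commutator of two covariant
  derivatives of \<open>\<kappa>\<close>. Such a commutator, paired with a field, is an exterior
  derivative up to products of first derivatives, and exactly these products complete the square.
  Two obstacles shape the development. The tangential projection and the (0,1) part are pointwise
  descriptions whose natural spanning vector \<open>F_z\<close> vanishes at branch points, so
  smoothness and all first order identities have to be read off from nonvanishing local frames.
  Moreover tangent vectors are families of coordinate vectors and the surface integral is a choice
  among partitions of unity. Hence the invariance of connection and curvature under coordinate
  changes, the existence of partitions of unity and the independence of the integral from them must
  be established before the pointwise identity can be integrated.\<close>

text \<open>Lets an explicit derivative \<open>f'\<close> take the place of
  \<open>frechet_derivative\<close>. Invariance under pointwise equality is a premise here because
  it is itself proved through this rule: in that induction the premise is the induction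
  hypothesis.\<close>

lemma C_k_on_SucI_aux:
  assumes "\<And>x. x \<in> U \<Longrightarrow> (f has_derivative f' x) (at x)"
    and "\<And>e. e \<in> Basis \<Longrightarrow> C_k_on k U (\<lambda>x. f' x e)" and "open U"
    and cong: "\<And>f g. (\<And>x. x \<in> U \<Longrightarrow> f x = g x) \<Longrightarrow> C_k_on k U f \<Longrightarrow> C_k_on k U (g :: _ \<Rightarrow> 'b)"
  shows "C_k_on (Suc k) U (f :: 'a::euclidean_space \<Rightarrow> 'b::real_normed_vector)"
proof -
  have "frechet_derivative f (at x) = f' x" if "x \<in> U" for x
    using assms(1)[OF that] frechet_derivative_at by metis
  then show ?thesis
    using assms by (auto simp: differentiable_def intro!: cong[of "\<lambda>x. f' x e" for e])
qed

lemma C_k_on_cong: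
  fixes f :: "'a::euclidean_space \<Rightarrow> 'b::real_normed_vector"
  assumes "open U" "\<And>x. x \<in> U \<Longrightarrow> f x = g x" "C_k_on k U f"
  shows "C_k_on k U g"
  using assms(2,3)
proof (induction k arbitrary: f g)
  case 0
  then show ?case by (auto cong: continuous_on_cong)
next
  case (Suc k)
  have "(g has_derivative frechet_derivative f (at x)) (at x)" if "x \<in> U" for x
    using Suc.prems that assms(1)
    by (auto intro: has_derivative_transform_within_open[of f] simp: frechet_derivative_works[symmetric])
  then show ?case
    using Suc by (intro C_k_on_SucI_aux[OF _ _ assms(1)]) auto
qed

lemmas C_k_on_SucI = C_k_on_SucI_aux[OF _ _ _ C_k_on_cong]

lemma C_k_on_has_derivative:
  "C_k_on (Suc k) U f \<Longrightarrow> x \<in> U \<Longrightarrow> (f has_derivative frechet_derivative f (at x)) (at x)"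
  by (simp add: frechet_derivative_works)

lemma C_k_on_SucD: "C_k_on (Suc k) U f \<Longrightarrow> C_k_on k U f"
proof (induction k arbitrary: f)
  case 0
  then show ?case
    by (auto intro!: continuous_at_imp_continuous_on differentiable_imp_continuous_within)
next
  case (Suc k)
  then show ?case by auto
qed

lemma C_k_on_mono: "j \<le> k \<Longrightarrow> C_k_on k U f \<Longrightarrow> C_k_on j U f"
proof (induction rule: dec_induct)
  case (step n)
  then show ?case using C_k_on_SucD[of n U f] by simp
qed

lemma C_k_on_imp_continuous_on: "C_k_on k U f \<Longrightarrow> continuous_on U f"
  using C_k_on_mono[of 0 k U f] by simp

lemma C_k_on_subset: "C_k_on k U f \<Longrightarrow> V \<subseteq> U \<Longrightarrow> C_k_on k V f"
  by (induction k arbitrary: f) (auto intro: continuous_on_subset)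

lemma C_k_on_local:
  assumes "\<And>x. x \<in> U \<Longrightarrow> \<exists>V. open V \<and> x \<in> V \<and> C_k_on k V f"
  shows "C_k_on k U f"
  using assms
proof (induction k arbitrary: f)
  case 0
  then show ?case
    by (auto intro!: continuous_at_imp_continuous_on simp: continuous_on_eq_continuous_at)
       (metis continuous_on_eq_continuous_at)
next
  case (Suc k)
  then show ?case by (auto; metis)
qed

lemma C_k_on_const [simp]: "C_k_on k U (\<lambda>x. c)"
  by (induction k arbitrary: c) auto

lemma C_k_on_ident [simp]: "C_k_on k U (\<lambda>x. x)"
  by (cases k) auto

lemma C_k_on_linear:
  assumes "bounded_linear h" "open U" "C_k_on k U f"
  shows "C_k_on k U (\<lambda>x. h (f x))"
  using assms(3)
proof (induction k arbitrary: f)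
  case 0
  then show ?case
    using linear_continuous_on_compose bounded_linear.linear continuous_on_compose2
      linear_continuous_on[OF assms(1)] by (metis C_k_on.simps(1) subset_UNIV)
next
  case (Suc k)
  show ?case
    by (rule C_k_on_SucI[where f' = "\<lambda>x e. h (frechet_derivative f (at x) e)"])
       (use Suc assms in \<open>auto intro!: bounded_linear.has_derivative[OF assms(1)]
          simp: frechet_derivative_works[symmetric]\<close>)
qed

lemma C_k_on_add:
  assumes "open U" "C_k_on k U f" "C_k_on k U g"
  shows "C_k_on k U (\<lambda>x. f x + g x)"
  using assms(2,3)
proof (induction k arbitrary: f g)
  case 0
  then show ?case by (auto intro: continuous_intros)
next
  case (Suc k)
  show ?case
    by (rule C_k_on_SucI[where f' = "\<lambda>x e. frechet_derivative f (at x) e + frechet_derivative g (at x) e"])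
       (use Suc assms in \<open>auto intro!: has_derivative_add simp: frechet_derivative_works[symmetric]\<close>)
qed

lemma C_k_on_sum:
  assumes "open U" "\<And>i. i \<in> I \<Longrightarrow> C_k_on k U (f i)"
  shows "C_k_on k U (\<lambda>x. \<Sum>i\<in>I. f i x)"
  using assms(2)
  by (induction I rule: infinite_finite_induct) (auto intro: C_k_on_add assms(1))

lemma C_k_on_bilinear:
  assumes "bounded_bilinear h" "open U" "C_k_on k U f" "C_k_on k U g"
  shows "C_k_on k U (\<lambda>x. h (f x) (g x))"
  using assms(3,4)
proof (induction k arbitrary: f g)
  case 0
  then show ?case by (auto intro: bounded_bilinear.continuous_on[OF assms(1)])
next
  case (Suc k)
  show ?case
  proof (rule C_k_on_SucI[where
        f' = "\<lambda>x e. h (f x) (frechet_derivative g (at x) e) + h (frechet_derivative f (at x) e) (g x)"])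
    show "((\<lambda>x. h (f x) (g x)) has_derivative
        (\<lambda>e. h (f x) (frechet_derivative g (at x) e) + h (frechet_derivative f (at x) e) (g x))) (at x)"
      if "x \<in> U" for x
      using Suc.prems that
      by (auto intro!: bounded_bilinear.FDERIV[OF assms(1)] simp: frechet_derivative_works[symmetric])
    show "C_k_on k U (\<lambda>x. h (f x) (frechet_derivative g (at x) e) + h (frechet_derivative f (at x) e) (g x))"
      if "e \<in> Basis" for e
      using Suc.prems that C_k_on_SucD
      by (intro C_k_on_add assms Suc.IH) (blast intro: C_k_on_SucD | simp)+
  qed (use assms in auto)
qed

lemmas C_k_on_mult = C_k_on_bilinear[OF bounded_bilinear_mult]
lemmas C_k_on_scaleR = C_k_on_bilinear[OF bounded_bilinear_scaleR]
lemmas C_k_on_inner = C_k_on_bilinear[OF bounded_bilinear_inner]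

lemma C_k_on_uminus: "open U \<Longrightarrow> C_k_on k U f \<Longrightarrow> C_k_on k U (\<lambda>x. - f x)"
  by (rule C_k_on_linear[OF bounded_linear_minus[OF bounded_linear_ident]])

lemma C_k_on_diff:
  "open U \<Longrightarrow> C_k_on k U f \<Longrightarrow> C_k_on k U g \<Longrightarrow> C_k_on k U (\<lambda>x. f x - g x)"
  using C_k_on_add[of U k f "\<lambda>x. - g x"] by (simp add: C_k_on_uminus)

lemma C_k_on_of_real:
  "open U \<Longrightarrow> C_k_on k U f \<Longrightarrow> C_k_on k U (\<lambda>x. of_real (f x) :: 'k::real_normed_field)"
  by (rule C_k_on_linear[OF bounded_linear_of_real])

lemma C_k_on_prod:
  fixes f :: "'i \<Rightarrow> 'a::euclidean_space \<Rightarrow> real"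
  assumes "open U" "\<And>i. i \<in> I \<Longrightarrow> C_k_on k U (f i)"
  shows "C_k_on k U (\<lambda>x. \<Prod>i\<in>I. f i x)"
  using assms(2)
  by (induction I rule: infinite_finite_induct) (auto intro: C_k_on_mult assms(1))

lemma C_k_on_vec_nth: "open U \<Longrightarrow> C_k_on k U f \<Longrightarrow> C_k_on k U (\<lambda>x. f x $ i)"
  by (rule C_k_on_linear[OF bounded_linear_vec_nth])

lemma bounded_linear_axis: "bounded_linear (axis i :: 'b::real_normed_vector \<Rightarrow> 'b^'n)"
proof
  show "axis i (x + y) = (axis i x + axis i y :: 'b^'n)"
    and "axis i (r *\<^sub>R x) = (r *\<^sub>R axis i x :: 'b^'n)" for x y r
    by (auto simp: vec_eq_iff axis_def)
  have "norm (axis i x :: 'b^'n) \<le> norm x * 1" for x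
    using L2_set_le_sum[of UNIV "\<lambda>j. norm ((axis i x :: 'b^'n) $ j)"]
    by (simp add: norm_vec_def axis_def if_distrib[of norm] sum.delta cong: if_cong)
  then show "\<exists>K. \<forall>x. norm (axis i x :: 'b^'n) \<le> norm x * K" by blast
qed

lemma vec_sum_axis: "(x :: 'b::comm_monoid_add^'n) = (\<Sum>i\<in>UNIV. axis i (x $ i))"
  by (auto simp: vec_eq_iff axis_def if_distrib sum.delta cong: if_cong)

lemma C_k_on_vec:
  fixes f :: "'a::euclidean_space \<Rightarrow> 'b::real_normed_vector^'n"
  assumes "open U" "\<And>i. C_k_on k U (\<lambda>x. f x $ i)"
  shows "C_k_on k U f"
proof -
  have "C_k_on k U (\<lambda>x. \<Sum>i\<in>UNIV. axis i (f x $ i))"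
    by (intro C_k_on_sum C_k_on_linear[OF bounded_linear_axis] assms)
  then show ?thesis using vec_sum_axis[of "f x" for x] by simp
qed

text \<open>The recursion in \<open>C_k_on\<close> controls basis directions only; linearity of the
  derivative extends this to every direction \<open>e\<close>.\<close>

lemma C_k_on_frechet_derivative:
  assumes "open U" "C_k_on (Suc k) U f"
  shows "C_k_on k U (\<lambda>x. frechet_derivative f (at x) e)"
proof (rule C_k_on_cong[OF assms(1)])
  show "C_k_on k U (\<lambda>x. \<Sum>b\<in>Basis. (e \<bullet> b) *\<^sub>R frechet_derivative f (at x) b)"
    using assms by (intro C_k_on_sum C_k_on_linear[OF bounded_linear_scaleR_right]) auto
  show "(\<Sum>b\<in>Basis. (e \<bullet> b) *\<^sub>R frechet_derivative f (at x) b) = frechet_derivative f (at x) e"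
    if "x \<in> U" for x
  proof -
    interpret linear "frechet_derivative f (at x)"
      using C_k_on_has_derivative[OF assms(2) that] has_derivative_linear by blast
    show ?thesis
      by (subst (2) euclidean_representation[symmetric]) (simp add: sum scale)
  qed
qed

lemma C_k_on_compose:
  fixes g :: "'b::euclidean_space \<Rightarrow> 'c::real_normed_vector"
    and f :: "'a::euclidean_space \<Rightarrow> 'b"
  assumes "open U" "open V" "f ` U \<subseteq> V" "C_k_on k U f" "C_k_on k V g"
  shows "C_k_on k U (\<lambda>x. g (f x))"
  using assms(3-5)
proof (induction k arbitrary: g f)
  case 0
  then show ?case by (auto intro: continuous_on_compose2)
next
  case (Suc k)
  \<comment> \<open>Expanding the outer derivative in a basis makes the chain rule a sum of products
    of scalar functions with compositions of lower order, to which the induction hypothesis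
    applies.\<close>
  let ?f' = "\<lambda>x e. \<Sum>b\<in>Basis. (frechet_derivative f (at x) e \<bullet> b) *\<^sub>R frechet_derivative g (at (f x)) b"
  show ?case
  proof (rule C_k_on_SucI[where f' = ?f'])
    show "((\<lambda>x. g (f x)) has_derivative ?f' x) (at x)" if "x \<in> U" for x
    proof -
      have fx: "f x \<in> V" using that Suc.prems by auto
      have "linear (frechet_derivative g (at (f x)))"
        using C_k_on_has_derivative[OF Suc.prems(3) fx] has_derivative_linear by blast
      then have "frechet_derivative g (at (f x)) (frechet_derivative f (at x) e) = ?f' x e" for e
        by (subst euclidean_representation[symmetric]) (simp add: linear_sum linear_scale)
      then show ?thesis
        using has_derivative_compose[OF C_k_on_has_derivative[OF Suc.prems(2) that]
            C_k_on_has_derivative[OF Suc.prems(3) fx]] by simp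
    qed
    show "C_k_on k U (\<lambda>x. ?f' x e)" if "e \<in> Basis" for e
    proof (intro C_k_on_sum C_k_on_scaleR assms(1))
      fix b :: 'b assume b: "b \<in> Basis"
      show "C_k_on k U (\<lambda>x. frechet_derivative f (at x) e \<bullet> b)"
        using Suc.prems(2) that
        by (intro C_k_on_linear[OF bounded_linear_inner_left] assms) auto
      show "C_k_on k U (\<lambda>x. frechet_derivative g (at (f x)) b)"
        using Suc.prems b C_k_on_SucD[OF Suc.prems(2)] by (intro Suc.IH) auto
    qed
  qed (use assms in auto)
qed

text \<open>On the punctured field the derivative of \<open>inverse\<close> is polynomial in
  \<open>inverse\<close>, so an induction on the order closes; composition gives the general
  case.\<close>

lemma C_k_on_inverse:
  fixes f :: "'a::euclidean_space \<Rightarrow> 'k::{real_normed_field, euclidean_space}"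
  assumes "open U" "\<And>x. x \<in> U \<Longrightarrow> f x \<noteq> 0" "C_k_on k U f"
  shows "C_k_on k U (\<lambda>x. inverse (f x))"
proof -
  have "C_k_on k (- {0 :: 'k}) inverse"
  proof (induction k)
    case 0
    then show ?case by (auto intro!: continuous_intros)
  next
    case (Suc k)
    have op: "open (- {0 :: 'k})" by auto
    show ?case
      by (rule C_k_on_SucI[where f' = "\<lambda>x e. - (inverse x * e * inverse x)"])
         (use op Suc in \<open>auto intro!: has_derivative_inverse' C_k_on_uminus C_k_on_mult\<close>)
  qed
  then show ?thesis
    by (intro C_k_on_compose[OF assms(1) _ _ assms(3), of "- {0}"]) (use assms(2) in auto)
qed

lemma holomorphic_on_imp_C_k_on:
  assumes "open U" "f holomorphic_on U"
  shows "C_k_on k U f"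
  using assms(2)
proof (induction k arbitrary: f)
  case 0
  then show ?case by (simp add: holomorphic_on_imp_continuous_on)
next
  case (Suc k)
  show ?case
  proof (rule C_k_on_SucI[where f' = "\<lambda>x e. deriv f x * e"])
    show "(f has_derivative (*) (deriv f x)) (at x)" if "x \<in> U" for x
      using holomorphic_derivI[OF Suc.prems assms(1) that] by (simp add: has_field_derivative_def)
    show "C_k_on k U (\<lambda>x. deriv f x * e)" for e
      by (intro Suc.IH holomorphic_intros holomorphic_deriv Suc.prems assms(1))
  qed (use assms in auto)
qed

text \<open>Both mixed derivatives are limits of the same second difference quotient.\<close>

lemma symmetric_second_derivative_real:
  fixes f :: "'a::euclidean_space \<Rightarrow> real"
  assumes "open U" "C_k_on 2 U f" "x \<in> U"
  shows "frechet_derivative (\<lambda>y. frechet_derivative f (at y) a) (at x) b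
       = frechet_derivative (\<lambda>y. frechet_derivative f (at y) b) (at x) a"
proof -
  define D where "D a b y = frechet_derivative (\<lambda>y. frechet_derivative f (at y) a) (at y) b" for a b y
  have C2: "C_k_on (Suc (Suc 0)) U f" using assms(2) by (simp add: numeral_2_eq_2)
  have mvt: "\<exists>s t. s \<in> {0<..<h} \<and> t \<in> {0<..<h} \<and>
      f (x + h *\<^sub>R a + h *\<^sub>R b) - f (x + h *\<^sub>R a) - f (x + h *\<^sub>R b) + f x = h * h * D a b (x + s *\<^sub>R a + t *\<^sub>R b)"
    if "h > 0" and sub: "\<And>s t. s \<in> {0..h} \<Longrightarrow> t \<in> {0..h} \<Longrightarrow> x + s *\<^sub>R a + t *\<^sub>R b \<in> U" for a b h
  proof -
    have d1: "((\<lambda>s. f (x + s *\<^sub>R a + t *\<^sub>R b)) has_real_derivative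
        frechet_derivative f (at (x + s *\<^sub>R a + t *\<^sub>R b)) a) (at s)" if "x + s *\<^sub>R a + t *\<^sub>R b \<in> U" for s t
    proof -
      have "((\<lambda>s. f (x + s *\<^sub>R a + t *\<^sub>R b)) has_derivative
          (\<lambda>r. frechet_derivative f (at (x + s *\<^sub>R a + t *\<^sub>R b)) (r *\<^sub>R a))) (at s)"
        by (rule has_derivative_compose[where f = "\<lambda>s. x + s *\<^sub>R a + t *\<^sub>R b", OF _ C_k_on_has_derivative[OF C2 that]])
           (auto intro!: derivative_eq_intros)
      moreover have "linear (frechet_derivative f (at (x + s *\<^sub>R a + t *\<^sub>R b)))"
        using C_k_on_has_derivative[OF C2 that] has_derivative_linear by blast
      ultimately show ?thesis
        by (simp add: has_field_derivative_def linear_scale mult_commute_abs)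
    qed
    have d2: "((\<lambda>t. frechet_derivative f (at (x + s *\<^sub>R a + t *\<^sub>R b)) a) has_real_derivative
        D a b (x + s *\<^sub>R a + t *\<^sub>R b)) (at t)" if "x + s *\<^sub>R a + t *\<^sub>R b \<in> U" for s t
    proof -
      have C1: "C_k_on (Suc 0) U (\<lambda>y. frechet_derivative f (at y) a)"
        by (rule C_k_on_frechet_derivative[OF assms(1) C2])
      have "((\<lambda>t. frechet_derivative f (at (x + s *\<^sub>R a + t *\<^sub>R b)) a) has_derivative
          (\<lambda>r. D a (r *\<^sub>R b) (x + s *\<^sub>R a + t *\<^sub>R b))) (at t)"
        unfolding D_def by (rule has_derivative_compose[where f = "\<lambda>t. x + s *\<^sub>R a + t *\<^sub>R b", OF _ C_k_on_has_derivative[OF C1 that]])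
           (auto intro!: derivative_eq_intros)
      moreover have "D a (r *\<^sub>R b) y = r * D a b y" if "y \<in> U" for r y
        using linear_scale[OF has_derivative_linear[OF C_k_on_has_derivative[OF C1 that]], of r b]
        by (simp add: D_def)
      ultimately show ?thesis
        using that by (simp add: has_field_derivative_def mult_commute_abs)
    qed
    define u where "u s = f (x + s *\<^sub>R a + h *\<^sub>R b) - f (x + s *\<^sub>R a + 0 *\<^sub>R b)" for s
    have "\<exists>s. 0 < s \<and> s < h \<and> u h - u 0 = (h - 0) * (frechet_derivative f (at (x + s *\<^sub>R a + h *\<^sub>R b)) a
         - frechet_derivative f (at (x + s *\<^sub>R a + 0 *\<^sub>R b)) a)"
      using \<open>h > 0\<close> unfolding u_def by (intro MVT2 DERIV_diff d1 sub) auto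
    then obtain s where s: "0 < s" "s < h" and us: "u h - u 0 = h * (frechet_derivative f (at (x + s *\<^sub>R a + h *\<^sub>R b)) a
         - frechet_derivative f (at (x + s *\<^sub>R a + 0 *\<^sub>R b)) a)" by auto
    have "\<exists>t. 0 < t \<and> t < h \<and> frechet_derivative f (at (x + s *\<^sub>R a + h *\<^sub>R b)) a
         - frechet_derivative f (at (x + s *\<^sub>R a + 0 *\<^sub>R b)) a = (h - 0) * D a b (x + s *\<^sub>R a + t *\<^sub>R b)"
      using \<open>h > 0\<close> s by (intro MVT2 d2 sub) auto
    then obtain t where "0 < t" "t < h" "frechet_derivative f (at (x + s *\<^sub>R a + h *\<^sub>R b)) a
         - frechet_derivative f (at (x + s *\<^sub>R a + 0 *\<^sub>R b)) a = h * D a b (x + s *\<^sub>R a + t *\<^sub>R b)" by auto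
    then show ?thesis
      using us s by (intro exI[of _ s] exI[of _ t]) (auto simp: u_def)
  qed
  have cont: "isCont (D a b) x" for a b
  proof -
    have "continuous_on U (D a b)"
      unfolding D_def
      using C_k_on_frechet_derivative[OF assms(1) C_k_on_frechet_derivative[OF assms(1) C2]] by simp
    then show ?thesis using assms continuous_on_eq_continuous_at by blast
  qed
  have "D a b x = D b a x"
  proof (rule ccontr)
    assume ne: "D a b x \<noteq> D b a x"
    define e where "e = \<bar>D a b x - D b a x\<bar> / 2"
    have "e > 0" using ne by (simp add: e_def)
    obtain r1 r2 where "r1 > 0" "r2 > 0"
      and r1: "\<And>y. dist y x < r1 \<Longrightarrow> dist (D a b y) (D a b x) < e"
      and r2: "\<And>y. dist y x < r2 \<Longrightarrow> dist (D b a y) (D b a x) < e"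
      using cont[of a b] cont[of b a] \<open>e > 0\<close> unfolding continuous_at_eps_delta by (metis dist_norm)
    obtain r3 where "r3 > 0" and r3: "ball x r3 \<subseteq> U"
      using assms openE by blast
    define r where "r = min r1 (min r2 r3)"
    have "r > 0" using \<open>r1 > 0\<close> \<open>r2 > 0\<close> \<open>r3 > 0\<close> by (simp add: r_def)
    define c where "c = norm a + norm b + 1"
    have "c > 0" by (simp add: c_def add_nonneg_pos)
    \<comment> \<open>With this side length the whole parallelogram spanned at \<open>x\<close>
      stays within distance \<open>r / 2\<close> of \<open>x\<close>, hence inside \<open>U\<close>
      and inside both neighbourhoods of continuity.\<close>
    define h where "h = r / (2 * c)"
    have "h > 0" using \<open>r > 0\<close> \<open>c > 0\<close> by (simp add: h_def)
    have near: "dist (x + s *\<^sub>R a + t *\<^sub>R b) x < r" if "s \<in> {0..h}" "t \<in> {0..h}" for s t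
    proof -
      have "dist (x + s *\<^sub>R a + t *\<^sub>R b) x \<le> \<bar>s\<bar> * norm a + \<bar>t\<bar> * norm b"
        using norm_triangle_ineq[of "s *\<^sub>R a" "t *\<^sub>R b"] by (simp add: dist_norm algebra_simps)
      also have "\<dots> \<le> h * norm a + h * norm b"
        using that by (intro add_mono mult_right_mono) auto
      also have "\<dots> \<le> h * c" using \<open>h > 0\<close> by (simp add: c_def algebra_simps)
      also have "\<dots> = r / 2" using \<open>c > 0\<close> by (simp add: h_def)
      also have "\<dots> < r" using \<open>r > 0\<close> by simp
      finally show ?thesis .
    qed
    have inU: "x + s *\<^sub>R a + t *\<^sub>R b \<in> U" if "s \<in> {0..h}" "t \<in> {0..h}" for s t
      using near[OF that] r3 by (auto simp: r_def dist_commute)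
    have swap: "x + s *\<^sub>R b + t *\<^sub>R a = x + t *\<^sub>R a + s *\<^sub>R b" for s t by simp
    obtain s t where st: "s \<in> {0<..<h}" "t \<in> {0<..<h}"
      "f (x + h *\<^sub>R a + h *\<^sub>R b) - f (x + h *\<^sub>R a) - f (x + h *\<^sub>R b) + f x = h * h * D a b (x + s *\<^sub>R a + t *\<^sub>R b)"
      using mvt[OF \<open>h > 0\<close> inU] by blast
    obtain s' t' where st': "s' \<in> {0<..<h}" "t' \<in> {0<..<h}"
      "f (x + h *\<^sub>R b + h *\<^sub>R a) - f (x + h *\<^sub>R b) - f (x + h *\<^sub>R a) + f x = h * h * D b a (x + s' *\<^sub>R b + t' *\<^sub>R a)"
      using mvt[OF \<open>h > 0\<close>, of b a] inU unfolding swap by blast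
    have "h * h * D a b (x + s *\<^sub>R a + t *\<^sub>R b) = h * h * D b a (x + t' *\<^sub>R a + s' *\<^sub>R b)"
      using st(3) st'(3) by (simp only: swap)
    then have "D a b (x + s *\<^sub>R a + t *\<^sub>R b) = D b a (x + t' *\<^sub>R a + s' *\<^sub>R b)"
      using \<open>h > 0\<close> by (metis less_irrefl mult_cancel_left mult_eq_0_iff)
    moreover have "dist (D a b (x + s *\<^sub>R a + t *\<^sub>R b)) (D a b x) < e"
      using near[of s t] st by (intro r1) (auto simp: r_def)
    moreover have "dist (D b a (x + t' *\<^sub>R a + s' *\<^sub>R b)) (D b a x) < e"
      using near[of t' s'] st' by (intro r2) (auto simp: r_def)
    ultimately show False unfolding e_def dist_real_def by (auto simp: field_simps abs_if split: if_splits)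
  qed
  then show ?thesis by (simp add: D_def)
qed

lemma frechet_derivative_linear:
  assumes "bounded_linear h" "f differentiable (at x)"
  shows "frechet_derivative (\<lambda>y. h (f y)) (at x) e = h (frechet_derivative f (at x) e)"
  using bounded_linear.has_derivative[OF assms(1) assms(2)[unfolded frechet_derivative_works]]
  by (metis frechet_derivative_at)

lemma symmetric_second_derivative:
  fixes f :: "'a::euclidean_space \<Rightarrow> 'b::euclidean_space"
  assumes U: "open U" and f: "C_k_on 2 U f" and x: "x \<in> U"
  shows "frechet_derivative (\<lambda>y. frechet_derivative f (at y) a) (at x) b
       = frechet_derivative (\<lambda>y. frechet_derivative f (at y) b) (at x) a"
proof (rule euclidean_eqI)
  fix i :: 'b
  have C2: "C_k_on (Suc (Suc 0)) U f" using f by (simp add: numeral_2_eq_2)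
  have df: "(\<lambda>y. frechet_derivative f (at y) a) differentiable (at x)" for a
    using C_k_on_frechet_derivative[OF U C2, of a] x by simp
  have fi: "C_k_on 2 U (\<lambda>y. f y \<bullet> i)"
    by (rule C_k_on_linear[OF bounded_linear_inner_left U f])
  have *: "frechet_derivative (\<lambda>y. frechet_derivative (\<lambda>y. f y \<bullet> i) (at y) a) (at x) b
      = frechet_derivative (\<lambda>y. frechet_derivative f (at y) a) (at x) b \<bullet> i" for a b
  proof -
    have "frechet_derivative (\<lambda>y. frechet_derivative f (at y) a \<bullet> i) (at x)
        = frechet_derivative (\<lambda>y. frechet_derivative (\<lambda>y. f y \<bullet> i) (at y) a) (at x)"
      using C2 by (intro frechet_derivative_transform_within_open[OF _ U x])
        (auto simp: frechet_derivative_linear[OF bounded_linear_inner_left]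
          intro!: differentiable_inner[OF df differentiable_const])
    then show ?thesis
      using frechet_derivative_linear[OF bounded_linear_inner_left df] by metis
  qed
  show "frechet_derivative (\<lambda>y. frechet_derivative f (at y) a) (at x) b \<bullet> i
      = frechet_derivative (\<lambda>y. frechet_derivative f (at y) b) (at x) a \<bullet> i"
    using symmetric_second_derivative_real[OF U fi x, of a b] by (simp add: *)
qed

lemma linear_complex:
  assumes "linear (L :: complex \<Rightarrow> 'b::real_vector)"
  shows "L w = Re w *\<^sub>R L 1 + Im w *\<^sub>R L \<i>"
proof -
  have "w = Re w *\<^sub>R 1 + Im w *\<^sub>R \<i>" by (simp add: complex_eq_iff)
  then have "L w = L (Re w *\<^sub>R 1 + Im w *\<^sub>R \<i>)" by (rule arg_cong)
  then show ?thesis using assms by (simp only: linear_add linear_scale)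
qed

section \<open>Integration in the plane\<close>

text \<open>Change of variables is available on \<open>real^'n\<close>, while charts of the surface
  take values in \<open>complex\<close>. Comparing the measures of boxes identifies the two Lebesgue
  measures, so integrals can be carried across.\<close>

lemma lborel_complex_eq:
  "(lborel :: complex measure) = distr (lborel :: (real^2) measure) borel (\<lambda>v. Complex (v$1) (v$2))"
proof (rule lborel_eqI)
  let ?\<iota> = "\<lambda>v :: real^2. Complex (v$1) (v$2)"
  have m: "?\<iota> \<in> borel_measurable borel"
    by (intro borel_measurable_continuous_onI) (auto simp: Complex_eq intro!: continuous_intros)
  fix l u :: complex
  assume le: "\<And>b. b \<in> Basis \<Longrightarrow> l \<bullet> b \<le> u \<bullet> b"
  let ?l = "vector [Re l, Im l] :: real^2" and ?u = "vector [Re u, Im u] :: real^2"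
  have lu: "?l $ i \<le> ?u $ i" for i
    using le[of 1] le[of \<i>] exhaust_2[of i] by (auto simp: Basis_complex_def inner_complex_def)
  have "?\<iota> -` box l u = box ?l ?u"
    by (auto simp: box_def Basis_complex_def Basis_vec_def inner_complex_def inner_axis forall_2)
  then have "emeasure (distr lborel borel ?\<iota>) (box l u) = emeasure lborel (box ?l ?u)"
    using m by (subst emeasure_distr) auto
  also have "\<dots> = (\<Prod>b\<in>Basis. (?u - ?l) \<bullet> b)"
    by (rule emeasure_lborel_box)
       (use lu in \<open>auto simp: Basis_vec_def inner_axis\<close>)
  also have "(\<Prod>b\<in>Basis. (?u - ?l) \<bullet> b) = (\<Prod>b\<in>Basis. (u - l) \<bullet> b)"
  proof -
    have B: "(Basis :: (real^2) set) = {axis 1 1, axis 2 1}"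
      by (auto simp: Basis_vec_def) (metis exhaust_2)
    have "axis 1 1 \<noteq> (axis 2 1 :: real^2)" by (simp add: axis_eq_axis)
    then show ?thesis
      by (simp add: B Basis_complex_def inner_axis inner_complex_def)
  qed
  finally show "emeasure (distr lborel borel ?\<iota>) (box l u) = ennreal (\<Prod>b\<in>Basis. (u - l) \<bullet> b)" .
qed auto

lemma set_lebesgue_integral_holomorphic_image:
  fixes h :: "complex \<Rightarrow> real"
  assumes U: "open U" and hol: "\<phi> holomorphic_on U" and inj: "inj_on \<phi> U"
    and int1: "set_integrable lborel (\<phi> ` U) h"
    and int2: "set_integrable lborel U (\<lambda>w. (norm (deriv \<phi> w))\<^sup>2 * h (\<phi> w))"
  shows "set_lebesgue_integral lborel (\<phi> ` U) h
       = set_lebesgue_integral lborel U (\<lambda>w. (norm (deriv \<phi> w))\<^sup>2 * h (\<phi> w))"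
proof -
  define \<iota> where "\<iota> v = Complex (v$1) (v$2)" for v :: "real^2"
  define \<iota>' where "\<iota>' w = (vector [Re w, Im w] :: real^2)" for w
  have inv [simp]: "\<iota> (\<iota>' w) = w" "\<iota>' (\<iota> v) = v" for w v
    by (auto simp: \<iota>_def \<iota>'_def complex_eq_iff vec_eq_iff forall_2)
  have lin: "bounded_linear \<iota>" "bounded_linear \<iota>'"
    by (auto intro!: linear_linear[THEN iffD2] linearI
        simp: linear_conv_bounded_linear[symmetric] \<iota>_def \<iota>'_def complex_eq_iff vec_eq_iff forall_2)
  have cont: "continuous_on A \<iota>" for A
    by (rule linear_continuous_on[OF lin(1)])
  have m: "\<iota> \<in> borel_measurable borel"
    by (intro borel_measurable_continuous_onI cont)
  have tr: "set_integrable lborel (\<iota> -` A) (\<lambda>v. f (\<iota> v)) \<and>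
      set_lebesgue_integral lborel A f = set_lebesgue_integral lborel (\<iota> -` A) (\<lambda>v. f (\<iota> v))"
    if "set_integrable lborel A f" for A and f :: "complex \<Rightarrow> real"
  proof -
    let ?F = "\<lambda>x. indicator A x *\<^sub>R f x"
    have i: "integrable lborel ?F" using that by (simp add: set_integrable_def)
    then have meas: "?F \<in> borel_measurable borel" by auto
    have *: "indicator (\<iota> -` A) v = (indicator A (\<iota> v) :: real)" for v by (auto simp: indicator_def)
    have d: "(lborel :: complex measure) = distr lborel borel \<iota>"
      using lborel_complex_eq by (simp add: \<iota>_def[abs_def])
    have "integrable lborel (\<lambda>v. ?F (\<iota> v))"
      using i unfolding d using m meas by (subst (asm) integrable_distr_eq) auto
    moreover have "integral\<^sup>L lborel ?F = integral\<^sup>L lborel (\<lambda>v. ?F (\<iota> v))"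
      unfolding d using m meas by (subst integral_distr) auto
    ultimately show ?thesis by (simp add: set_integrable_def set_lebesgue_integral_def *)
  qed
  define \<psi> where "\<psi> v = \<iota>' (\<phi> (\<iota> v))" for v
  define U2 where "U2 = \<iota> -` U"
  have oU2: "open U2"
    unfolding U2_def using cont[of UNIV] U by (simp add: open_vimage)
  have im: "\<psi> ` U2 = \<iota> -` (\<phi> ` U)"
  proof (intro set_eqI iffI)
    fix v assume "v \<in> \<iota> -` (\<phi> ` U)"
    then obtain u where "u \<in> U" "\<iota> v = \<phi> u" by auto
    then have "v = \<psi> (\<iota>' u)" "\<iota>' u \<in> U2" by (auto simp: \<psi>_def U2_def) (metis inv(2))
    then show "v \<in> \<psi> ` U2" by blast
  qed (auto simp: U2_def \<psi>_def)
  have inj2: "inj_on \<psi> U2"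
    using inj unfolding U2_def \<psi>_def inj_on_def by (metis inv vimage_eq)
  define D where "D x v = \<iota>' (deriv \<phi> (\<iota> x) * \<iota> v)" for x v
  have der: "(\<psi> has_derivative D x) (at x within U2)" if "x \<in> U2" for x
  proof -
    have "(\<phi> has_derivative (*) (deriv \<phi> (\<iota> x))) (at (\<iota> x))"
      using holomorphic_derivI[OF hol U, of "\<iota> x"] that by (simp add: has_field_derivative_def U2_def)
    then have "((\<lambda>v. \<phi> (\<iota> v)) has_derivative (\<lambda>v. deriv \<phi> (\<iota> x) * \<iota> v)) (at x)"
      by (rule has_derivative_compose[OF bounded_linear_imp_has_derivative[OF lin(1)]])
    then have "(\<psi> has_derivative D x) (at x)"
      unfolding D_def[abs_def] \<psi>_def[abs_def] by (rule bounded_linear.has_derivative[OF lin(2)])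
    then show ?thesis by (rule has_derivative_at_withinI)
  qed
  \<comment> \<open>Multiplication by a complex number is a rotation composed with a dilation, whose
    real determinant is the squared modulus.\<close>
  have det: "\<bar>det (matrix (D x))\<bar> = (norm (deriv \<phi> (\<iota> x)))\<^sup>2" for x
    unfolding det_2 matrix_def D_def \<iota>_def \<iota>'_def
    by (simp add: axis_def cmod_power2) (simp add: power2_eq_square)
  \<comment> \<open>The change of variables theorem is stated for vector valued integrands, hence
    the detour through \<open>real^1\<close>.\<close>
  define f where "f v = (vec (h (\<iota> v)) :: real^1)" for v
  have ai: "f absolutely_integrable_on (\<psi> ` U2)"
  proof -
    have "set_integrable lborel (\<iota> -` (\<phi> ` U)) (\<lambda>v. h (\<iota> v))" using tr[OF int1] by simp
    then have "(\<lambda>v. h (\<iota> v)) absolutely_integrable_on (\<psi> ` U2)"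
      unfolding im set_integrable_def by (subst integrable_completion) auto
    then show ?thesis by (simp add: f_def absolutely_integrable_on_1_iff)
  qed
  have "integral U2 (\<lambda>x. \<bar>det (matrix (D x))\<bar> *\<^sub>R f (\<psi> x)) = integral (\<psi> ` U2) f"
    using has_absolute_integral_change_of_variables[OF _ der inj2, of f "integral (\<psi> ` U2) f"] ai oU2
    by (simp add: sets_completionI_sets)
  then have "integral U2 (\<lambda>x. (norm (deriv \<phi> (\<iota> x)))\<^sup>2 * h (\<phi> (\<iota> x))) = integral (\<psi> ` U2) (\<lambda>v. h (\<iota> v))"
    unfolding det f_def integral_on_1_eq by (simp add: \<psi>_def vec_eq_iff)
  then show ?thesis
    using tr[OF int1] tr[OF int2] im unfolding U2_def by (simp add: set_borel_integral_eq_integral(2))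
qed

text \<open>Difference quotients of \<open>f\<close> integrate to zero because Lebesgue measure is
  translation invariant, and dominated convergence passes to the derivative. The argument works in
  every direction \<open>e\<close> at once, without iterated integrals.\<close>

lemma integral_frechet_derivative_compact_support:
  fixes f :: "'a::euclidean_space \<Rightarrow> real"
  assumes f: "C_k_on 1 UNIV f" and K: "compact K" and supp: "\<And>x. x \<notin> K \<Longrightarrow> f x = 0"
  shows "integrable lborel (\<lambda>x. frechet_derivative f (at x) e)"
    and "integral\<^sup>L lborel (\<lambda>x. frechet_derivative f (at x) e) = 0"
proof -
  let ?D = "\<lambda>x. frechet_derivative f (at x) e"
  have C1: "C_k_on (Suc 0) UNIV f" using f by simp
  have contf: "continuous_on A f" for A
    using C_k_on_imp_continuous_on[OF f] continuous_on_subset by blast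
  have contD: "continuous_on A ?D" for A
    using C_k_on_frechet_derivative[OF open_UNIV C1, of e] continuous_on_subset by fastforce
  have D0: "?D x = 0" if "x \<notin> K" for x
  proof -
    have "frechet_derivative (\<lambda>x. 0) (at x) = frechet_derivative f (at x)"
      by (rule frechet_derivative_transform_within_open[of _ _ "- K"])
         (use that supp K in \<open>auto simp: compact_imp_closed\<close>)
    then show ?thesis by (metis frechet_derivative_const)
  qed
  obtain M where M: "\<And>x. norm (?D x) \<le> M" "M \<ge> 0"
  proof -
    have "bounded (?D ` K)" using compact_continuous_image[OF contD K] compact_imp_bounded by blast
    then obtain M where "\<And>x. x \<in> K \<Longrightarrow> norm (?D x) \<le> M" by (auto simp: bounded_iff)
    then have "norm (?D x) \<le> max M 0" for x using D0[of x] by (cases "x \<in> K") (auto simp: le_max_iff_disj)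
    then show ?thesis using that[of "max M 0"] by auto
  qed
  have int0: "integrable lborel F" if "continuous_on UNIV F" "compact L" "\<And>x. x \<notin> L \<Longrightarrow> F x = 0" for F :: "'a \<Rightarrow> real" and L
  proof -
    have "(\<lambda>x. indicator L x *\<^sub>R F x) = F" using that(3) by (auto simp: indicator_def fun_eq_iff)
    then show ?thesis
      using borel_integrable_compact[OF that(2) continuous_on_subset[OF that(1)]] by simp
  qed
  show "integrable lborel ?D" using int0[OF contD K] D0 by blast
  have intf: "integrable lborel f" using int0[OF contf K] supp by blast
  \<comment> \<open>All points from which a step of length parameter at most 1 along
    \<open>e\<close> leads into \<open>K\<close>: a single compact set supporting every difference
    quotient with \<open>0 < t n \<le> 1\<close>. The mean value theorem bounds the quotients there
    by \<open>M\<close>.\<close>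
  define K' where "K' = (\<lambda>(y, t). y - t *\<^sub>R e) ` (K \<times> {0..1::real})"
  have cK': "compact K'"
    unfolding K'_def by (intro compact_continuous_image compact_Times K) (auto simp: case_prod_unfold intro!: continuous_intros)
  define t where "t n = 1 / real (Suc n)" for n
  have t: "0 < t n" "t n \<le> 1" for n by (auto simp: t_def)
  have tn0 [simp]: "t n \<noteq> 0" for n by (simp add: t_def)
  have t0: "t \<longlonglongrightarrow> 0"
    unfolding t_def using LIMSEQ_inverse_real_of_nat by (simp add: inverse_eq_divide)
  define q where "q n x = (f (x + t n *\<^sub>R e) - f x) / t n" for n x
  have der1: "((\<lambda>s. f (x + s *\<^sub>R e)) has_real_derivative ?D (x + s *\<^sub>R e)) (at s)" for x s
  proof -
    have fd: "(f has_derivative frechet_derivative f (at y)) (at y)" for y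
      using C_k_on_has_derivative[OF C1] by simp
    have "((\<lambda>s. f (x + s *\<^sub>R e)) has_derivative
        (\<lambda>r. frechet_derivative f (at (x + s *\<^sub>R e)) (r *\<^sub>R e))) (at s)"
      by (rule has_derivative_compose[where f = "\<lambda>s. x + s *\<^sub>R e", OF _ fd]) (auto intro!: derivative_eq_intros)
    then show ?thesis
      using linear_scale[OF has_derivative_linear[OF fd]] by (simp add: has_field_derivative_def mult_commute_abs)
  qed
  have qb: "norm (q n x) \<le> indicator K' x *\<^sub>R M" for n x
  proof (cases "x \<in> K'")
    case True
    have "\<exists>s. 0 < s \<and> s < t n \<and> f (x + t n *\<^sub>R e) - f (x + 0 *\<^sub>R e) = (t n - 0) * ?D (x + s *\<^sub>R e)"
      using t by (intro MVT2 der1) auto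
    then obtain s where "f (x + t n *\<^sub>R e) - f x = t n * ?D (x + s *\<^sub>R e)" by auto
    then show ?thesis using True M t[of n] by (simp add: q_def)
  next
    case False
    have "x \<notin> K" "x + t n *\<^sub>R e \<notin> K"
      using False t[of n] by (force simp: K'_def image_iff)+
    then show ?thesis using False supp by (simp add: q_def)
  qed
  have intq: "integral\<^sup>L lborel (q n) = 0" for n
  proof -
    have dt: "distr lborel borel ((+) (t n *\<^sub>R e)) = (lborel :: 'a measure)" by (rule lborel_distr_plus)
    have fm: "f \<in> borel_measurable borel" using contf by (rule borel_measurable_continuous_onI)
    have "integral\<^sup>L lborel f = integral\<^sup>L lborel (\<lambda>x. f (t n *\<^sub>R e + x))"
      by (subst dt[symmetric], subst integral_distr) (use fm in auto)
    moreover have "integrable lborel (\<lambda>x. f (t n *\<^sub>R e + x))"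
      using intf by (subst (asm) dt[symmetric], subst (asm) integrable_distr_eq) (use fm in auto)
    ultimately show ?thesis
      using intf by (simp add: q_def[abs_def] add.commute)
  qed
  have "(\<lambda>n. integral\<^sup>L lborel (q n)) \<longlonglongrightarrow> integral\<^sup>L lborel ?D"
  proof (rule integral_dominated_convergence[where w = "\<lambda>x. indicator K' x *\<^sub>R M"])
    show "?D \<in> borel_measurable lborel" using contD by (simp add: borel_measurable_continuous_onI)
    show "q n \<in> borel_measurable lborel" for n
      unfolding q_def
      by (auto intro!: borel_measurable_continuous_onI continuous_intros continuous_on_compose2[OF contf])
    show "integrable lborel (\<lambda>x. indicator K' x *\<^sub>R M)"
      by (rule borel_integrable_compact[OF cK']) auto
    show "AE x in lborel. norm (q n x) \<le> indicator K' x *\<^sub>R M" for n using qb by simp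
    show "AE x in lborel. (\<lambda>n. q n x) \<longlonglongrightarrow> ?D x"
    proof (rule AE_I2)
      fix x
      have "((\<lambda>h. (f (x + (0 + h) *\<^sub>R e) - f (x + 0 *\<^sub>R e)) / h) \<longlongrightarrow> ?D (x + 0 *\<^sub>R e)) (at 0)"
        using der1[of x 0] by (simp add: DERIV_def)
      moreover have "filterlim t (at 0) sequentially"
        using t0 by (auto simp: filterlim_at t_def)
      ultimately show "(\<lambda>n. q n x) \<longlonglongrightarrow> ?D x"
        using filterlim_compose by (fastforce simp: q_def)
    qed
  qed
  then show "integral\<^sup>L lborel ?D = 0"
    using LIMSEQ_unique[OF _ tendsto_const] by (simp add: intq)
qed


section \<open>Smooth partitions of unity\<close>

text \<open>The polynomial factor makes the family closed under differentiation; the classical flat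
  function \<open>exp (- 1 / t)\<close> is the case \<open>P = 1\<close>.\<close>

definition flat_exp :: "real poly \<Rightarrow> real \<Rightarrow> real" where
  "flat_exp P t = (if t > 0 then poly P (1 / t) * exp (- (1 / t)) else 0)"

lemma poly_times_exp_minus_tendsto_0: "((\<lambda>x::real. poly Q x * exp (- x)) \<longlongrightarrow> 0) at_top"
proof -
  have "((\<lambda>x. \<Sum>i\<le>degree Q. coeff Q i * (x ^ i / exp x)) \<longlongrightarrow> (\<Sum>i\<le>degree Q. coeff Q i * 0)) at_top"
    by (intro tendsto_sum tendsto_mult tendsto_const tendsto_power_div_exp_0)
  then show ?thesis
    by (simp add: poly_altdef sum_divide_distrib exp_minus inverse_eq_divide)
qed

text \<open>The polynomial \<open>[:0,0,1:]\<close> is the square of the variable and comes from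
  differentiating \<open>1 / t\<close>. At \<open>t = 0\<close> the quotient
  \<open>flat_exp P h / h\<close> is again of the form treated by
  \<open>poly_times_exp_minus_tendsto_0\<close>, with \<open>P\<close> multiplied by the
  variable.\<close>

lemma flat_exp_has_derivative:
  "(flat_exp P has_real_derivative flat_exp ([:0,0,1:] * (P - pderiv P)) t) (at t)"
proof -
  consider "t > 0" | "t < 0" | "t = 0" by linarith
  then show ?thesis
  proof cases
    case 1
    have "((\<lambda>t. poly P (1 / t) * exp (- (1 / t))) has_real_derivative
        flat_exp ([:0,0,1:] * (P - pderiv P)) t) (at t)"
      using 1 by (auto intro!: derivative_eq_intros DERIV_chain2[OF poly_DERIV]
          simp: flat_exp_def power2_eq_square field_simps)
    then show ?thesis
      by (rule has_field_derivative_transform_within_open[where S = "{0<..}"]) (use 1 in \<open>auto simp: flat_exp_def\<close>)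
  next
    case 2
    have "((\<lambda>t. 0) has_real_derivative flat_exp ([:0,0,1:] * (P - pderiv P)) t) (at t)"
      using 2 by (auto simp: flat_exp_def)
    then show ?thesis
      by (rule has_field_derivative_transform_within_open[where S = "{..<0}"]) (use 2 in \<open>auto simp: flat_exp_def\<close>)
  next
    case 3
    have "((\<lambda>h. flat_exp P h / h) \<longlongrightarrow> 0) (at 0)"
    proof (rule filterlim_split_at)
      show "((\<lambda>h. flat_exp P h / h) \<longlongrightarrow> 0) (at_left 0)"
        by (rule tendsto_eventually) (auto simp: eventually_at_filter flat_exp_def)
      have "((\<lambda>h. poly (pCons 0 P) (inverse h) * exp (- inverse h)) \<longlongrightarrow> 0) (at_right 0)"
        by (rule filterlim_compose[OF poly_times_exp_minus_tendsto_0 filterlim_inverse_at_top_right])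
      then show "((\<lambda>h. flat_exp P h / h) \<longlongrightarrow> 0) (at_right 0)"
        by (rule Lim_transform_eventually)
           (auto simp: eventually_at_filter flat_exp_def inverse_eq_divide)
    qed
    then show ?thesis using 3 by (simp add: DERIV_def flat_exp_def)
  qed
qed

lemma C_k_on_flat_exp: "C_k_on k UNIV (flat_exp P)"
proof (induction k arbitrary: P)
  case 0
  then show ?case
    using DERIV_continuous[OF flat_exp_has_derivative] by (auto simp: continuous_on_eq_continuous_within)
next
  case (Suc k)
  show ?case
    by (rule C_k_on_SucI[where f' = "\<lambda>t e. flat_exp ([:0,0,1:] * (P - pderiv P)) t * e"])
       (use Suc flat_exp_has_derivative in \<open>auto simp: has_field_derivative_def\<close>)
qed

lemma smooth_bump_exists:
  obtains b :: "complex \<Rightarrow> real" where "\<And>k. C_k_on k UNIV b" "\<And>w. b w \<ge> 0" "\<And>w. b w > 0 \<longleftrightarrow> norm w < 1"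
proof
  let ?b = "\<lambda>w :: complex. flat_exp 1 (1 - w \<bullet> w)"
  show "C_k_on k UNIV ?b" for k
    by (intro C_k_on_compose[OF open_UNIV open_UNIV _ _ C_k_on_flat_exp] C_k_on_diff C_k_on_inner) auto
  show "?b w \<ge> 0" for w by (simp add: flat_exp_def)
  have "w \<bullet> w < 1 \<longleftrightarrow> norm w < 1" for w :: complex
    by (metis abs_norm_cancel abs_square_less_1 dot_square_norm)
  then show "?b w > 0 \<longleftrightarrow> norm w < 1" for w by (simp add: flat_exp_def)
qed

section \<open>Charts\<close>

lemma is_chartD:
  assumes "is_chart c"
  shows "open (fst c)" "open (snd c ` fst c)" "p \<in> fst c \<Longrightarrow> chart_inv c (snd c p) = p"
    "w \<in> snd c ` fst c \<Longrightarrow> chart_inv c w \<in> fst c" "w \<in> snd c ` fst c \<Longrightarrow> snd c (chart_inv c w) = w"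
    "continuous_on (snd c ` fst c) (chart_inv c)" "continuous_on (fst c) (snd c)" "inj_on (snd c) (fst c)"
proof -
  have h: "homeomorphism (fst c) (snd c ` fst c) (snd c) (chart_inv c)"
    using assms by (simp add: is_chart_def)
  show inv: "p \<in> fst c \<Longrightarrow> chart_inv c (snd c p) = p" for p
    using h by (simp add: homeomorphism_def)
  show "inj_on (snd c) (fst c)"
    using inv by (metis inj_onI)
qed (use assms in \<open>auto simp: is_chart_def homeomorphism_def\<close>)

lemma open_chart_image:
  assumes "is_chart c" "open N" "N \<subseteq> fst c"
  shows "open (snd c ` N)"
proof -
  have "snd c ` N = snd c ` fst c \<inter> chart_inv c -` N"
    using assms(3) is_chartD(3)[OF assms(1)] by (force simp: image_iff)
  then show ?thesis
    using continuous_open_preimage[OF is_chartD(6)[OF assms(1)] is_chartD(2)[OF assms(1)] assms(2)] by simp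
qed

locale riemann_surface =
  fixes S :: "('s::{t2_space, second_countable_topology}, complex) chart set"
  assumes closed: "closed_riemann_surface S"
begin

lemma is_chart: "c \<in> S \<Longrightarrow> is_chart c"
  using closed by (simp add: closed_riemann_surface_def)

lemmas chart = is_chartD[OF is_chart]

lemma compact_surface: "compact (UNIV :: 's set)"
  using closed by (simp add: closed_riemann_surface_def)

lemma closed_imp_compact: "closed (K :: 's set) \<Longrightarrow> compact K"
  using compact_Int_closed[OF compact_surface] by simp

lemma chart_at: obtains z where "z \<in> S" "p \<in> fst z"
  using closed unfolding closed_riemann_surface_def by blast

lemma transition_holomorphic:
  "z \<in> S \<Longrightarrow> c \<in> S \<Longrightarrow> (snd c \<circ> chart_inv z) holomorphic_on (snd z ` (fst z \<inter> fst c))"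
  using closed by (simp add: closed_riemann_surface_def)

lemma open_overlap: "z \<in> S \<Longrightarrow> c \<in> S \<Longrightarrow> open (snd z ` (fst z \<inter> fst c))"
  by (intro open_chart_image is_chart open_Int chart) auto

section \<open>Transition maps, differential forms and chart integrals\<close>

definition jac :: "('s, complex) chart \<Rightarrow> ('s, complex) chart \<Rightarrow> 's \<Rightarrow> complex" where
  "jac z c p = deriv (snd c \<circ> chart_inv z) (snd z p)"

lemma transition_has_derivative:
  assumes "z \<in> S" "c \<in> S" "p \<in> fst z" "p \<in> fst c"
  shows "((snd c \<circ> chart_inv z) has_derivative (*) (jac z c p)) (at (snd z p))"
  using holomorphic_derivI[OF transition_holomorphic[OF assms(1,2)] open_overlap[OF assms(1,2)], of "snd z p"] assms
  by (simp add: has_field_derivative_def jac_def)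

lemma coord_deriv_change:
  fixes f :: "'s \<Rightarrow> 'b::real_normed_vector"
  assumes zc: "z \<in> S" "c \<in> S" "p \<in> fst z" "p \<in> fst c"
    and f: "(f \<circ> chart_inv c) differentiable (at (snd c p))"
  shows "coord_deriv z e f p = coord_deriv c (jac z c p * e) f p"
    and "(f \<circ> chart_inv z) differentiable (at (snd z p))"
proof -
  have T: "(snd c \<circ> chart_inv z) (snd z p) = snd c p"
    using chart(3)[OF zc(1,3)] by simp
  have "((\<lambda>w. (f \<circ> chart_inv c) ((snd c \<circ> chart_inv z) w)) has_derivative
      (\<lambda>e. frechet_derivative (f \<circ> chart_inv c) (at (snd c p)) (jac z c p * e))) (at (snd z p))"
    using f unfolding frechet_derivative_works
    by (intro has_derivative_compose[OF transition_has_derivative[OF zc]]) (simp only: T)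
  then have *: "((f \<circ> chart_inv z) has_derivative
      (\<lambda>e. frechet_derivative (f \<circ> chart_inv c) (at (snd c p)) (jac z c p * e))) (at (snd z p))"
    by (rule has_derivative_transform_within_open[OF _ open_overlap[OF zc(1,2)]])
       (use zc chart(3)[OF zc(1)] chart(3)[OF zc(2)] in auto)
  then show "coord_deriv z e f p = coord_deriv c (jac z c p * e) f p"
    unfolding coord_deriv_def using frechet_derivative_at by metis
  show "(f \<circ> chart_inv z) differentiable (at (snd z p))"
    using * by (auto simp: differentiable_def)
qed

text \<open>A 2-form is recorded by its coefficient of \<open>dx dy\<close> in each chart. The
  squared modulus of \<open>jac\<close> is the real Jacobian determinant of the holomorphic
  transition map.\<close>

definition two_form :: "(('s, complex) chart \<Rightarrow> 's \<Rightarrow> real) \<Rightarrow> bool" where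
  "two_form \<omega> \<longleftrightarrow> (\<forall>z\<in>S. continuous_on (snd z ` fst z) (\<lambda>w. \<omega> z (chart_inv z w))) \<and>
     (\<forall>z\<in>S. \<forall>c\<in>S. \<forall>p\<in>fst z \<inter> fst c. \<omega> z p = (norm (jac z c p))\<^sup>2 * \<omega> c p)"

lemma two_form_continuous:
  "two_form \<omega> \<Longrightarrow> z \<in> S \<Longrightarrow> continuous_on (snd z ` fst z) (\<lambda>w. \<omega> z (chart_inv z w))"
  by (simp add: two_form_def)

lemma two_form_change:
  "two_form \<omega> \<Longrightarrow> z \<in> S \<Longrightarrow> c \<in> S \<Longrightarrow> p \<in> fst z \<Longrightarrow> p \<in> fst c \<Longrightarrow> \<omega> z p = (norm (jac z c p))\<^sup>2 * \<omega> c p"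
  unfolding two_form_def by blast

text \<open>The number \<open>\<alpha> z e p\<close> is the value on the tangent vector with
  coordinate \<open>e\<close> in the chart \<open>z\<close>; the transition map acts on such vectors
  by multiplication with \<open>jac\<close>. Order 1 of differentiability is what makes
  \<open>exterior\<close> continuous.\<close>

definition one_form :: "(('s, complex) chart \<Rightarrow> complex \<Rightarrow> 's \<Rightarrow> real) \<Rightarrow> bool" where
  "one_form \<alpha> \<longleftrightarrow> (\<forall>z\<in>S. \<forall>e. C_k_on 1 (snd z ` fst z) (\<lambda>w. \<alpha> z e (chart_inv z w))) \<and>
     (\<forall>z\<in>S. \<forall>p\<in>fst z. linear (\<lambda>e. \<alpha> z e p)) \<and>
     (\<forall>z\<in>S. \<forall>c\<in>S. \<forall>p\<in>fst z \<inter> fst c. \<forall>e. \<alpha> z e p = \<alpha> c (jac z c p * e) p)"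

definition exterior :: "(('s, complex) chart \<Rightarrow> complex \<Rightarrow> 's \<Rightarrow> real) \<Rightarrow> ('s, complex) chart \<Rightarrow> 's \<Rightarrow> real" where
  "exterior \<alpha> z p = coord_deriv z 1 (\<alpha> z \<i>) p - coord_deriv z \<i> (\<alpha> z 1) p"

definition chart_integral :: "('s, complex) chart \<Rightarrow> ('s \<Rightarrow> real) \<Rightarrow> real" where
  "chart_integral c f = set_lebesgue_integral lborel (snd c ` fst c) (\<lambda>w. f (chart_inv c w))"

lemma chart_integral_cong:
  assumes "c \<in> S" "\<And>p. p \<in> fst c \<Longrightarrow> f p = g p"
  shows "chart_integral c f = chart_integral c g"
proof -
  have "indicat_real (snd c ` fst c) w *\<^sub>R f (chart_inv c w) = indicat_real (snd c ` fst c) w *\<^sub>R g (chart_inv c w)" for w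
    using assms(2)[OF chart(4)[OF assms(1)]] by (cases "w \<in> snd c ` fst c") auto
  then show ?thesis unfolding chart_integral_def set_lebesgue_integral_def by (simp only:)
qed

lemma compact_chart_image:
  assumes "c \<in> S" "closed K" "K \<subseteq> fst c"
  shows "compact (snd c ` K)"
  by (rule compact_continuous_image[OF continuous_on_subset[OF chart(7)[OF assms(1)] assms(3)]
        closed_imp_compact[OF assms(2)]])

text \<open>The set \<open>K\<close> is compact because the surface is, so the integrand is
  continuous with compact support inside the chart image, whatever happens near the boundary of that
  image.\<close>

lemma chart_integrable:
  assumes c: "c \<in> S" and K: "closed K" "K \<subseteq> fst c"
    and cont: "continuous_on (snd c ` fst c) (\<lambda>w. f (chart_inv c w))"
    and supp: "\<And>p. p \<in> fst c \<Longrightarrow> p \<notin> K \<Longrightarrow> f p = (0::real)"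
  shows "set_integrable lborel (snd c ` fst c) (\<lambda>w. f (chart_inv c w))"
proof -
  have "indicat_real (snd c ` fst c) w *\<^sub>R f (chart_inv c w) = indicat_real (snd c ` K) w *\<^sub>R f (chart_inv c w)" for w
  proof (cases "w \<in> snd c ` fst c \<and> w \<notin> snd c ` K")
    case True
    then have "chart_inv c w \<in> fst c" "chart_inv c w \<notin> K"
      using chart(4,5)[OF c, of w] by (blast, metis imageI)
    then show ?thesis using supp by simp
  next
    case False
    then show ?thesis using K by (auto simp: indicator_def)
  qed
  then show ?thesis
    unfolding set_integrable_def
    using borel_integrable_compact[OF compact_chart_image[OF c K] continuous_on_subset[OF cont image_mono[OF K(2)]]]
    by (simp only:)
qed

lemma chart_integral_sum:
  assumes "\<And>i. i \<in> I \<Longrightarrow> set_integrable lborel (snd c ` fst c) (\<lambda>w. f i (chart_inv c w))"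
  shows "chart_integral c (\<lambda>p. \<Sum>i\<in>I. f i p) = (\<Sum>i\<in>I. chart_integral c (f i))"
  using assms unfolding chart_integral_def set_lebesgue_integral_def set_integrable_def
  by (simp add: sum_distrib_left)

text \<open>The support lies in the overlap, so both integrals may be restricted to it; there the
  coefficient law of a 2-form is precisely the Jacobian factor in the substitution rule.\<close>

lemma chart_integral_change:
  assumes \<theta>: "two_form \<theta>" and c: "c \<in> S" and d: "d \<in> S" and K: "closed K" "K \<subseteq> fst c \<inter> fst d"
    and supp: "\<And>p. p \<in> fst c \<Longrightarrow> p \<notin> K \<Longrightarrow> \<theta> c p = 0" "\<And>p. p \<in> fst d \<Longrightarrow> p \<notin> K \<Longrightarrow> \<theta> d p = 0"
  shows "chart_integral c (\<theta> c) = chart_integral d (\<theta> d)"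
proof -
  define U where "U = snd c ` (fst c \<inter> fst d)"
  define V where "V = snd d ` (fst c \<inter> fst d)"
  define T where "T = snd d \<circ> chart_inv c"
  have restr: "indicat_real (snd a ` (fst c \<inter> fst d)) w *\<^sub>R \<theta> a (chart_inv a w)
      = indicat_real (snd a ` fst a) w *\<^sub>R \<theta> a (chart_inv a w)" if "a = c \<or> a = d" for a w
  proof (cases "w \<in> snd a ` fst a \<and> w \<notin> snd a ` (fst c \<inter> fst d)")
    case True
    have a: "a \<in> S" using that c d by auto
    have "chart_inv a w \<in> fst a" "chart_inv a w \<notin> fst c \<inter> fst d"
      using True chart(4,5)[OF a, of w] by (blast, metis imageI)
    then show ?thesis using supp K that by auto
  next
    case False
    then show ?thesis using that by (auto simp: indicator_def)
  qed
  note restr = restr[OF disjI1[OF refl]] restr[OF disjI2[OF refl]]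
  have int: "set_integrable lborel (snd a ` fst a) (\<lambda>w. \<theta> a (chart_inv a w))" if "a = c \<or> a = d" for a
    using that two_form_continuous[OF \<theta> c] two_form_continuous[OF \<theta> d] c d K supp by (intro chart_integrable[where K = K]) auto
  note int = int[OF disjI1[OF refl]] int[OF disjI2[OF refl]]
  have TU: "T ` U = V"
    unfolding T_def U_def V_def using chart(3)[OF c] by (force simp: image_iff)
  have inj: "inj_on T U"
    unfolding T_def U_def using chart(3)[OF c] inj_on_subset[OF chart(8)[OF d]]
    by (auto simp: inj_on_def)
  have pull: "indicat_real U w *\<^sub>R ((norm (deriv T w))\<^sup>2 * \<theta> d (chart_inv d (T w)))
      = indicat_real U w *\<^sub>R \<theta> c (chart_inv c w)" for w
  proof (cases "w \<in> U")
    case True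
    then obtain p where p: "p \<in> fst c" "p \<in> fst d" "w = snd c p" by (auto simp: U_def)
    then have "\<theta> c p = (norm (jac c d p))\<^sup>2 * \<theta> d p" by (intro two_form_change \<theta> c d)
    then show ?thesis
      using p chart(3)[OF c] chart(3)[OF d] by (simp add: T_def jac_def)
  qed auto
  have "set_lebesgue_integral lborel (T ` U) (\<lambda>w. \<theta> d (chart_inv d w))
      = set_lebesgue_integral lborel U (\<lambda>w. (norm (deriv T w))\<^sup>2 * \<theta> d (chart_inv d (T w)))"
  proof (rule set_lebesgue_integral_holomorphic_image[OF _ _ inj])
    show "open U" unfolding U_def by (rule open_overlap[OF c d])
    show "T holomorphic_on U" unfolding U_def T_def by (rule transition_holomorphic[OF c d])
    show "set_integrable lborel (T ` U) (\<lambda>w. \<theta> d (chart_inv d w))"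
      using int(2) unfolding TU V_def set_integrable_def by (simp only: restr)
    show "set_integrable lborel U (\<lambda>w. (norm (deriv T w))\<^sup>2 * \<theta> d (chart_inv d (T w)))"
      using int(1) unfolding set_integrable_def pull by (simp only: restr U_def)
  qed
  moreover have "set_lebesgue_integral lborel (T ` U) (\<lambda>w. \<theta> d (chart_inv d w)) = chart_integral d (\<theta> d)"
    unfolding TU V_def chart_integral_def set_lebesgue_integral_def by (simp only: restr)
  moreover have "set_lebesgue_integral lborel U (\<lambda>w. (norm (deriv T w))\<^sup>2 * \<theta> d (chart_inv d (T w))) = chart_integral c (\<theta> c)"
    unfolding chart_integral_def set_lebesgue_integral_def pull by (simp only: restr U_def)
  ultimately show ?thesis by simp
qed

definition csmooth :: "('s \<Rightarrow> real) \<Rightarrow> bool" where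
  "csmooth f \<longleftrightarrow> (\<forall>z\<in>S. C_inf_on (snd z ` fst z) (f \<circ> chart_inv z))"

lemma csmooth_continuous: "csmooth f \<Longrightarrow> z \<in> S \<Longrightarrow> continuous_on (snd z ` fst z) (\<lambda>w. f (chart_inv z w))"
  unfolding csmooth_def C_inf_on_def using C_k_on_imp_continuous_on by (fastforce simp: o_def)

lemma two_form_scale:
  assumes "csmooth f" "two_form \<omega>"
  shows "two_form (\<lambda>z p. f p * \<omega> z p)"
  unfolding two_form_def
proof (intro conjI ballI)
  show "continuous_on (snd z ` fst z) (\<lambda>w. f (chart_inv z w) * \<omega> z (chart_inv z w))" if "z \<in> S" for z
    by (intro continuous_on_mult csmooth_continuous[OF assms(1)] two_form_continuous[OF assms(2)] that)
  show "f p * \<omega> z p = (norm (jac z c p))\<^sup>2 * (f p * \<omega> c p)" if "z \<in> S" "c \<in> S" "p \<in> fst z \<inter> fst c" for z c p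
    using two_form_change[OF assms(2) that(1,2)] that(3) by simp
qed

lemma partition_of_unityD:
  assumes "partition_of_unity S C \<rho>"
  shows "finite C" "C \<subseteq> S" "c \<in> C \<Longrightarrow> csmooth (\<rho> c)" "c \<in> C \<Longrightarrow> \<rho> c p \<ge> 0"
    "c \<in> C \<Longrightarrow> closure {p. \<rho> c p \<noteq> 0} \<subseteq> fst c" "(\<Sum>c\<in>C. \<rho> c p) = 1"
  using assms unfolding partition_of_unity_def csmooth_def by auto

lemma not_in_support: "p \<notin> closure {p. f p \<noteq> 0} \<Longrightarrow> f p = 0"
  using closure_subset[of "{p. f p \<noteq> 0}"] by auto

text \<open>Insert \<open>1\<close> as the sum of the partition functions; each summand is then
  supported in two charts and can be moved into the chart of its partition function. This one
  redistribution serves both the independence of the partition and Stokes' theorem.\<close>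

lemma chart_integral_partition:
  assumes \<theta>: "two_form \<theta>" and c: "c \<in> S" and K: "closed K" "K \<subseteq> fst c"
    and supp: "\<And>z p. z \<in> S \<Longrightarrow> p \<in> fst z \<Longrightarrow> p \<notin> K \<Longrightarrow> \<theta> z p = 0"
    and pou: "partition_of_unity S D \<rho>"
  shows "chart_integral c (\<theta> c) = (\<Sum>d\<in>D. chart_integral d (\<lambda>p. \<rho> d p * \<theta> d p))"
proof -
  note P = partition_of_unityD[OF pou]
  have "chart_integral c (\<theta> c) = chart_integral c (\<lambda>p. \<Sum>d\<in>D. \<rho> d p * \<theta> c p)"
    using P(6) by (simp add: sum_distrib_right[symmetric])
  also have "\<dots> = (\<Sum>d\<in>D. chart_integral c (\<lambda>p. \<rho> d p * \<theta> c p))"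
  proof (rule chart_integral_sum)
    fix d assume "d \<in> D"
    then show "set_integrable lborel (snd c ` fst c) (\<lambda>w. \<rho> d (chart_inv c w) * \<theta> c (chart_inv c w))"
      using two_form_continuous[OF two_form_scale[OF P(3) \<theta>] c] supp c
      by (intro chart_integrable[OF c K]) auto
  qed
  also have "\<dots> = (\<Sum>d\<in>D. chart_integral d (\<lambda>p. \<rho> d p * \<theta> d p))"
  proof (rule sum.cong[OF refl])
    fix d assume d: "d \<in> D"
    show "chart_integral c (\<lambda>p. \<rho> d p * \<theta> c p) = chart_integral d (\<lambda>p. \<rho> d p * \<theta> d p)"
    proof (rule chart_integral_change[OF two_form_scale[OF P(3)[OF d] \<theta>] c])
      show "d \<in> S" using d P(2) by auto
      show "closed (K \<inter> closure {p. \<rho> d p \<noteq> 0})" using K by auto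
      show "K \<inter> closure {p. \<rho> d p \<noteq> 0} \<subseteq> fst c \<inter> fst d" using K P(5)[OF d] by auto
      have "\<rho> d p * \<theta> e p = 0" if "e = c \<or> e = d" "p \<in> fst e" "p \<notin> K \<inter> closure {p. \<rho> d p \<noteq> 0}" for e p
        using that supp[of e p] \<open>d \<in> S\<close> c not_in_support[of p "\<rho> d"] by (metis IntI mult_eq_0_iff)
      from this[of c] this[of d]
      show "p \<in> fst c \<Longrightarrow> p \<notin> K \<inter> closure {p. \<rho> d p \<noteq> 0} \<Longrightarrow> \<rho> d p * \<theta> c p = 0"
        and "p \<in> fst d \<Longrightarrow> p \<notin> K \<inter> closure {p. \<rho> d p \<noteq> 0} \<Longrightarrow> \<rho> d p * \<theta> d p = 0" for p
        by blast+
    qed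
  qed
  finally show ?thesis .
qed

text \<open>Both sides equal the double sum over the products of the two partitions.\<close>

lemma partition_integral_unique:
  assumes \<omega>: "two_form \<omega>" and C: "partition_of_unity S C \<rho>" and D: "partition_of_unity S D \<rho>'"
  shows "(\<Sum>c\<in>C. chart_integral c (\<lambda>p. \<rho> c p * \<omega> c p)) = (\<Sum>d\<in>D. chart_integral d (\<lambda>p. \<rho>' d p * \<omega> d p))"
proof -
  note P = partition_of_unityD[OF C] and Q = partition_of_unityD[OF D]
  have "(\<Sum>c\<in>C. chart_integral c (\<lambda>p. \<rho> c p * \<omega> c p))
      = (\<Sum>c\<in>C. \<Sum>d\<in>D. chart_integral d (\<lambda>p. \<rho>' d p * (\<rho> c p * \<omega> d p)))"
  proof (intro sum.cong refl)
    fix c assume c: "c \<in> C"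
    show "chart_integral c (\<lambda>p. \<rho> c p * \<omega> c p) = (\<Sum>d\<in>D. chart_integral d (\<lambda>p. \<rho>' d p * (\<rho> c p * \<omega> d p)))"
      by (rule chart_integral_partition[OF two_form_scale[OF P(3)[OF c] \<omega>] _ closed_closure P(5)[OF c] _ D])
         (use c P(2) not_in_support[of _ "\<rho> c"] in \<open>blast, metis mult_zero_left\<close>)
  qed
  also have "\<dots> = (\<Sum>d\<in>D. \<Sum>c\<in>C. chart_integral d (\<lambda>p. \<rho>' d p * (\<rho> c p * \<omega> d p)))"
    by (rule sum.swap)
  also have "\<dots> = (\<Sum>d\<in>D. chart_integral d (\<lambda>p. \<Sum>c\<in>C. \<rho>' d p * (\<rho> c p * \<omega> d p)))"
  proof (intro sum.cong refl chart_integral_sum[symmetric])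
    fix c d assume cd: "c \<in> C" "d \<in> D"
    show "set_integrable lborel (snd d ` fst d) (\<lambda>w. \<rho>' d (chart_inv d w) * (\<rho> c (chart_inv d w) * \<omega> d (chart_inv d w)))"
    proof (rule chart_integrable[OF _ closed_closure Q(5)[OF cd(2)]])
      show "d \<in> S" using cd Q(2) by auto
      then show "continuous_on (snd d ` fst d) (\<lambda>w. \<rho>' d (chart_inv d w) * (\<rho> c (chart_inv d w) * \<omega> d (chart_inv d w)))"
        by (intro two_form_continuous[OF two_form_scale[OF Q(3) two_form_scale[OF P(3) \<omega>]]] cd)
      show "\<rho>' d p * (\<rho> c p * \<omega> d p) = 0" if "p \<notin> closure {p. \<rho>' d p \<noteq> 0}" for p
        using not_in_support[OF that] by simp
    qed
  qed
  also have "\<dots> = (\<Sum>d\<in>D. chart_integral d (\<lambda>p. \<rho>' d p * \<omega> d p))"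
    using P(6) by (simp add: sum_distrib_left[symmetric] sum_distrib_right[symmetric])
  finally show ?thesis .
qed

text \<open>The choice operator in the definition ranges over a single value once the partition is
  known to be irrelevant. The hypothesis \<open>two_form\<close> is therefore the ticket to every
  computation with a surface integral.\<close>

lemma surface_integral_eq:
  assumes "two_form \<omega>" "partition_of_unity S C \<rho>"
  shows "surface_integral S \<omega> = (\<Sum>c\<in>C. chart_integral c (\<lambda>p. \<rho> c p * \<omega> c p))"
  unfolding surface_integral_def
proof (rule some_equality)
  show "\<exists>D \<rho>'. partition_of_unity S D \<rho>' \<and> (\<Sum>c\<in>C. chart_integral c (\<lambda>p. \<rho> c p * \<omega> c p))
      = (\<Sum>c\<in>D. set_lebesgue_integral lborel (snd c ` fst c) (\<lambda>w. \<rho>' c (chart_inv c w) * \<omega> c (chart_inv c w)))"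
    using assms(2) unfolding chart_integral_def by blast
  fix I assume "\<exists>D \<rho>'. partition_of_unity S D \<rho>' \<and>
    I = (\<Sum>c\<in>D. set_lebesgue_integral lborel (snd c ` fst c) (\<lambda>w. \<rho>' c (chart_inv c w) * \<omega> c (chart_inv c w)))"
  then obtain D \<rho>' where "partition_of_unity S D \<rho>'"
    "I = (\<Sum>c\<in>D. chart_integral c (\<lambda>p. \<rho>' c p * \<omega> c p))"
    unfolding chart_integral_def by blast
  then show "I = (\<Sum>c\<in>C. chart_integral c (\<lambda>p. \<rho> c p * \<omega> c p))"
    using partition_integral_unique[OF assms(1) _ assms(2)] by simp
qed


section \<open>Exterior derivative and Stokes' theorem\<close>

definition wedge :: "('s \<Rightarrow> real) \<Rightarrow> (('s, complex) chart \<Rightarrow> complex \<Rightarrow> 's \<Rightarrow> real) \<Rightarrow> ('s, complex) chart \<Rightarrow> 's \<Rightarrow> real" where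
  "wedge f \<alpha> z p = coord_deriv z 1 f p * \<alpha> z \<i> p - coord_deriv z \<i> f p * \<alpha> z 1 p"

lemma csmooth_has_derivative:
  assumes "csmooth f" "z \<in> S" "p \<in> fst z"
  shows "(f \<circ> chart_inv z has_derivative (\<lambda>e. coord_deriv z e f p)) (at (snd z p))"
proof -
  have "C_k_on (Suc 0) (snd z ` fst z) (f \<circ> chart_inv z)"
    using assms unfolding csmooth_def C_inf_on_def by blast
  from C_k_on_has_derivative[OF this, of "snd z p"] show ?thesis
    using assms(3) by (simp add: coord_deriv_def)
qed

lemma coord_deriv_chart_inv:
  assumes "z \<in> S" "w \<in> snd z ` fst z"
  shows "coord_deriv z e f (chart_inv z w) = frechet_derivative (f \<circ> chart_inv z) (at w) e"
  using chart(5)[OF assms] by (simp add: coord_deriv_def)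

text \<open>The coefficient is the 2 by 2 determinant formed by \<open>df\<close> and
  \<open>\<alpha>\<close>; precomposing both with multiplication by \<open>jac\<close> multiplies it
  by the determinant of that multiplication.\<close>

lemma two_form_wedge:
  assumes f: "csmooth f" and \<alpha>: "one_form \<alpha>"
  shows "two_form (wedge f \<alpha>)"
  unfolding two_form_def
proof (intro conjI ballI)
  fix z assume z: "z \<in> S"
  have "C_k_on (Suc 0) (snd z ` fst z) (f \<circ> chart_inv z)"
    using f z unfolding csmooth_def C_inf_on_def by blast
  then have "continuous_on (snd z ` fst z) (\<lambda>w. frechet_derivative (f \<circ> chart_inv z) (at w) e)" for e
    by (rule C_k_on_imp_continuous_on[OF C_k_on_frechet_derivative[OF chart(2)[OF z]]])
  then have "continuous_on (snd z ` fst z) (\<lambda>w. coord_deriv z e f (chart_inv z w))" for e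
    by (rule continuous_on_eq) (simp add: coord_deriv_chart_inv[OF z])
  moreover have "continuous_on (snd z ` fst z) (\<lambda>w. \<alpha> z e (chart_inv z w))" for e
    using \<alpha> z C_k_on_imp_continuous_on unfolding one_form_def by blast
  ultimately show "continuous_on (snd z ` fst z) (\<lambda>w. wedge f \<alpha> z (chart_inv z w))"
    unfolding wedge_def by (intro continuous_intros)
next
  fix z c p assume zc: "z \<in> S" "c \<in> S" "p \<in> fst z \<inter> fst c"
  have Df: "coord_deriv z e f p = coord_deriv c (jac z c p * e) f p" for e
    using coord_deriv_change(1)[OF zc(1,2)] differentiableI[OF csmooth_has_derivative[OF f zc(2)]] zc(3) by blast
  have A: "\<alpha> z e p = \<alpha> c (jac z c p * e) p" for e
    using \<alpha> zc unfolding one_form_def by blast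
  have lin: "linear (\<lambda>e. coord_deriv c e f p)" "linear (\<lambda>e. \<alpha> c e p)"
    using has_derivative_linear[OF csmooth_has_derivative[OF f zc(2)]] \<alpha> zc unfolding one_form_def by blast+
  have L: "coord_deriv c e f p = Re e * coord_deriv c 1 f p + Im e * coord_deriv c \<i> f p" for e
    using linear_complex[OF lin(1), of e] by simp
  have L': "\<alpha> c e p = Re e * \<alpha> c 1 p + Im e * \<alpha> c \<i> p" for e
    using linear_complex[OF lin(2), of e] by simp
  show "wedge f \<alpha> z p = (cmod (jac z c p))\<^sup>2 * wedge f \<alpha> c p"
    unfolding wedge_def Df A L[of "jac z c p * 1"] L[of "jac z c p * \<i>"] L'[of "jac z c p * 1"] L'[of "jac z c p * \<i>"]
    by (simp add: cmod_power2) (simp add: power2_eq_square algebra_simps)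
qed

lemma coord_deriv_outside_support:
  assumes "z \<in> S" "p \<in> fst z" "p \<notin> K" "closed K" "\<And>q. q \<notin> K \<Longrightarrow> f q = 0"
  shows "coord_deriv z e f p = 0"
proof -
  have "frechet_derivative (\<lambda>x. 0) (at (snd z p)) = frechet_derivative (f \<circ> chart_inv z) (at (snd z p))"
  proof (rule frechet_derivative_transform_within_open)
    show "open (snd z ` (fst z - K))"
      using assms by (intro open_chart_image is_chart open_Diff chart) auto
  qed (use assms chart(3)[OF assms(1)] in auto)
  then show ?thesis unfolding coord_deriv_def by (metis frechet_derivative_const)
qed

lemma exterior_scale:
  assumes f: "csmooth f" and \<alpha>: "one_form \<alpha>" and c: "c \<in> S" "p \<in> fst c"
  shows "exterior (\<lambda>z e q. f q * \<alpha> z e q) c p = wedge f \<alpha> c p + f p * exterior \<alpha> c p"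
proof -
  have "coord_deriv c e (\<lambda>q. f q * \<alpha> c e' q) p = coord_deriv c e f p * \<alpha> c e' p + f p * coord_deriv c e (\<alpha> c e') p" for e e'
  proof -
    have "C_k_on (Suc 0) (snd c ` fst c) (\<lambda>w. \<alpha> c e' (chart_inv c w))"
      using \<alpha> c(1) by (simp add: one_form_def)
    from C_k_on_has_derivative[OF this, of "snd c p"]
    have d\<alpha>: "(\<alpha> c e' \<circ> chart_inv c has_derivative (\<lambda>e. coord_deriv c e (\<alpha> c e') p)) (at (snd c p))"
      using c(2) by (simp add: coord_deriv_def comp_def)
    have "((\<lambda>w. (f \<circ> chart_inv c) w * (\<alpha> c e' \<circ> chart_inv c) w) has_derivative
       (\<lambda>e. (f \<circ> chart_inv c) (snd c p) * coord_deriv c e (\<alpha> c e') p + coord_deriv c e f p * (\<alpha> c e' \<circ> chart_inv c) (snd c p)))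
       (at (snd c p))"
      by (rule has_derivative_mult[OF csmooth_has_derivative[OF f c] d\<alpha>])
    from fun_cong[OF frechet_derivative_at[OF this], of e] show ?thesis
      using chart(3)[OF c] by (simp add: coord_deriv_def[of c e "\<lambda>q. f q * \<alpha> c e' q"] comp_def)
  qed
  then show ?thesis by (simp add: exterior_def wedge_def algebra_simps)
qed

lemma exterior_continuous:
  assumes "one_form \<alpha>" "c \<in> S"
  shows "continuous_on (snd c ` fst c) (\<lambda>w. exterior \<alpha> c (chart_inv c w))"
proof -
  have "continuous_on (snd c ` fst c) (\<lambda>w. coord_deriv c e (\<alpha> c e') (chart_inv c w))" for e e'
  proof (rule continuous_on_eq)
    have "C_k_on (Suc 0) (snd c ` fst c) (\<lambda>w. \<alpha> c e' (chart_inv c w))"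
      using assms by (simp add: one_form_def)
    from C_k_on_frechet_derivative[OF chart(2)[OF assms(2)] this, of e]
    show "continuous_on (snd c ` fst c) (\<lambda>w. frechet_derivative (\<lambda>w. \<alpha> c e' (chart_inv c w)) (at w) e)"
      by simp
  qed (simp add: coord_deriv_chart_inv[OF assms(2)] comp_def)
  then show ?thesis unfolding exterior_def by (intro continuous_intros)
qed

lemma chart_integral_exterior:
  assumes f: "csmooth f" and \<alpha>: "one_form \<alpha>" and c: "c \<in> S" and K: "closed K" "K \<subseteq> fst c"
    and supp: "\<And>p. p \<notin> K \<Longrightarrow> f p = 0"
  shows "chart_integral c (exterior (\<lambda>z e q. f q * \<alpha> z e q) c) = 0"
proof -
  let ?U = "snd c ` fst c"
  \<comment> \<open>Extension by zero to the whole plane. It is continuously differentiable across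
    the boundary of the chart image because it already vanishes off the compact image of
    \<open>K\<close>.\<close>
  define G where "G e w = (if w \<in> ?U then f (chart_inv c w) * \<alpha> c e (chart_inv c w) else 0)" for e w
  note cK = compact_chart_image[OF c K]
  have oK: "open (- (snd c ` K))" using cK by (simp add: compact_imp_closed open_Compl)
  have G0: "G e w = 0" if "w \<notin> snd c ` K" for e w
  proof (cases "w \<in> ?U")
    case True
    then have "chart_inv c w \<notin> K" using that chart(5)[OF c True] by (metis imageI)
    then show ?thesis using supp by (simp add: G_def)
  qed (simp add: G_def)
  have C1: "C_k_on 1 UNIV (G e)" for e
  proof (rule C_k_on_local)
    fix w :: complex
    show "\<exists>V. open V \<and> w \<in> V \<and> C_k_on 1 V (G e)"
    proof (cases "w \<in> ?U")
      case True
      have "C_k_on 1 ?U (\<lambda>w. f (chart_inv c w) * \<alpha> c e (chart_inv c w))"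
        using f \<alpha> c by (intro C_k_on_mult chart) (auto simp: csmooth_def C_inf_on_def one_form_def comp_def simp del: C_k_on.simps)
      then have "C_k_on 1 ?U (G e)"
        by (rule C_k_on_cong[OF chart(2)[OF c], rotated]) (simp add: G_def)
      then show ?thesis using True chart(2)[OF c] by blast
    next
      case False
      have "C_k_on 1 (- (snd c ` K)) (G e)"
        by (rule C_k_on_cong[OF oK _ C_k_on_const[of _ _ 0]]) (simp add: G0)
      moreover have "w \<in> - (snd c ` K)" using False K by auto
      ultimately show ?thesis using oK by blast
    qed
  qed
  have "indicat_real ?U w *\<^sub>R exterior (\<lambda>z e q. f q * \<alpha> z e q) c (chart_inv c w)
      = frechet_derivative (G \<i>) (at w) 1 - frechet_derivative (G 1) (at w) \<i>" for w
  proof (cases "w \<in> ?U")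
    case True
    have "frechet_derivative (G e) (at w) = frechet_derivative ((\<lambda>q. f q * \<alpha> c e q) \<circ> chart_inv c) (at w)" for e
      by (rule frechet_derivative_transform_within_open[OF _ chart(2)[OF c] True])
         (use C1[of e] in \<open>auto simp: G_def\<close>)
    then show ?thesis using True by (simp add: exterior_def coord_deriv_chart_inv[OF c True])
  next
    case False
    have "frechet_derivative (\<lambda>x. 0) (at w) = frechet_derivative (G e) (at w)" for e
      by (rule frechet_derivative_transform_within_open[OF _ oK]) (use False K G0 in auto)
    then show ?thesis using False by (metis (no_types) frechet_derivative_const diff_self indicator_simps(2) scaleR_zero_left)
  qed
  then show ?thesis
    unfolding chart_integral_def set_lebesgue_integral_def
    using integral_frechet_derivative_compact_support[OF C1 cK G0] by (simp add: Bochner_Integration.integral_diff)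
qed

lemma chart_integral_diff:
  assumes "set_integrable lborel (snd c ` fst c) (\<lambda>w. f (chart_inv c w))"
    "set_integrable lborel (snd c ` fst c) (\<lambda>w. g (chart_inv c w))"
  shows "chart_integral c (\<lambda>p. f p - g p) = chart_integral c f - chart_integral c g"
  using assms unfolding chart_integral_def by (simp add: set_integral_diff)

text \<open>The product rule writes \<open>\<rho> d\<alpha>\<close> as
  \<open>d(\<rho>\<alpha>) - d\<rho> \<and> \<alpha>\<close> in each chart. The first part is a
  compactly supported exterior derivative and integrates to zero; the second parts cancel after
  summation since the differentials of the partition functions add up to zero. The claim is phrased
  for the chart integrals of a fixed partition, the form in which it is used when densities are
  compared.\<close>

lemma stokes:
  assumes \<alpha>: "one_form \<alpha>" and pou: "partition_of_unity S C \<rho>"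
  shows "(\<Sum>c\<in>C. chart_integral c (\<lambda>p. \<rho> c p * exterior \<alpha> c p)) = 0"
proof -
  note P = partition_of_unityD[OF pou]
  define K where "K c = closure {p. \<rho> c p \<noteq> 0}" for c
  have K: "closed (K c)" "c \<in> C \<Longrightarrow> K c \<subseteq> fst c" "p \<notin> K c \<Longrightarrow> \<rho> c p = 0" for c p
    using P(5) not_in_support unfolding K_def by auto
  have w0: "wedge (\<rho> c) \<alpha> z p = 0" if "z \<in> S" "p \<in> fst z" "p \<notin> K c" for c z p
    using coord_deriv_outside_support[OF that K(1,3)] by (simp add: wedge_def)
  have wi: "set_integrable lborel (snd c ` fst c) (\<lambda>w. wedge (\<rho> c) \<alpha> c (chart_inv c w))" if "c \<in> C" for c
    using that P(2) by (intro chart_integrable[OF _ K(1) K(2)] two_form_continuous[OF two_form_wedge[OF P(3) \<alpha>]] w0) auto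
  have ei: "set_integrable lborel (snd c ` fst c) (\<lambda>w. \<rho> c (chart_inv c w) * exterior \<alpha> c (chart_inv c w))" if "c \<in> C" for c
    using that P(2)
    by (intro chart_integrable[OF _ K(1) K(2)] continuous_on_mult csmooth_continuous[OF P(3)] exterior_continuous[OF \<alpha>])
       (auto simp: K(3))
  have "chart_integral c (\<lambda>p. \<rho> c p * exterior \<alpha> c p) = - chart_integral c (wedge (\<rho> c) \<alpha> c)" if c: "c \<in> C" for c
  proof -
    have cS: "c \<in> S" using c P(2) by auto
    have "chart_integral c (\<lambda>p. \<rho> c p * exterior \<alpha> c p)
        = chart_integral c (\<lambda>p. exterior (\<lambda>z e q. \<rho> c q * \<alpha> z e q) c p - wedge (\<rho> c) \<alpha> c p)"
      by (rule chart_integral_cong[OF cS]) (simp add: exterior_scale[OF P(3)[OF c] \<alpha> cS])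
    also have "\<dots> = chart_integral c (exterior (\<lambda>z e q. \<rho> c q * \<alpha> z e q) c) - chart_integral c (wedge (\<rho> c) \<alpha> c)"
    proof (rule chart_integral_diff[OF _ wi[OF c]])
      have "set_integrable lborel (snd c ` fst c) (\<lambda>w. wedge (\<rho> c) \<alpha> c (chart_inv c w) + \<rho> c (chart_inv c w) * exterior \<alpha> c (chart_inv c w))"
        by (rule set_integral_add(1)[OF wi[OF c] ei[OF c]])
      then show "set_integrable lborel (snd c ` fst c) (\<lambda>w. exterior (\<lambda>z e q. \<rho> c q * \<alpha> z e q) c (chart_inv c w))"
        by (rule set_integrable_cong[THEN iffD1, rotated -1])
           (simp_all add: exterior_scale[OF P(3)[OF c] \<alpha> cS] chart(4)[OF cS])
    qed
    also have "chart_integral c (exterior (\<lambda>z e q. \<rho> c q * \<alpha> z e q) c) = 0"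
      by (rule chart_integral_exterior[OF P(3)[OF c] \<alpha> cS K(1) K(2)[OF c] K(3)])
    finally show ?thesis by simp
  qed
  then have "(\<Sum>c\<in>C. chart_integral c (\<lambda>p. \<rho> c p * exterior \<alpha> c p)) = - (\<Sum>c\<in>C. chart_integral c (wedge (\<rho> c) \<alpha> c))"
    by (simp add: sum_negf)
  \<comment> \<open>The 2-forms \<open>wedge (\<rho> c) \<alpha>\<close> live in different charts;
    redistributing them over the partition brings all of them into a common chart \<open>d\<close>,
    where the inner sum over \<open>c\<close> can be carried out pointwise.\<close>
  also have "(\<Sum>c\<in>C. chart_integral c (wedge (\<rho> c) \<alpha> c))
      = (\<Sum>c\<in>C. \<Sum>d\<in>C. chart_integral d (\<lambda>p. \<rho> d p * wedge (\<rho> c) \<alpha> d p))"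
    using P(2) by (intro sum.cong refl chart_integral_partition[OF two_form_wedge[OF P(3) \<alpha>] _ K(1) K(2) w0 pou]) auto
  also have "\<dots> = (\<Sum>d\<in>C. \<Sum>c\<in>C. chart_integral d (\<lambda>p. \<rho> d p * wedge (\<rho> c) \<alpha> d p))"
    by (rule sum.swap)
  also have "\<dots> = (\<Sum>d\<in>C. chart_integral d (\<lambda>p. \<Sum>c\<in>C. \<rho> d p * wedge (\<rho> c) \<alpha> d p))"
  proof (intro sum.cong refl chart_integral_sum[symmetric])
    fix c d assume cd: "c \<in> C" "d \<in> C"
    show "set_integrable lborel (snd d ` fst d) (\<lambda>w. \<rho> d (chart_inv d w) * wedge (\<rho> c) \<alpha> d (chart_inv d w))"
      by (rule chart_integrable[OF _ K(1) K(2)[OF cd(2)] two_form_continuous[OF two_form_scale[OF P(3)[OF cd(2)] two_form_wedge[OF P(3)[OF cd(1)] \<alpha>]]]])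
         (use cd P(2) in \<open>auto simp: K(3)\<close>)
  qed
  also have "\<dots> = (\<Sum>d\<in>C. chart_integral d (\<lambda>p. 0))"
  proof (intro sum.cong refl chart_integral_cong)
    fix d p assume d: "d \<in> C" and p: "p \<in> fst d"
    then have dS: "d \<in> S" using P(2) by auto
    have "(\<Sum>c\<in>C. coord_deriv d e (\<rho> c) p) = 0" for e
    proof -
      have "((\<lambda>w. \<Sum>c\<in>C. (\<rho> c \<circ> chart_inv d) w) has_derivative (\<lambda>e. \<Sum>c\<in>C. coord_deriv d e (\<rho> c) p)) (at (snd d p))"
        by (intro has_derivative_sum csmooth_has_derivative P(3) dS p)
      then have "((\<lambda>w. 1 :: real) has_derivative (\<lambda>e. \<Sum>c\<in>C. coord_deriv d e (\<rho> c) p)) (at (snd d p))"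
        by (simp add: P(6))
      from has_derivative_unique[OF this has_derivative_const] show ?thesis by (metis)
    qed
    then show "(\<Sum>c\<in>C. \<rho> d p * wedge (\<rho> c) \<alpha> d p) = 0"
      unfolding wedge_def sum_distrib_left[symmetric] sum_subtractf sum_distrib_right[symmetric] by simp
  qed (use P(2) in auto)
  also have "\<dots> = 0" by (simp add: chart_integral_def)
  finally show ?thesis by simp
qed


section \<open>Existence of smooth partitions of unity\<close>

lemma csmooth_local_bump:
  obtains N K f where "open N" "p \<in> N" "closed K" "\<exists>z\<in>S. K \<subseteq> fst z" "csmooth f"
    "\<And>q. f q \<ge> 0" "\<And>q. q \<in> N \<Longrightarrow> f q > 0" "\<And>q. q \<notin> K \<Longrightarrow> f q = 0"
proof -
  obtain b :: "complex \<Rightarrow> real" where b: "\<And>k. C_k_on k UNIV b" "\<And>w. b w \<ge> 0" "\<And>w. b w > 0 \<longleftrightarrow> norm w < 1"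
    using smooth_bump_exists by metis
  obtain z where z: "z \<in> S" "p \<in> fst z" using chart_at by blast
  obtain r where r: "r > 0" "cball (snd z p) r \<subseteq> snd z ` fst z"
    using open_contains_cball chart(2)[OF z(1)] z(2) by blast
  \<comment> \<open>A closed coordinate disc. It is compact, hence closed in the Hausdorff space
    \<open>'s\<close>, so that its complement is open and the extension by zero is smooth across the
    boundary of the chart.\<close>
  define K where "K = chart_inv z ` cball (snd z p) r"
  define f where "f q = (if q \<in> fst z then b ((snd z q - snd z p) /\<^sub>R r) else 0)" for q
  define N where "N = fst z \<inter> snd z -` ball (snd z p) r"
  have nr: "norm ((snd z q - snd z p) /\<^sub>R r) = dist (snd z p) (snd z q) / r" for q
    using r by (simp add: dist_norm norm_minus_commute divide_inverse mult.commute)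
  have b0: "b w = 0" if "norm w \<ge> 1" for w using b(2)[of w] b(3)[of w] that by auto
  have "compact K"
    unfolding K_def by (intro compact_continuous_image continuous_on_subset[OF chart(6)[OF z(1)]] r) auto
  then have cK: "closed K" by (rule compact_imp_closed)
  have Kz: "K \<subseteq> fst z" unfolding K_def using chart(4)[OF z(1)] r by blast
  have f0: "f q = 0" if "q \<notin> K" for q
  proof (cases "q \<in> fst z")
    case True
    then have "snd z q \<notin> cball (snd z p) r" using that chart(3)[OF z(1) True] unfolding K_def by (metis imageI)
    then have "norm ((snd z q - snd z p) /\<^sub>R r) \<ge> 1"
      unfolding nr using r by simp
    then show ?thesis using b0 by (simp add: f_def)
  qed (simp add: f_def)
  have "csmooth f"
    unfolding csmooth_def C_inf_on_def
  proof (intro ballI allI C_k_on_local)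
    fix y k w assume y: "y \<in> S" and w: "w \<in> snd y ` fst y"
    show "\<exists>V. open V \<and> w \<in> V \<and> C_k_on k V (f \<circ> chart_inv y)"
    \<comment> \<open>Inside the chart \<open>z\<close> the bump is composed with a holomorphic
      transition map; outside it there is a neighbourhood disjoint from \<open>K\<close> on which
      the function vanishes.\<close>
    proof (cases "chart_inv y w \<in> fst z")
      case True
      let ?V = "snd y ` (fst y \<inter> fst z)"
      have V: "open ?V" by (rule open_overlap[OF y z(1)])
      have "C_k_on k ?V (\<lambda>w. b (((snd z \<circ> chart_inv y) w - snd z p) /\<^sub>R r))"
        by (intro C_k_on_compose[OF V open_UNIV _ _ b(1)] C_k_on_linear[OF bounded_linear_scaleR_right V]
            C_k_on_diff V holomorphic_on_imp_C_k_on transition_holomorphic y z C_k_on_const) auto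
      then have "C_k_on k ?V (f \<circ> chart_inv y)"
        by (rule C_k_on_cong[OF V, rotated]) (use chart(3)[OF y] in \<open>auto simp: f_def\<close>)
      moreover have "w \<in> ?V" using True w chart(3,5)[OF y] by force
      ultimately show ?thesis using V by blast
    next
      case False
      let ?V = "snd y ` (fst y - K)"
      have V: "open ?V" using cK by (intro open_chart_image is_chart y open_Diff chart) auto
      have "C_k_on k ?V (f \<circ> chart_inv y)"
        by (rule C_k_on_cong[OF V _ C_k_on_const[of _ _ 0]]) (use chart(3)[OF y] f0 in auto)
      moreover have "w \<in> ?V"
        using False Kz w chart(4)[OF y w] chart(5)[OF y w] by (metis DiffI imageI subsetD)
      ultimately show ?thesis using V by blast
    qed
  qed
  moreover have "open N"
    unfolding N_def by (rule continuous_open_preimage[OF chart(7)[OF z(1)] chart(1)[OF z(1)]]) auto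
  moreover have "p \<in> N" using z r by (simp add: N_def)
  moreover have "f q > 0" if "q \<in> N" for q
  proof -
    have "norm ((snd z q - snd z p) /\<^sub>R r) < 1"
      unfolding nr using that r by (simp add: N_def)
    then show ?thesis using that b(3) by (simp add: f_def N_def)
  qed
  moreover have "f q \<ge> 0" for q using b(2) by (simp add: f_def)
  ultimately show ?thesis using that[of N K f] cK Kz z(1) f0 by blast
qed

lemma csmooth_sum:
  assumes "\<And>i. i \<in> I \<Longrightarrow> csmooth (f i)"
  shows "csmooth (\<lambda>q. \<Sum>i\<in>I. f i q)"
  unfolding csmooth_def C_inf_on_def comp_def
  using assms chart(2) unfolding csmooth_def C_inf_on_def comp_def by (intro ballI allI C_k_on_sum) blast+

lemma csmooth_divide:
  assumes "csmooth f" "csmooth g" "\<And>q. g q \<noteq> 0"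
  shows "csmooth (\<lambda>q. f q / g q)"
  unfolding csmooth_def C_inf_on_def comp_def divide_inverse
  using assms chart(2) unfolding csmooth_def C_inf_on_def comp_def
  by (intro ballI allI C_k_on_mult C_k_on_inverse) blast+

lemma partition_of_unity_exists: obtains C \<rho> where "partition_of_unity S C \<rho>"
proof -
  have "\<exists>N K f z. open N \<and> p \<in> N \<and> closed K \<and> z \<in> S \<and> K \<subseteq> fst z \<and> csmooth f \<and>
    (\<forall>q. f q \<ge> 0) \<and> (\<forall>q\<in>N. f q > 0) \<and> (\<forall>q. q \<notin> K \<longrightarrow> f q = 0)" for p
    using csmooth_local_bump[of p] by metis
  then obtain N K f z where *: "\<And>p. open (N p) \<and> p \<in> N p \<and> closed (K p) \<and> z p \<in> S \<and> K p \<subseteq> fst (z p) \<and> csmooth (f p) \<and>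
    (\<forall>q. f p q \<ge> 0) \<and> (\<forall>q\<in>N p. f p q > 0) \<and> (\<forall>q. q \<notin> K p \<longrightarrow> f p q = 0)"
    by metis
  obtain I where I: "finite I" "UNIV \<subseteq> (\<Union>p\<in>I. N p)"
  proof (rule compactE_image[OF compact_surface, of UNIV N])
    show "open (N p)" for p using *[of p] by simp
    show "UNIV \<subseteq> (\<Union>p\<in>UNIV. N p)" using * by blast
  qed
  define B where "B q = (\<Sum>p\<in>I. f p q)" for q
  have B: "B q > 0" for q
  proof -
    obtain p where "p \<in> I" "q \<in> N p" using I by blast
    then show ?thesis unfolding B_def using * I(1) by (intro sum_pos2[of I p]) auto
  qed
  \<comment> \<open>Partition functions are indexed by charts, and several points of
    \<open>I\<close> may have received the same chart; their bumps are collected into one function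
    before normalising.\<close>
  define \<rho> where "\<rho> c q = (\<Sum>p\<in>{p\<in>I. z p = c}. f p q) / B q" for c q
  have "partition_of_unity S (z ` I) \<rho>"
    unfolding partition_of_unity_def
  proof (intro conjI ballI allI)
    show "finite (z ` I)" "z ` I \<subseteq> S" using I * by auto
    fix c assume c: "c \<in> z ` I"
    show "0 \<le> \<rho> c p" for p using B[of p] * by (auto simp: \<rho>_def intro!: divide_nonneg_pos sum_nonneg)
    show "closure {p. \<rho> c p \<noteq> 0} \<subseteq> fst c"
    proof -
      let ?K = "\<Union>p\<in>{p\<in>I. z p = c}. K p"
      have "\<rho> c q = 0" if "q \<notin> ?K" for q
        unfolding \<rho>_def using that * by (simp add: sum.neutral)
      then have "{p. \<rho> c p \<noteq> 0} \<subseteq> ?K" by blast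
      moreover have "closed ?K" using I * by (intro closed_UN) auto
      ultimately have "closure {p. \<rho> c p \<noteq> 0} \<subseteq> ?K" by (rule closure_minimal)
      also have "?K \<subseteq> fst c" using * by blast
      finally show ?thesis .
    qed
    have "csmooth (\<rho> c)"
      unfolding \<rho>_def using B unfolding B_def
      by (intro csmooth_divide csmooth_sum) (use * in \<open>auto simp: less_imp_neq[symmetric]\<close>)
    then show "C_inf_on (snd y ` fst y) (\<rho> c \<circ> chart_inv y)" if "y \<in> S" for y
      using that by (simp add: csmooth_def)
  next
    show "(\<Sum>c\<in>z ` I. \<rho> c p) = 1" for p
      using sum.image_gen[OF I(1), of "\<lambda>i. f i p" z] B[of p]
      by (simp add: \<rho>_def sum_divide_distrib[symmetric] B_def)
  qed
  then show ?thesis using that by blast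
qed

section \<open>Comparing surface integrals whose densities differ by a square and an exact
  term\<close>

lemma set_integral_nonneg_eq_0_imp_zero:
  fixes f :: "complex \<Rightarrow> real"
  assumes "open U" "set_integrable lborel U f" "continuous_on U f" "\<And>w. w \<in> U \<Longrightarrow> f w \<ge> 0"
    and 0: "set_lebesgue_integral lborel U f = 0" and w: "w \<in> U"
  shows "f w = 0"
proof (rule ccontr)
  assume "f w \<noteq> 0"
  let ?V = "U \<inter> f -` {0<..}"
  have V: "open ?V" "w \<in> ?V"
    using continuous_open_preimage[OF assms(3,1), of "{0<..}"] assms(4)[OF w] \<open>f w \<noteq> 0\<close> w by auto
  have "AE x in lborel. indicat_real U x *\<^sub>R f x = 0"
    using 0 assms(2,4) unfolding set_lebesgue_integral_def set_integrable_def
    by (subst (asm) integral_nonneg_eq_0_iff_AE) (auto simp: indicator_def)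
  then have "AE x in lebesgue. indicat_real U x *\<^sub>R f x = 0"
    by (rule AE_completion)
  \<comment> \<open>The set where \<open>f\<close> is positive is open and null, and an open set in
    the plane that is null contains no point.\<close>
  then have "AE x\<in>?V in lebesgue. x \<in> {}"
    by eventually_elim auto
  from mem_closed_if_AE_lebesgue_open[OF V(1) closed_empty this V(2)] show False by simp
qed

text \<open>The analytic skeleton of the theorem, free of geometry: the exact term drops out by
  Stokes, the nonnegative term \<open>\<theta>\<close> gives the inequality, and continuity of
  \<open>\<theta>\<close> settles the equality case.\<close>

lemma surface_integral_compare:
  assumes \<omega>: "two_form \<omega>1" "two_form \<omega>2" "two_form \<theta>" and \<alpha>: "one_form \<alpha>"
    and eq: "\<And>z p. z \<in> S \<Longrightarrow> p \<in> fst z \<Longrightarrow> \<omega>1 z p = \<omega>2 z p + \<theta> z p + exterior \<alpha> z p"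
    and nonneg: "\<And>z p. z \<in> S \<Longrightarrow> p \<in> fst z \<Longrightarrow> \<theta> z p \<ge> 0"
  shows "surface_integral S \<omega>2 \<le> surface_integral S \<omega>1"
    and "surface_integral S \<omega>2 = surface_integral S \<omega>1 \<longleftrightarrow> (\<forall>z\<in>S. \<forall>p\<in>fst z. \<theta> z p = 0)"
proof -
  obtain C \<rho> where pou: "partition_of_unity S C \<rho>" using partition_of_unity_exists by blast
  note P = partition_of_unityD[OF pou]
  have \<rho>0: "\<rho> c p = 0" if "p \<notin> closure {p. \<rho> c p \<noteq> 0}" for c p
    using not_in_support[OF that] .
  have int: "set_integrable lborel (snd c ` fst c) (\<lambda>w. \<rho> c (chart_inv c w) * h (chart_inv c w))"
    if "c \<in> C" "continuous_on (snd c ` fst c) (\<lambda>w. h (chart_inv c w))" for c h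
  proof (rule chart_integrable[OF _ closed_closure P(5)[OF that(1)]])
    show "c \<in> S" using that(1) P(2) by auto
    then show "continuous_on (snd c ` fst c) (\<lambda>w. \<rho> c (chart_inv c w) * h (chart_inv c w))"
      by (intro continuous_on_mult csmooth_continuous[OF P(3)] that)
    show "\<rho> c p * h p = 0" if "p \<notin> closure {p. \<rho> c p \<noteq> 0}" for p
      using \<rho>0[OF that] by simp
  qed
  have "chart_integral c (\<lambda>p. \<rho> c p * \<omega>1 c p) = chart_integral c (\<lambda>p. \<rho> c p * \<omega>2 c p)
      + chart_integral c (\<lambda>p. \<rho> c p * \<theta> c p) + chart_integral c (\<lambda>p. \<rho> c p * exterior \<alpha> c p)"
    if c: "c \<in> C" for c
  proof -
    have cS: "c \<in> S" using c P(2) by auto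
    have "chart_integral c (\<lambda>p. \<rho> c p * \<omega>1 c p)
        = chart_integral c (\<lambda>p. (\<rho> c p * \<omega>2 c p + \<rho> c p * \<theta> c p) + \<rho> c p * exterior \<alpha> c p)"
      by (rule chart_integral_cong[OF cS]) (simp add: eq[OF cS] distrib_left)
    then show ?thesis
      unfolding chart_integral_def
      using int[OF c two_form_continuous[OF \<omega>(2) cS]] int[OF c two_form_continuous[OF \<omega>(3) cS]]
        int[OF c exterior_continuous[OF \<alpha> cS]]
      by (simp only: set_integral_add)
  qed
  then have sum: "surface_integral S \<omega>1 = surface_integral S \<omega>2 + (\<Sum>c\<in>C. chart_integral c (\<lambda>p. \<rho> c p * \<theta> c p))"
    unfolding surface_integral_eq[OF \<omega>(1) pou] surface_integral_eq[OF \<omega>(2) pou]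
    using stokes[OF \<alpha> pou] by (simp add: sum.distrib)
  have pos: "\<rho> c (chart_inv c w) * \<theta> c (chart_inv c w) \<ge> 0" if "c \<in> C" "w \<in> snd c ` fst c" for c w
    using that P(2) by (intro mult_nonneg_nonneg P(4) nonneg chart(4)) auto
  have ci: "chart_integral c (\<lambda>p. \<rho> c p * \<theta> c p) \<ge> 0" if "c \<in> C" for c
    unfolding chart_integral_def set_lebesgue_integral_def
  proof (intro integral_nonneg_AE AE_I2)
    show "0 \<le> indicat_real (snd c ` fst c) w *\<^sub>R (\<rho> c (chart_inv c w) * \<theta> c (chart_inv c w))" for w
      by (cases "w \<in> snd c ` fst c") (simp_all add: pos[OF that])
  qed
  then show "surface_integral S \<omega>2 \<le> surface_integral S \<omega>1"
    using sum by (simp add: sum_nonneg)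
  show "surface_integral S \<omega>2 = surface_integral S \<omega>1 \<longleftrightarrow> (\<forall>z\<in>S. \<forall>p\<in>fst z. \<theta> z p = 0)"
  proof
    assume "\<forall>z\<in>S. \<forall>p\<in>fst z. \<theta> z p = 0"
    then have "chart_integral c (\<lambda>p. \<rho> c p * \<theta> c p) = chart_integral c (\<lambda>p. 0)" if "c \<in> C" for c
      using that P(2) by (intro chart_integral_cong) auto
    then show "surface_integral S \<omega>2 = surface_integral S \<omega>1"
      using sum by (simp add: chart_integral_def)
  next
    assume "surface_integral S \<omega>2 = surface_integral S \<omega>1"
    then have z0: "chart_integral c (\<lambda>p. \<rho> c p * \<theta> c p) = 0" if "c \<in> C" for c
      using sum ci that sum_nonneg_eq_0_iff[OF P(1), of "\<lambda>c. chart_integral c (\<lambda>p. \<rho> c p * \<theta> c p)"] by simp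
    show "\<forall>z\<in>S. \<forall>p\<in>fst z. \<theta> z p = 0"
    proof (intro ballI)
      fix z p assume z: "z \<in> S" "p \<in> fst z"
      \<comment> \<open>The integrals vanish only after weighting with the partition functions. At
        each point at least one weight is nonzero, so \<open>\<theta>\<close> vanishes in that chart
        and then, by the coefficient law, in every chart.\<close>
      obtain c where c: "c \<in> C" "\<rho> c p \<noteq> 0"
        using P(6)[of p] by (metis sum.neutral zero_neq_one)
      have cS: "c \<in> S" using c P(2) by auto
      have pc: "p \<in> fst c" using \<rho>0[of p c] c P(5) by blast
      have "\<rho> c (chart_inv c (snd c p)) * \<theta> c (chart_inv c (snd c p)) = 0"
      proof (rule set_integral_nonneg_eq_0_imp_zero[OF chart(2)[OF cS] int[OF c(1) two_form_continuous[OF \<omega>(3) cS]]])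
        show "continuous_on (snd c ` fst c) (\<lambda>w. \<rho> c (chart_inv c w) * \<theta> c (chart_inv c w))"
          by (intro continuous_on_mult csmooth_continuous[OF P(3)] two_form_continuous[OF \<omega>(3)] c cS)
        show "set_lebesgue_integral lborel (snd c ` fst c) (\<lambda>w. \<rho> c (chart_inv c w) * \<theta> c (chart_inv c w)) = 0"
          using z0[OF c(1)] by (simp add: chart_integral_def)
      qed (use pos[OF c(1)] pc in auto)
      then have "\<theta> c p = 0" using c pc chart(3)[OF cS] by simp
      then show "\<theta> z p = 0" using two_form_change[OF \<omega>(3) z(1) cS z(2) pc] by simp
    qed
  qed
qed

end

section \<open>The Levi-Civita connection and curvature in coordinates\<close>

abbreviation pd :: "'a::real_normed_vector \<Rightarrow> ('a \<Rightarrow> 'b::real_normed_vector) \<Rightarrow> 'a \<Rightarrow> 'b" where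
  "pd e f x \<equiv> frechet_derivative f (at x) e"

lemma pd_eqI: "(f has_derivative f') (at x) \<Longrightarrow> pd e f x = f' e"
  using frechet_derivative_at by metis

lemma pd_sum_axis:
  fixes f :: "real^'n \<Rightarrow> 'b::real_normed_vector"
  assumes "f differentiable (at x)"
  shows "pd a f x = (\<Sum>l\<in>UNIV. (a $ l) *\<^sub>R pd (axis l 1) f x)"
proof -
  have "linear (frechet_derivative f (at x))"
    using assms frechet_derivative_works has_derivative_linear by blast
  then interpret linear "frechet_derivative f (at x)" .
  have "a = (\<Sum>l\<in>UNIV. (a $ l) *\<^sub>R axis l 1)"
    by (simp add: vec_eq_iff axis_def if_distrib sum.delta cong: if_cong)
  then have "pd a f x = pd (\<Sum>l\<in>UNIV. (a $ l) *\<^sub>R axis l 1) f x" by (rule arg_cong)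
  then show ?thesis by (simp add: sum scale)
qed

lemma has_derivative_vecI:
  fixes f :: "'a::real_normed_vector \<Rightarrow> 'b::real_normed_vector^'n"
  assumes "\<And>i. ((\<lambda>x. f x $ i) has_derivative (\<lambda>e. f' e $ i)) F"
  shows "(f has_derivative f') F"
proof -
  have "((\<lambda>x. \<Sum>i\<in>UNIV. axis i (f x $ i)) has_derivative (\<lambda>e. \<Sum>i\<in>UNIV. axis i (f' e $ i))) F"
    by (intro has_derivative_sum bounded_linear.has_derivative[OF bounded_linear_axis] assms)
  then show ?thesis by (simp flip: vec_sum_axis)
qed

lemma has_derivative_vec_nth:
  "(f has_derivative f') F \<Longrightarrow> ((\<lambda>x. f x $ i) has_derivative (\<lambda>e. f' e $ i)) F"
  by (rule bounded_linear.has_derivative[OF bounded_linear_vec_nth])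

text \<open>Bilinear over \<open>'k\<close> even for complex scalars; the Hermitian form is obtained
  by conjugating the second argument with \<open>vcnj\<close>. Generic scalars let one calculus
  serve both the real bundle and its complexification.\<close>

definition ip :: "real^'n^'n \<Rightarrow> 'k^'n \<Rightarrow> 'k^'n \<Rightarrow> 'k::real_normed_field" where
  "ip M u v = (\<Sum>i\<in>UNIV. \<Sum>j\<in>UNIV. of_real (M $ i $ j) * u $ i * v $ j)"

lemma ip_add_left: "ip M (u + v) w = ip M u w + ip M v w"
  and ip_add_right: "ip M w (u + v) = ip M w u + ip M w v"
  and ip_diff_left: "ip M (u - v) w = ip M u w - ip M v w"
  and ip_diff_right: "ip M w (u - v) = ip M w u - ip M w v"
  and ip_minus_left: "ip M (- u) w = - ip M u w"
  and ip_minus_right: "ip M w (- u) = - ip M w u"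
  and ip_zero_left: "ip M 0 w = 0"
  and ip_zero_right: "ip M w 0 = 0"
  and ip_scale_left: "ip M (a *s u) w = a * ip M u w"
  and ip_scale_right: "ip M w (a *s u) = a * ip M w u"
  by (simp_all add: ip_def sum.distrib sum_subtractf sum_negf sum_distrib_left algebra_simps)

lemmas ip_linear = ip_add_left ip_add_right ip_diff_left ip_diff_right ip_minus_left ip_minus_right
  ip_zero_left ip_zero_right ip_scale_left ip_scale_right

lemma ip_commute: "(\<And>i j. M $ i $ j = M $ j $ i) \<Longrightarrow> ip M u v = ip M v u"
  unfolding ip_def by (subst sum.swap) (simp add: mult.commute mult.left_commute)

text \<open>Christoffel symbols of a bare matrix valued function \<open>G\<close>, detached from
  charts, so that the local theory can be developed on open subsets of \<open>real^'n\<close> and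
  applied to each chart separately.\<close>

definition chris :: "(real^'n \<Rightarrow> real^'n^'n) \<Rightarrow> real^'n \<Rightarrow> 'n \<Rightarrow> 'n \<Rightarrow> 'n \<Rightarrow> real" where
  "chris G x k i j = (1/2) * (\<Sum>l\<in>UNIV. matrix_inv (G x) $ k $ l *
     (pd (axis i 1) (\<lambda>y. G y $ j $ l) x + pd (axis j 1) (\<lambda>y. G y $ i $ l) x
      - pd (axis l 1) (\<lambda>y. G y $ i $ j) x))"

definition chr :: "(real^'n \<Rightarrow> real^'n^'n) \<Rightarrow> real^'n \<Rightarrow> real^'n \<Rightarrow> 'k^'n \<Rightarrow> 'k::real_normed_field^'n" where
  "chr G x a b = (\<chi> k. \<Sum>i\<in>UNIV. \<Sum>j\<in>UNIV. of_real (chris G x k i j * a $ i) * b $ j)"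

definition dchr :: "(real^'n \<Rightarrow> real^'n^'n) \<Rightarrow> real^'n \<Rightarrow> real^'n \<Rightarrow> real^'n \<Rightarrow> 'k^'n \<Rightarrow> 'k::real_normed_field^'n" where
  "dchr G x m a b = (\<chi> k. \<Sum>i\<in>UNIV. \<Sum>j\<in>UNIV. of_real (pd m (\<lambda>y. chris G y k i j) x * a $ i) * b $ j)"

text \<open>The pullback of the Levi-Civita connection along an arbitrary map \<open>f\<close>,
  applied to a field along \<open>f\<close>. The identity map gives the connection itself, a
  transition map gives its transform, and \<open>coords\<close> gives the connection along
  \<open>F\<close>.\<close>

definition cov :: "(real^'n \<Rightarrow> real^'n^'n) \<Rightarrow> ('a::euclidean_space \<Rightarrow> real^'n) \<Rightarrow> 'a \<Rightarrow>
    ('a \<Rightarrow> 'k^'n) \<Rightarrow> 'a \<Rightarrow> 'k::{real_normed_field, euclidean_space}^'n" where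
  "cov G f e V w = pd e V w + chr G (f w) (pd e f w) (V w)"

definition riem :: "(real^'n \<Rightarrow> real^'n^'n) \<Rightarrow> real^'n \<Rightarrow> 'n \<Rightarrow> 'n \<Rightarrow> 'n \<Rightarrow> 'n \<Rightarrow> real" where
  "riem G x l i j k = pd (axis i 1) (\<lambda>y. chris G y l j k) x - pd (axis j 1) (\<lambda>y. chris G y l i k) x
     + (\<Sum>m\<in>UNIV. chris G x l i m * chris G x m j k - chris G x l j m * chris G x m i k)"

definition crv :: "(real^'n \<Rightarrow> real^'n^'n) \<Rightarrow> real^'n \<Rightarrow> 'k^'n \<Rightarrow> 'k^'n \<Rightarrow> 'k^'n \<Rightarrow> 'k::real_normed_field^'n" where
  "crv G x X Y Z = (\<chi> l. \<Sum>i\<in>UNIV. \<Sum>j\<in>UNIV. \<Sum>k\<in>UNIV. of_real (riem G x l i j k) * X $ i * Y $ j * Z $ k)"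

definition vof :: "real^'n \<Rightarrow> 'k::real_normed_field^'n" where
  "vof u = (\<chi> i. of_real (u $ i))"

lemma vof_nth [simp]: "vof u $ i = of_real (u $ i)" by (simp add: vof_def)

lemma chr_add_right: "chr G x a (u + v) = chr G x a u + chr G x a v"
  and chr_add_left: "chr G x (a + b) u = chr G x a u + chr G x b u"
  and chr_scale_right: "chr G x a (c *s u) = c *s chr G x a u"
  by (simp_all add: chr_def vec_eq_iff sum.distrib sum_subtractf sum_distrib_left algebra_simps)

lemma chr_scaleR_left:
  fixes u :: "'k::real_normed_field^'n"
  shows "chr G x (r *\<^sub>R a) u = r *\<^sub>R chr G x a u"
  by (simp add: chr_def vec_eq_iff scaleR_sum_right scaleR_conv_of_real[where ?'a = 'k] sum_distrib_left mult_ac)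

lemma chr_sum_right: "chr G x a (\<Sum>i\<in>I. u i) = (\<Sum>i\<in>I. chr G x a (u i))"
proof (induction I rule: infinite_finite_induct)
  case (insert i I)
  then show ?case by (simp add: chr_add_right)
qed (simp_all add: chr_def vec_eq_iff)

lemma chr_vof: "chr G x a (vof b) = vof (chr G x a b)"
  by (simp add: chr_def vof_def vec_eq_iff)

lemma vec_expand: "(v :: 'k::real_normed_field^'n) = (\<Sum>i\<in>UNIV. v $ i *s vof (axis i 1))"
  by (simp add: vec_eq_iff axis_def if_distrib[of of_real] if_distrib[of "\<lambda>x. _ * x"] sum.delta cong: if_cong)

lemma chr_expand:
  "chr G x a (v :: 'k::real_normed_field^'n) = (\<Sum>i\<in>UNIV. v $ i *s vof (chr G x a (axis i 1)))"
  by (subst vec_expand) (simp add: chr_sum_right chr_scale_right chr_vof)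

lemma matrix_inv_works:
  fixes M :: "real^'n^'n"
  assumes "invertible M"
  shows "M ** matrix_inv M = mat 1" "matrix_inv M ** M = mat 1"
  using someI_ex[OF assms[unfolded invertible_def]] by (simp_all add: matrix_inv_def)

lemma C_k_on_det:
  fixes A :: "'a::euclidean_space \<Rightarrow> real^'n^'n"
  assumes "open U" "\<And>i j. C_k_on k U (\<lambda>x. A x $ i $ j)"
  shows "C_k_on k U (\<lambda>x. det (A x))"
  unfolding det_def by (intro C_k_on_sum C_k_on_mult C_k_on_prod C_k_on_const assms)

text \<open>By Cramer's rule every entry of the inverse is a quotient of determinants, hence smooth
  where the determinant does not vanish.\<close>

lemma C_k_on_matrix_inv:
  fixes A :: "'a::euclidean_space \<Rightarrow> real^'n^'n"
  assumes "open U" "\<And>i j. C_k_on k U (\<lambda>x. A x $ i $ j)" "\<And>x. x \<in> U \<Longrightarrow> invertible (A x)"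
  shows "C_k_on k U (\<lambda>x. matrix_inv (A x) $ i $ j)"
proof (rule C_k_on_cong[OF assms(1)])
  let ?B = "\<lambda>x. (\<chi> m n. if n = i then axis j 1 $ m else A x $ m $ n) :: real^'n^'n"
  show "C_k_on k U (\<lambda>x. det (?B x) * inverse (det (A x)))"
  proof (intro C_k_on_mult C_k_on_inverse C_k_on_det assms)
    show "C_k_on k U (\<lambda>x. ?B x $ m $ n)" for m n
      using assms(2) by (cases "n = i") simp_all
  qed (use assms(3) invertible_det_nz in auto)
  fix x assume "x \<in> U"
  then have inv: "invertible (A x)" by (rule assms(3))
  have "A x *v (matrix_inv (A x) *v axis j 1) = axis j 1"
    using matrix_inv_works(1)[OF inv] by (simp add: matrix_vector_mul_assoc)
  then have "matrix_inv (A x) *v axis j 1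
      = (\<chi> i. det (\<chi> m n. if n = i then axis j 1 $ m else A x $ m $ n) / det (A x))"
    using cramer[of "A x"] inv invertible_det_nz[of "A x"] by blast
  then show "det (?B x) * inverse (det (A x)) = matrix_inv (A x) $ i $ j"
    by (simp add: vec_eq_iff matrix_vector_mult_basis column_def divide_inverse)
qed

section \<open>The Levi-Civita connection of a metric on a coordinate domain\<close>

locale metric_coords =
  fixes \<Omega> :: "(real^'n) set" and G :: "real^'n \<Rightarrow> real^'n^'n"
  assumes open_domain: "open \<Omega>"
    and smooth: "C_k_on k \<Omega> (\<lambda>x. G x $ i $ j)"
    and symmetric: "x \<in> \<Omega> \<Longrightarrow> G x $ i $ j = G x $ j $ i"
    and positive: "x \<in> \<Omega> \<Longrightarrow> u \<noteq> 0 \<Longrightarrow> ip (G x) u u > (0::real)"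
begin

lemma ip_sym: "x \<in> \<Omega> \<Longrightarrow> ip (G x) u v = ip (G x) v u"
  by (intro ip_commute symmetric)

lemma ip_nondegenerate:
  assumes "x \<in> \<Omega>" "\<And>v. ip (G x) u v = (0::real)"
  shows "u = 0"
  using positive[OF assms(1), of u] assms(2)[of u] by auto

lemma invertible_gram:
  assumes "x \<in> \<Omega>"
  shows "invertible (G x)"
proof -
  have "u = 0" if "G x *v u = 0" for u
  proof -
    have "ip (G x) v u = (\<Sum>i\<in>UNIV. v $ i * (G x *v u) $ i)" for v
      by (simp add: ip_def matrix_vector_mult_def sum_distrib_left mult_ac)
    then have "ip (G x) u v = 0" for v
      using ip_sym[OF assms, of u v] that by simp
    then show ?thesis by (rule ip_nondegenerate[OF assms])
  qed
  then show ?thesis by (simp add: invertible_left_inverse matrix_left_invertible_ker)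
qed

lemma smooth_chris: "C_k_on k \<Omega> (\<lambda>x. chris G x l i j)"
proof -
  have "C_k_on k \<Omega> (\<lambda>x. pd e (\<lambda>y. G y $ i $ j) x)" for i j e
    by (rule C_k_on_frechet_derivative[OF open_domain smooth])
  then show ?thesis
    unfolding chris_def
    by (intro C_k_on_mult C_k_on_const C_k_on_sum C_k_on_add C_k_on_diff C_k_on_matrix_inv open_domain
        smooth invertible_gram)
qed

lemma chris_symmetric:
  assumes "x \<in> \<Omega>"
  shows "chris G x k i j = chris G x k j i"
proof -
  have "pd e (\<lambda>y. G y $ i $ j) x = pd e (\<lambda>y. G y $ j $ i) x" for e
  proof -
    have "(\<lambda>y. G y $ i $ j) differentiable (at x)"
      using smooth[of "Suc 0"] assms by simp
    from frechet_derivative_transform_within_open[OF this open_domain assms, of "\<lambda>y. G y $ j $ i"]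
    show ?thesis using symmetric by simp
  qed
  then show ?thesis by (simp add: chris_def add.commute)
qed

lemma chr_symmetric: "x \<in> \<Omega> \<Longrightarrow> chr G x a b = chr G x b (a :: real^'n)"
  unfolding chr_def using chris_symmetric
  by (subst sum.swap) (simp add: vec_eq_iff mult_ac)

text \<open>The derivative of the metric itself in direction \<open>a\<close>, with the fields
  \<open>b\<close> and \<open>c\<close> held constant in coordinates.\<close>

definition dG :: "real^'n \<Rightarrow> real^'n \<Rightarrow> 'k^'n \<Rightarrow> 'k^'n \<Rightarrow> 'k::real_normed_field" where
  "dG x a b c = (\<Sum>i\<in>UNIV. \<Sum>j\<in>UNIV. of_real (pd a (\<lambda>y. G y $ i $ j) x) * b $ i * c $ j)"

lemma differentiable_gram: "x \<in> \<Omega> \<Longrightarrow> (\<lambda>y. G y $ i $ j) differentiable (at x)"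
  and differentiable_chris: "x \<in> \<Omega> \<Longrightarrow> (\<lambda>y. chris G y l i j) differentiable (at x)"
  using smooth[of "Suc 0"] smooth_chris[of "Suc 0"] by simp_all

text \<open>Lowering the upper index of the Christoffel symbols with \<open>G\<close> cancels the
  inverse matrix in their definition (\<open>low\<close>); the rest only reorders finite
  sums.\<close>

lemma koszul:
  assumes x: "x \<in> \<Omega>"
  shows "2 * ip (G x) (chr G x a b) c = dG x a b c + dG x b a c - dG x c a (b :: real^'n)"
proof -
  define d where "d l i j = pd (axis l 1) (\<lambda>y. G y $ i $ j) x" for l i j
  have low: "2 * (\<Sum>k\<in>UNIV. G x $ k $ m * chris G x k i j) = d i j m + d j i m - d m i j" for m i j
  proof -
    have "2 * (\<Sum>k\<in>UNIV. G x $ k $ m * chris G x k i j)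
        = (\<Sum>k\<in>UNIV. \<Sum>l\<in>UNIV. G x $ m $ k * matrix_inv (G x) $ k $ l * (d i j l + d j i l - d l i j))"
      using symmetric[OF x] by (simp add: chris_def d_def sum_distrib_left mult_ac)
    also have "\<dots> = (\<Sum>l\<in>UNIV. (G x ** matrix_inv (G x)) $ m $ l * (d i j l + d j i l - d l i j))"
      by (subst sum.swap) (simp add: matrix_matrix_mult_def sum_distrib_right)
    also have "\<dots> = d i j m + d j i m - d m i j"
      by (simp add: matrix_inv_works(1)[OF invertible_gram[OF x]] mat_def if_distrib[of "\<lambda>x. x * _"] sum.delta' cong: if_cong)
    finally show ?thesis .
  qed
  have dG: "dG x a b c = (\<Sum>i\<in>UNIV. \<Sum>j\<in>UNIV. \<Sum>l\<in>UNIV. a $ l * b $ i * c $ j * d l i j)" for a b c :: "real^'n"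
    unfolding dG_def pd_sum_axis[OF differentiable_gram[OF x], where a = a] d_def by (simp add: sum_distrib_left sum_distrib_right mult_ac)
  have "2 * ip (G x) (chr G x a b) c
      = (\<Sum>k\<in>UNIV. \<Sum>m\<in>UNIV. \<Sum>i\<in>UNIV. \<Sum>j\<in>UNIV. 2 * (G x $ k $ m * chris G x k i j * a $ i * b $ j * c $ m))"
    by (simp add: ip_def chr_def sum_distrib_left sum_distrib_right mult_ac)
  also have "\<dots> = (\<Sum>m\<in>UNIV. \<Sum>i\<in>UNIV. \<Sum>j\<in>UNIV. \<Sum>k\<in>UNIV. 2 * (G x $ k $ m * chris G x k i j * a $ i * b $ j * c $ m))"
    by (subst sum.swap, rule sum.cong[OF refl], subst sum.swap, rule sum.cong[OF refl], rule sum.swap)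
  also have "\<dots> = (\<Sum>m\<in>UNIV. \<Sum>i\<in>UNIV. \<Sum>j\<in>UNIV. a $ i * b $ j * c $ m * (2 * (\<Sum>k\<in>UNIV. G x $ k $ m * chris G x k i j)))"
    by (simp add: sum_distrib_left mult_ac)
  also have "\<dots> = (\<Sum>m\<in>UNIV. \<Sum>i\<in>UNIV. \<Sum>j\<in>UNIV. a $ i * b $ j * c $ m * d i j m)
      + (\<Sum>m\<in>UNIV. \<Sum>i\<in>UNIV. \<Sum>j\<in>UNIV. a $ i * b $ j * c $ m * d j i m)
      - (\<Sum>m\<in>UNIV. \<Sum>i\<in>UNIV. \<Sum>j\<in>UNIV. a $ i * b $ j * c $ m * d m i j)"
    unfolding low by (simp add: distrib_left right_diff_distrib sum.distrib sum_subtractf)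
  also have "(\<Sum>m\<in>UNIV. \<Sum>i\<in>UNIV. \<Sum>j\<in>UNIV. a $ i * b $ j * c $ m * d i j m) = dG x a b c"
  proof -
    have "dG x a b c = (\<Sum>i\<in>UNIV. \<Sum>l\<in>UNIV. \<Sum>j\<in>UNIV. a $ l * b $ i * c $ j * d l i j)"
      unfolding dG by (rule sum.cong[OF refl], rule sum.swap)
    also have "\<dots> = (\<Sum>l\<in>UNIV. \<Sum>j\<in>UNIV. \<Sum>i\<in>UNIV. a $ l * b $ i * c $ j * d l i j)"
      by (subst sum.swap, rule sum.cong[OF refl], rule sum.swap)
    also have "\<dots> = (\<Sum>j\<in>UNIV. \<Sum>l\<in>UNIV. \<Sum>i\<in>UNIV. a $ l * b $ i * c $ j * d l i j)"
      by (rule sum.swap)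
    finally show ?thesis by (simp add: mult_ac)
  qed
  also have "(\<Sum>m\<in>UNIV. \<Sum>i\<in>UNIV. \<Sum>j\<in>UNIV. a $ i * b $ j * c $ m * d j i m) = dG x b a c"
  proof -
    have "dG x b a c = (\<Sum>j\<in>UNIV. \<Sum>i\<in>UNIV. \<Sum>l\<in>UNIV. b $ l * a $ i * c $ j * d l i j)"
      unfolding dG by (rule sum.swap)
    then show ?thesis by (simp add: mult_ac)
  qed
  also have "(\<Sum>m\<in>UNIV. \<Sum>i\<in>UNIV. \<Sum>j\<in>UNIV. a $ i * b $ j * c $ m * d m i j) = dG x c a b"
  proof -
    have "dG x c a b = (\<Sum>i\<in>UNIV. \<Sum>l\<in>UNIV. \<Sum>j\<in>UNIV. c $ l * a $ i * b $ j * d l i j)"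
      unfolding dG by (rule sum.cong[OF refl], rule sum.swap)
    also have "\<dots> = (\<Sum>l\<in>UNIV. \<Sum>i\<in>UNIV. \<Sum>j\<in>UNIV. c $ l * a $ i * b $ j * d l i j)"
      by (rule sum.swap)
    finally show ?thesis by (simp add: mult_ac)
  qed
  finally show ?thesis .
qed

lemma dG_symmetric: "x \<in> \<Omega> \<Longrightarrow> dG x a b c = dG x a c b"
proof -
  assume x: "x \<in> \<Omega>"
  have "pd a (\<lambda>y. G y $ i $ j) x = pd a (\<lambda>y. G y $ j $ i) x" for i j
  proof -
    have "(\<lambda>y. G y $ i $ j) differentiable (at x)"
      using smooth[of "Suc 0"] x by simp
    from frechet_derivative_transform_within_open[OF this open_domain x, of "\<lambda>y. G y $ j $ i"]
    show ?thesis using symmetric by simp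
  qed
  then show ?thesis
    unfolding dG_def by (subst sum.swap) (simp add: mult_ac)
qed

text \<open>Adding the Koszul identities for \<open>a b c\<close> and \<open>a c b\<close> cancels
  all terms but twice the derivative in direction \<open>a\<close>. This is compatibility of the
  connection with the metric.\<close>

lemma dG_compatible_real:
  assumes x: "x \<in> \<Omega>"
  shows "dG x a b c = ip (G x) (chr G x a b) c + ip (G x) b (chr G x a (c :: real^'n))"
  using koszul[OF x, of a b c] koszul[OF x, of a c b] dG_symmetric[OF x, of a c b]
    dG_symmetric[OF x, of b a c] dG_symmetric[OF x, of c a b] ip_sym[OF x, of b "chr G x a c"]
  by linarith

text \<open>Both sides are bilinear over \<open>'k\<close>, so it suffices to compare them on the coordinate vectors.\<close>

lemma dG_compatible:
  assumes x: "x \<in> \<Omega>"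
  shows "dG x a b c = ip (G x) (chr G x a b) c + ip (G x) b (chr G x a (c :: 'k::real_normed_field^'n))"
proof -
  let ?e = "\<lambda>i. axis i 1 :: real^'n"
  have ip_sum: "ip M (\<Sum>i\<in>UNIV. b $ i *s u i) (\<Sum>j\<in>UNIV. c $ j *s v j) = (\<Sum>i\<in>UNIV. \<Sum>j\<in>UNIV. b $ i * c $ j * ip M (u i) (v j))"
    for M :: "real^'n^'n" and u v :: "'n \<Rightarrow> 'k^'n"
  proof -
    have l: "ip M (\<Sum>i\<in>I. u i) w = (\<Sum>i\<in>I. ip M (u i) w)" for I and u :: "'n \<Rightarrow> 'k^'n" and w
      by (induction I rule: infinite_finite_induct) (simp_all add: ip_linear)
    have r: "ip M w (\<Sum>i\<in>I. u i) = (\<Sum>i\<in>I. ip M w (u i))" for I and u :: "'n \<Rightarrow> 'k^'n" and w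
      by (induction I rule: infinite_finite_induct) (simp_all add: ip_linear)
    show ?thesis by (simp only: l ip_scale_left r ip_scale_right, subst sum.swap) (simp add: sum_distrib_left mult_ac)
  qed
  have ipv: "ip M (vof u) (vof v) = (of_real (ip M u v) :: 'k)" for M :: "real^'n^'n" and u v
    by (simp add: ip_def)
  have dGe: "of_real (pd a (\<lambda>y. G y $ i $ j) x) = (of_real (dG x a (?e i) (?e j)) :: 'k)" for i j
    by (simp add: dG_def axis_def if_distrib[of "\<lambda>x. _ * x"] if_distrib[of "\<lambda>x. x * _"] sum.delta cong: if_cong)
  have "dG x a b c = (\<Sum>i\<in>UNIV. \<Sum>j\<in>UNIV. b $ i * c $ j * of_real (dG x a (?e i) (?e j)))"
    unfolding dG_def[of x a b c] dGe by (simp add: mult_ac)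
  also have "\<dots> = (\<Sum>i\<in>UNIV. \<Sum>j\<in>UNIV. b $ i * c $ j * ip (G x) (vof (chr G x a (?e i))) (vof (?e j)))
      + (\<Sum>i\<in>UNIV. \<Sum>j\<in>UNIV. b $ i * c $ j * ip (G x) (vof (?e i)) (vof (chr G x a (?e j))))"
    unfolding dG_compatible_real[OF x] ipv by (simp add: distrib_left sum.distrib)
  also have "\<dots> = ip (G x) (chr G x a b) c + ip (G x) b (chr G x a c)"
    unfolding ip_sum[symmetric] chr_expand[symmetric] vec_expand[symmetric] ..
  finally show ?thesis .
qed


lemma chr_has_derivative:
  fixes V :: "'a::euclidean_space \<Rightarrow> 'k::{real_normed_field, euclidean_space}^'n"
  assumes x: "f w \<in> \<Omega>" and f: "(f has_derivative f') (at w)"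
    and a: "(a has_derivative a') (at w)" and V: "(V has_derivative V') (at w)"
  shows "((\<lambda>w. chr G (f w) (a w) (V w)) has_derivative
    (\<lambda>e. dchr G (f w) (f' e) (a w) (V w) + chr G (f w) (a' e) (V w) + chr G (f w) (a w) (V' e))) (at w)"
proof (rule has_derivative_vecI)
  fix k
  have "((\<lambda>w. of_real (chris G (f w) k i j * a w $ i) * V w $ j) has_derivative
      (\<lambda>e. of_real (pd (f' e) (\<lambda>y. chris G y k i j) (f w) * a w $ i) * V w $ j
         + of_real (chris G (f w) k i j * a' e $ i) * V w $ j + of_real (chris G (f w) k i j * a w $ i) * V' e $ j)) (at w)" for i j
  proof -
    have c: "((\<lambda>w. chris G (f w) k i j) has_derivative (\<lambda>e. pd (f' e) (\<lambda>y. chris G y k i j) (f w))) (at w)"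
      by (rule has_derivative_compose[OF f C_k_on_has_derivative[OF smooth_chris x]])
    have "((\<lambda>w. of_real (chris G (f w) k i j * a w $ i) * V w $ j) has_derivative
       (\<lambda>e. of_real (chris G (f w) k i j * a w $ i) * V' e $ j
         + of_real (chris G (f w) k i j * a' e $ i + pd (f' e) (\<lambda>y. chris G y k i j) (f w) * a w $ i) * V w $ j)) (at w)"
      by (intro has_derivative_mult bounded_linear.has_derivative[OF bounded_linear_of_real] c
          has_derivative_vec_nth[OF a] has_derivative_vec_nth[OF V])
    then show ?thesis by (rule has_derivative_eq_rhs) (simp add: fun_eq_iff algebra_simps)
  qed
  then have "((\<lambda>w. \<Sum>i\<in>UNIV. \<Sum>j\<in>UNIV. of_real (chris G (f w) k i j * a w $ i) * V w $ j) has_derivative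
      (\<lambda>e. \<Sum>i\<in>UNIV. \<Sum>j\<in>UNIV. of_real (pd (f' e) (\<lambda>y. chris G y k i j) (f w) * a w $ i) * V w $ j
         + of_real (chris G (f w) k i j * a' e $ i) * V w $ j + of_real (chris G (f w) k i j * a w $ i) * V' e $ j)) (at w)"
    by (intro has_derivative_sum)
  then show "((\<lambda>w. chr G (f w) (a w) (V w) $ k) has_derivative
     (\<lambda>e. (dchr G (f w) (f' e) (a w) (V w) + chr G (f w) (a' e) (V w) + chr G (f w) (a w) (V' e)) $ k)) (at w)"
    by (simp add: chr_def dchr_def sum.distrib)
qed

lemma ip_has_derivative:
  fixes f f' :: "'a::euclidean_space \<Rightarrow> real^'n" and V W V' W' :: "'a::euclidean_space \<Rightarrow> 'k::{real_normed_field, euclidean_space}^'n"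
  assumes x: "f w \<in> \<Omega>" and f: "(f has_derivative f') (at w)"
    and V: "(V has_derivative V') (at w)" and W: "(W has_derivative W') (at w)"
  shows "((\<lambda>w. ip (G (f w)) (V w) (W w)) has_derivative
    (\<lambda>e. dG (f w) (f' e) (V w) (W w) + ip (G (f w)) (V' e) (W w) + ip (G (f w)) (V w) (W' e))) (at w)"
proof -
  have "((\<lambda>w. of_real (G (f w) $ i $ j) * V w $ i * W w $ j) has_derivative
      (\<lambda>e. of_real (pd (f' e) (\<lambda>y. G y $ i $ j) (f w)) * V w $ i * W w $ j
        + of_real (G (f w) $ i $ j) * V' e $ i * W w $ j + of_real (G (f w) $ i $ j) * V w $ i * W' e $ j)) (at w)" for i j :: 'n
  proof -
    have c: "((\<lambda>w. G (f w) $ i $ j) has_derivative (\<lambda>e. pd (f' e) (\<lambda>y. G y $ i $ j) (f w))) (at w)"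
      by (rule has_derivative_compose[OF f C_k_on_has_derivative[OF smooth x]])
    have "((\<lambda>w. of_real (G (f w) $ i $ j) * V w $ i * W w $ j) has_derivative
       (\<lambda>e. of_real (G (f w) $ i $ j) * V w $ i * W' e $ j
         + (of_real (G (f w) $ i $ j) * V' e $ i + of_real (pd (f' e) (\<lambda>y. G y $ i $ j) (f w)) * V w $ i) * W w $ j)) (at w)"
      by (intro has_derivative_mult bounded_linear.has_derivative[OF bounded_linear_of_real] c
          has_derivative_vec_nth[OF W] has_derivative_vec_nth[OF V])
    then show ?thesis by (rule has_derivative_eq_rhs) (simp add: fun_eq_iff algebra_simps)
  qed
  then have "((\<lambda>w. \<Sum>i\<in>UNIV. \<Sum>j\<in>UNIV. of_real (G (f w) $ i $ j) * V w $ i * W w $ j) has_derivative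
      (\<lambda>e. \<Sum>i\<in>UNIV. \<Sum>j\<in>UNIV. of_real (pd (f' e) (\<lambda>y. G y $ i $ j) (f w)) * V w $ i * W w $ j
        + of_real (G (f w) $ i $ j) * V' e $ i * W w $ j + of_real (G (f w) $ i $ j) * V w $ i * W' e $ j)) (at w)"
    by (intro has_derivative_sum)
  then show ?thesis by (simp add: ip_def dG_def sum.distrib)
qed

lemma cov_compatible:
  fixes V W :: "'a::euclidean_space \<Rightarrow> 'k::{real_normed_field, euclidean_space}^'n"
  assumes "f w \<in> \<Omega>" "f differentiable (at w)" "V differentiable (at w)" "W differentiable (at w)"
  shows "pd e (\<lambda>w. ip (G (f w)) (V w) (W w)) w
    = ip (G (f w)) (cov G f e V w) (W w) + ip (G (f w)) (V w) (cov G f e W w)"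
  using pd_eqI[OF ip_has_derivative[OF assms(1) assms(2-4)[unfolded frechet_derivative_works]], of e]
  by (simp add: cov_def dG_compatible[OF assms(1)] ip_linear algebra_simps)

text \<open>Rewrites the index formula for curvature as derivative of the connection plus its
  commutator, which is the shape in which second covariant derivatives produce it.\<close>

lemma crv_eq:
  fixes Z :: "'k::real_normed_field^'n"
  assumes x: "x \<in> \<Omega>"
  shows "crv G x (vof X) (vof Y) Z
    = dchr G x X Y Z - dchr G x Y X Z + chr G x X (chr G x Y Z) - chr G x Y (chr G x X Z)"
proof (subst vec_eq_iff, rule allI)
  fix l
  define S where "S t = (\<Sum>i\<in>UNIV. \<Sum>j\<in>UNIV. \<Sum>k\<in>UNIV. of_real (t i j k * X $ i * Y $ j) * Z $ k)" for t :: "'n \<Rightarrow> 'n \<Rightarrow> 'n \<Rightarrow> real"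
  have r4: "(\<Sum>i\<in>UNIV. \<Sum>m\<in>UNIV. \<Sum>j\<in>UNIV. \<Sum>k\<in>UNIV. h i m j k) = (\<Sum>i\<in>UNIV. \<Sum>j\<in>UNIV. \<Sum>k\<in>UNIV. \<Sum>m\<in>UNIV. h i m j k)"
    for h :: "'n \<Rightarrow> 'n \<Rightarrow> 'n \<Rightarrow> 'n \<Rightarrow> 'k"
    by (rule sum.cong[OF refl], subst sum.swap, rule sum.cong[OF refl], rule sum.swap)
  have 1: "dchr G x X Y Z $ l = S (\<lambda>i j k. pd (axis i 1) (\<lambda>y. chris G y l j k) x)"
  proof -
    have "dchr G x X Y Z $ l = (\<Sum>j\<in>UNIV. \<Sum>k\<in>UNIV. \<Sum>i\<in>UNIV. of_real (pd (axis i 1) (\<lambda>y. chris G y l j k) x * X $ i * Y $ j) * Z $ k)"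
      by (simp add: dchr_def pd_sum_axis[OF differentiable_chris[OF x], where a = X] sum_distrib_left sum_distrib_right mult_ac)
    also have "\<dots> = (\<Sum>j\<in>UNIV. \<Sum>i\<in>UNIV. \<Sum>k\<in>UNIV. of_real (pd (axis i 1) (\<lambda>y. chris G y l j k) x * X $ i * Y $ j) * Z $ k)"
      by (rule sum.cong[OF refl], rule sum.swap)
    finally show ?thesis unfolding S_def by (subst sum.swap)
  qed
  have 2: "dchr G x Y X Z $ l = S (\<lambda>i j k. pd (axis j 1) (\<lambda>y. chris G y l i k) x)"
  proof -
    have "dchr G x Y X Z $ l = (\<Sum>i\<in>UNIV. \<Sum>k\<in>UNIV. \<Sum>j\<in>UNIV. of_real (pd (axis j 1) (\<lambda>y. chris G y l i k) x * X $ i * Y $ j) * Z $ k)"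
      by (simp add: dchr_def pd_sum_axis[OF differentiable_chris[OF x], where a = Y] sum_distrib_left sum_distrib_right mult_ac)
    also have "\<dots> = (\<Sum>i\<in>UNIV. \<Sum>j\<in>UNIV. \<Sum>k\<in>UNIV. of_real (pd (axis j 1) (\<lambda>y. chris G y l i k) x * X $ i * Y $ j) * Z $ k)"
      by (rule sum.cong[OF refl], rule sum.swap)
    finally show ?thesis unfolding S_def .
  qed
  have 3: "chr G x X (chr G x Y Z) $ l = S (\<lambda>i j k. \<Sum>m\<in>UNIV. chris G x l i m * chris G x m j k)"
  proof -
    have "chr G x X (chr G x Y Z) $ l
        = (\<Sum>i\<in>UNIV. \<Sum>m\<in>UNIV. \<Sum>j\<in>UNIV. \<Sum>k\<in>UNIV. of_real (chris G x l i m * chris G x m j k * X $ i * Y $ j) * Z $ k)"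
      by (simp add: chr_def sum_distrib_left sum_distrib_right mult_ac)
    then show ?thesis unfolding S_def by (subst (asm) r4) (simp add: sum_distrib_right)
  qed
  have 4: "chr G x Y (chr G x X Z) $ l = S (\<lambda>i j k. \<Sum>m\<in>UNIV. chris G x l j m * chris G x m i k)"
  proof -
    have "chr G x Y (chr G x X Z) $ l
        = (\<Sum>j\<in>UNIV. \<Sum>m\<in>UNIV. \<Sum>i\<in>UNIV. \<Sum>k\<in>UNIV. of_real (chris G x l j m * chris G x m i k * X $ i * Y $ j) * Z $ k)"
      by (simp add: chr_def sum_distrib_left sum_distrib_right mult_ac)
    then show ?thesis unfolding S_def by (subst (asm) r4, subst sum.swap) (simp add: sum_distrib_right)
  qed
  have "crv G x (vof X) (vof Y) Z $ l
      = S (\<lambda>i j k. pd (axis i 1) (\<lambda>y. chris G y l j k) x) - S (\<lambda>i j k. pd (axis j 1) (\<lambda>y. chris G y l i k) x)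
      + S (\<lambda>i j k. \<Sum>m\<in>UNIV. chris G x l i m * chris G x m j k) - S (\<lambda>i j k. \<Sum>m\<in>UNIV. chris G x l j m * chris G x m i k)"
    unfolding S_def sum_subtractf[symmetric] sum.distrib[symmetric]
    by (simp add: crv_def riem_def sum_subtractf algebra_simps)
  then show "crv G x (vof X) (vof Y) Z $ l
    = (dchr G x X Y Z - dchr G x Y X Z + chr G x X (chr G x Y Z) - chr G x Y (chr G x X Z)) $ l"
    by (simp add: 1 2 3 4)
qed

text \<open>Second partial derivatives of \<open>f\<close> and of \<open>V\<close> commute and drop
  out. The map \<open>f\<close> is arbitrary, in particular it may fail to be an immersion; thus the
  identity covers sections along \<open>F\<close> at branch points, and with the identity map and
  constant fields it yields the symmetries of the curvature tensor.\<close>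

lemma cov_commutator:
  fixes V :: "'a::euclidean_space \<Rightarrow> 'k::{real_normed_field, euclidean_space}^'n"
  assumes U: "open U" "w \<in> U" and fU: "f ` U \<subseteq> \<Omega>" and f: "C_k_on 2 U f" and V: "C_k_on 2 U V"
  shows "cov G f a (cov G f b V) w - cov G f b (cov G f a V) w
    = crv G (f w) (vof (pd a f w)) (vof (pd b f w)) (V w)"
proof -
  have x: "f w \<in> \<Omega>" using U fU by auto
  have C2: "C_k_on (Suc (Suc 0)) U f" "C_k_on (Suc (Suc 0)) U V" using f V by (simp_all add: numeral_2_eq_2)
  note df = C_k_on_has_derivative[OF C2(1) U(2)] and dV = C_k_on_has_derivative[OF C2(2) U(2)]
  have ddf: "((\<lambda>w. pd e f w) has_derivative (\<lambda>e'. pd e' (\<lambda>w. pd e f w) w)) (at w)"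
    and ddV: "((\<lambda>w. pd e V w) has_derivative (\<lambda>e'. pd e' (\<lambda>w. pd e V w) w)) (at w)" for e
    by (rule C_k_on_has_derivative[OF C_k_on_frechet_derivative[OF U(1) C2(1)] U(2)])
       (rule C_k_on_has_derivative[OF C_k_on_frechet_derivative[OF U(1) C2(2)] U(2)])
  have pd_cov: "pd e' (cov G f e V) w = pd e' (\<lambda>w. pd e V w) w + (dchr G (f w) (pd e' f w) (pd e f w) (V w)
      + chr G (f w) (pd e' (\<lambda>w. pd e f w) w) (V w) + chr G (f w) (pd e f w) (pd e' V w))" for e e'
    unfolding cov_def[abs_def]
    by (rule pd_eqI[OF has_derivative_add[OF ddV chr_has_derivative[OF x df ddf dV]]])
  have "pd a (\<lambda>w. pd b V w) w = pd b (\<lambda>w. pd a V w) w"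
    by (rule symmetric_second_derivative[OF U(1) V U(2)])
  moreover have "pd a (\<lambda>w. pd b f w) w = pd b (\<lambda>w. pd a f w) w"
    by (rule symmetric_second_derivative[OF U(1) f U(2)])
  ultimately show ?thesis
    unfolding cov_def[of G f a "cov G f b V"] cov_def[of G f b "cov G f a V"] pd_cov crv_eq[OF x]
    by (simp add: cov_def chr_add_right)
qed

lemma C_k_on_chr:
  fixes V :: "'a::euclidean_space \<Rightarrow> 'k::{real_normed_field, euclidean_space}^'n"
  assumes "open U" "f ` U \<subseteq> \<Omega>" "C_k_on k U f" "C_k_on k U a" "C_k_on k U V"
  shows "C_k_on k U (\<lambda>w. chr G (f w) (a w) (V w))"
proof (rule C_k_on_vec[OF assms(1)])
  fix l
  have "C_k_on k U (\<lambda>w. chris G (f w) l i j)" for i j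
    by (rule C_k_on_compose[OF assms(1) open_domain assms(2,3) smooth_chris])
  then have "C_k_on k U (\<lambda>w. \<Sum>i\<in>UNIV. \<Sum>j\<in>UNIV. of_real (chris G (f w) l i j * a w $ i) * V w $ j)"
    by (intro C_k_on_sum C_k_on_mult C_k_on_of_real C_k_on_vec_nth assms)
  then show "C_k_on k U (\<lambda>w. chr G (f w) (a w) (V w) $ l)" by (simp add: chr_def)
qed

lemma C_k_on_cov:
  fixes V :: "'a::euclidean_space \<Rightarrow> 'k::{real_normed_field, euclidean_space}^'n"
  assumes "open U" "f ` U \<subseteq> \<Omega>" "C_k_on (Suc k) U f" "C_k_on (Suc k) U V"
  shows "C_k_on k U (cov G f e V)"
  unfolding cov_def[abs_def] using C_k_on_SucD[OF assms(3)] C_k_on_SucD[OF assms(4)]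
  by (intro C_k_on_add C_k_on_chr C_k_on_frechet_derivative assms)

lemma C_k_on_ip:
  fixes V W :: "'a::euclidean_space \<Rightarrow> 'k::{real_normed_field, euclidean_space}^'n"
  assumes "open U" "f ` U \<subseteq> \<Omega>" "C_k_on k U f" "C_k_on k U V" "C_k_on k U W"
  shows "C_k_on k U (\<lambda>w. ip (G (f w)) (V w) (W w))"
proof -
  have "C_k_on k U (\<lambda>w. G (f w) $ i $ j)" for i j
    by (rule C_k_on_compose[OF assms(1) open_domain assms(2,3) smooth])
  then have "C_k_on k U (\<lambda>w. of_real (G (f w) $ i $ j) :: 'k)" for i j
    by (rule C_k_on_of_real[OF assms(1)])
  moreover have "C_k_on k U (\<lambda>w. V w $ i)" "C_k_on k U (\<lambda>w. W w $ i)" for i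
    by (intro C_k_on_vec_nth assms)+
  ultimately show ?thesis
    unfolding ip_def by (intro C_k_on_sum C_k_on_mult assms(1))
qed

lemma C_k_on_crv:
  fixes X Y Z :: "'a::euclidean_space \<Rightarrow> 'k::{real_normed_field, euclidean_space}^'n"
  assumes U: "open U" and fU: "f ` U \<subseteq> \<Omega>" and f: "C_k_on k U f"
    and XYZ: "C_k_on k U X" "C_k_on k U Y" "C_k_on k U Z"
  shows "C_k_on k U (\<lambda>w. crv G (f w) (X w) (Y w) (Z w))"
proof (rule C_k_on_vec[OF U])
  fix l
  have "C_k_on k \<Omega> (\<lambda>x. riem G x l i j m)" for i j m
    unfolding riem_def
    by (intro C_k_on_add C_k_on_diff C_k_on_sum C_k_on_mult smooth_chris open_domain
        C_k_on_frechet_derivative[OF open_domain smooth_chris])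
  then have "C_k_on k U (\<lambda>w. riem G (f w) l i j m)" for i j m
    by (rule C_k_on_compose[OF U open_domain fU f])
  then have R: "C_k_on k U (\<lambda>w. of_real (riem G (f w) l i j m) :: 'k)" for i j m
    by (rule C_k_on_of_real[OF U])
  have "C_k_on k U (\<lambda>w. \<Sum>i\<in>UNIV. \<Sum>j\<in>UNIV. \<Sum>m\<in>UNIV. of_real (riem G (f w) l i j m) * X w $ i * Y w $ j * Z w $ m)"
    by (intro C_k_on_sum C_k_on_mult U R C_k_on_vec_nth[OF U XYZ(1)] C_k_on_vec_nth[OF U XYZ(2)] C_k_on_vec_nth[OF U XYZ(3)])
  then show "C_k_on k U (\<lambda>w. crv G (f w) (X w) (Y w) (Z w) $ l)" by (simp add: crv_def)
qed

end

lemma cov_add: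
  assumes "V differentiable (at w)" "W differentiable (at w)"
  shows "cov G f e (\<lambda>w. V w + W w) w = cov G f e V w + cov G f e W w"
  using pd_eqI[OF has_derivative_add[OF assms[unfolded frechet_derivative_works]], of e]
  by (simp add: cov_def chr_add_right)

lemma has_derivative_smult:
  fixes V :: "'a::real_normed_vector \<Rightarrow> 'k::real_normed_field^'n"
  assumes "(a has_derivative a') (at w)" "(V has_derivative V') (at w)"
  shows "((\<lambda>w. a w *s V w) has_derivative (\<lambda>e. a' e *s V w + a w *s V' e)) (at w)"
proof (rule has_derivative_vecI)
  fix i
  have "((\<lambda>w. a w * V w $ i) has_derivative (\<lambda>e. a w * V' e $ i + a' e * V w $ i)) (at w)"
    by (rule has_derivative_mult[OF assms(1) has_derivative_vec_nth[OF assms(2)]])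
  then show "((\<lambda>w. (a w *s V w) $ i) has_derivative (\<lambda>e. (a' e *s V w + a w *s V' e) $ i)) (at w)"
    by (simp add: add.commute)
qed

lemma cov_smult:
  fixes V :: "'a::euclidean_space \<Rightarrow> 'k::{real_normed_field, euclidean_space}^'n"
  assumes "a differentiable (at w)" "V differentiable (at w)"
  shows "cov G f e (\<lambda>w. a w *s V w) w = pd e a w *s V w + a w *s cov G f e V w"
  using pd_eqI[OF has_derivative_smult[OF assms[unfolded frechet_derivative_works]], of e]
  by (simp add: cov_def chr_scale_right vec.scale_right_distrib)

lemma cov_cong:
  assumes "open U" "w \<in> U" "V differentiable (at w)" "\<And>w. w \<in> U \<Longrightarrow> V w = W w"
  shows "cov G f e V w = cov G f e W w"
  using frechet_derivative_transform_within_open[OF assms(3,1,2,4)] assms(2,4) by (simp add: cov_def)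


lemma vof_real [simp]: "vof u = u"
  by (simp add: vof_def vec_eq_iff)

lemma crv_antisym: "crv G x Y X Z = - crv G x X Y Z"
proof -
  have anti: "riem G x l i j k = - riem G x l j i k" for l i j k
    by (simp add: riem_def sum_subtractf)
  have "of_real (riem G x l i j k) * Y $ i * X $ j * Z $ k = - (of_real (riem G x l j i k) * X $ j * Y $ i * Z $ k)" for l i j k
    by (subst anti) simp
  then have "crv G x Y X Z $ l = - (\<Sum>i\<in>UNIV. \<Sum>j\<in>UNIV. \<Sum>k\<in>UNIV. of_real (riem G x l j i k) * X $ j * Y $ i * Z $ k)" for l
    by (simp add: crv_def sum_negf)
  also have "\<dots> l = - crv G x X Y Z $ l" for l
    by (subst sum.swap) (simp add: crv_def)
  finally show ?thesis by (simp add: vec_eq_iff)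
qed

lemma crv_add:
  "crv G x (X + X') Y Z = crv G x X Y Z + crv G x X' Y Z"
  "crv G x Y (X + X') Z = crv G x Y X Z + crv G x Y X' Z"
  "crv G x Y Z (X + X') = crv G x Y Z X + crv G x Y Z X'"
  by (simp_all add: crv_def vec_eq_iff sum.distrib algebra_simps)

lemma crv_diff:
  "crv G x (X - X') Y Z = crv G x X Y Z - crv G x X' Y Z"
  "crv G x Y (X - X') Z = crv G x Y X Z - crv G x Y X' Z"
  "crv G x Y Z (X - X') = crv G x Y Z X - crv G x Y Z X'"
  by (simp_all add: crv_def vec_eq_iff sum_subtractf algebra_simps)

lemma crv_scale:
  "crv G x (a *s X) Y Z = a *s crv G x X Y Z"
  "crv G x Y (a *s X) Z = a *s crv G x Y X Z"
  "crv G x Y Z (a *s X) = a *s crv G x Y Z X"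
  by (simp_all add: crv_def vec_eq_iff sum_distrib_left mult_ac)

lemma crv_zero [simp]: "crv G x 0 Y Z = 0" "crv G x Y 0 Z = 0" "crv G x Y Z 0 = 0"
  by (simp_all add: crv_def vec_eq_iff)

section \<open>Symmetries of the curvature tensor\<close>

context metric_coords
begin

lemma cov_const: "cov G (\<lambda>x. x) a (\<lambda>_. c) x = chr G x a c"
  by (simp add: cov_def)

lemma C_k_on_cov_ident:
  fixes V :: "real^'n \<Rightarrow> 'k::{real_normed_field, euclidean_space}^'n"
  assumes "C_k_on (Suc k) \<Omega> V"
  shows "C_k_on k \<Omega> (cov G (\<lambda>x. x) a V)"
  by (rule C_k_on_cov[OF open_domain _ _ assms]) (simp_all del: C_k_on.simps)

lemma cov_commutator_ident:
  assumes "x \<in> \<Omega>"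
  shows "cov G (\<lambda>x. x) a (cov G (\<lambda>x. x) b (\<lambda>_. Z)) x - cov G (\<lambda>x. x) b (cov G (\<lambda>x. x) a (\<lambda>_. Z)) x = crv G x a b (Z :: real^'n)"
  using cov_commutator[OF open_domain assms, of "\<lambda>x. x" "\<lambda>_. Z" a b] by (simp del: C_k_on.simps)

text \<open>Second derivatives of the function \<open>ip (G y) Z W\<close> commute. Expanding them
  by compatibility, the products of first covariant derivatives are symmetric in \<open>a\<close>
  and \<open>b\<close>, so the difference leaves only the two curvature terms.\<close>

lemma crv_skew:
  assumes x: "x \<in> \<Omega>"
  shows "ip (G x) (crv G x a b Z) W = - ip (G x) Z (crv G x a b (W :: real^'n))"
proof -
  let ?c = "\<lambda>a Z. cov G (\<lambda>x. x) a (\<lambda>_. Z)"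
  let ?h = "\<lambda>y. ip (G y) Z W"
  have C1: "C_k_on (Suc 0) \<Omega> (?c a Z)" for a and Z :: "real^'n"
    by (rule C_k_on_cov_ident[OF C_k_on_const])
  have d: "?c a Z differentiable (at y)" if "y \<in> \<Omega>" for a y and Z :: "real^'n"
    using C1 that by simp
  have h1: "pd a ?h y = ip (G y) (?c a Z y) W + ip (G y) Z (?c a W y)" if "y \<in> \<Omega>" for a y
    using that by (intro cov_compatible) auto
  have Ch: "C_k_on 2 \<Omega> ?h"
    by (rule C_k_on_ip[OF open_domain]) (simp_all del: C_k_on.simps)
  have h2: "pd b (\<lambda>y. pd a ?h y) x = ip (G x) (cov G (\<lambda>x. x) b (?c a Z) x) W + ip (G x) (?c a Z x) (?c b W x)
      + (ip (G x) (?c b Z x) (?c a W x) + ip (G x) Z (cov G (\<lambda>x. x) b (?c a W) x))" for a b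
  proof -
    have dd: "(\<lambda>y. ip (G y) (?c a Z y) W) differentiable (at x)" "(\<lambda>y. ip (G y) Z (?c a W y)) differentiable (at x)"
      using C_k_on_ip[OF open_domain _ C_k_on_ident C1 C_k_on_const, of a Z W]
        C_k_on_ip[OF open_domain _ C_k_on_ident C_k_on_const C1, of Z a W] x by simp_all
    have "pd b (\<lambda>y. pd a ?h y) x = pd b (\<lambda>y. ip (G y) (?c a Z y) W + ip (G y) Z (?c a W y)) x"
      by (rule fun_cong[OF frechet_derivative_transform_within_open[OF _ open_domain x, symmetric]])
         (auto simp: h1 intro!: differentiable_add dd)
    also have "\<dots> = pd b (\<lambda>y. ip (G y) (?c a Z y) W) x + pd b (\<lambda>y. ip (G y) Z (?c a W y)) x"
      by (rule pd_eqI[OF has_derivative_add[OF dd[unfolded frechet_derivative_works]]])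
    finally show ?thesis
      using cov_compatible[of "\<lambda>x. x" x "?c a Z" "\<lambda>_. W" b] cov_compatible[of "\<lambda>x. x" x "\<lambda>_. Z" "?c a W" b] x d
      by simp
  qed
  have "pd b (\<lambda>y. pd a ?h y) x = pd a (\<lambda>y. pd b ?h y) x"
    by (rule symmetric_second_derivative[OF open_domain Ch x])
  then have "ip (G x) (crv G x a b Z) W + ip (G x) Z (crv G x a b W) = 0"
    unfolding h2 cov_commutator_ident[OF x, symmetric] ip_linear by linarith
  then show ?thesis by linarith
qed

text \<open>For constant coordinate fields the connection is torsion free, so the inner derivatives
  may be swapped and the six second derivatives cancel in pairs.\<close>

lemma crv_bianchi:
  assumes x: "x \<in> \<Omega>"
  shows "crv G x a b c + crv G x b c a + crv G x c a (b :: real^'n) = 0"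
proof -
  let ?c = "\<lambda>a Z. cov G (\<lambda>x. x) a (\<lambda>_. Z :: real^'n)"
  have sym: "cov G (\<lambda>x. x) a (?c b c) x = cov G (\<lambda>x. x) a (?c c b) x" for a b c
  proof (rule cov_cong[OF open_domain x])
    show "?c b c differentiable (at x)"
      using C_k_on_cov_ident[OF C_k_on_const, of 1 b c] x by simp
  qed (simp add: cov_const chr_symmetric)
  show ?thesis
    unfolding cov_commutator_ident[OF x, symmetric]
    using sym[of a b c] sym[of b c a] sym[of c a b] by simp
qed

lemma crv_pair:
  assumes x: "x \<in> \<Omega>"
  shows "ip (G x) (crv G x a b c) d = ip (G x) (crv G x c d a) (b :: real^'n)"
proof -
  define r where "r a b c d = ip (G x) (crv G x a b c) d" for a b c d :: "real^'n"
  have 1: "r b a c d = - r a b c d" for a b c d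
    by (simp add: r_def crv_antisym[of G x b a] ip_linear)
  have 2: "r a b d c = - r a b c d" for a b c d
    using crv_skew[OF x, of a b d c] ip_sym[OF x] by (simp add: r_def)
  have 3: "r a b c d + r b c a d + r c a b d = 0" for a b c d
    unfolding r_def ip_add_left[symmetric] crv_bianchi[OF x] by (rule ip_zero_left)
  \<comment> \<open>The classical octahedron argument: in a signed combination of the four cyclic
    identities the two skew symmetries cancel all values except those with the pairs
    \<open>a b\<close> and \<open>c d\<close> exchanged.\<close>
  have "r a b c d = r c d a b"
    using 3[of a b c d] 3[of b c d a] 3[of c d a b] 3[of d a b c]
      1[of a d b c] 1[of b d a c] 1[of b d c a] 1[of a c b d] 1[of a c d b] 1[of c b d a] 1[of d c a b] 1[of d a b c] 1[of b c a d] 1[of d b a c]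
      2[of a b c d] 2[of b c a d] 2[of c a b d] 2[of b c d a] 2[of c d b a] 2[of d b c a]
      2[of c d a b] 2[of d a c b] 2[of a c d b] 2[of d a b c] 2[of a b d c] 2[of b d a c]
      1[of b a c d] 1[of c a b d] 1[of d b c a] 1[of c d a b] 1[of d b c a]
    by linarith
  then show ?thesis by (simp add: r_def)
qed

text \<open>Makes the curvature part of the energy integrand a symmetric form in the variation
  field, so that its mixed terms in \<open>s\<close> and \<open>\<sigma>\<close> combine with factor
  2.\<close>

lemma jacobi_symmetric:
  assumes x: "x \<in> \<Omega>"
  shows "ip (G x) (crv G x u X X) v = ip (G x) (crv G x v X X) (u :: real^'n)"
  using crv_pair[OF x, of u X X v] crv_skew[OF x, of X v u X] crv_antisym[of G x v X X] ip_sym[OF x, of u]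
  by (simp add: ip_linear)

end

section \<open>Behaviour of connection and curvature under changes of coordinates\<close>

definition jact :: "(real^'n \<Rightarrow> real^'n) \<Rightarrow> real^'n \<Rightarrow> 'k^'n \<Rightarrow> 'k::real_normed_field^'n" where
  "jact \<phi> x v = (\<chi> i. \<Sum>j\<in>UNIV. of_real (pd (axis j 1) \<phi> x $ i) * v $ j)"

lemma jact_expand: "jact \<phi> x v = (\<Sum>j\<in>UNIV. v $ j *s vof (pd (axis j 1) \<phi> x))"
  by (simp add: jact_def vec_eq_iff mult.commute)

lemma jact_add: "jact \<phi> x (u + v) = jact \<phi> x u + jact \<phi> x v"
  and jact_diff: "jact \<phi> x (u - v) = jact \<phi> x u - jact \<phi> x v"
  and jact_scale: "jact \<phi> x (c *s v) = c *s jact \<phi> x v"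
  and jact_vof: "jact \<phi> x (vof r) = vof (jact \<phi> x r)"
  by (simp_all add: jact_def vec_eq_iff sum.distrib sum_subtractf sum_distrib_left algebra_simps)

lemma jact_sum: "jact \<phi> x (\<Sum>i\<in>I. u i) = (\<Sum>i\<in>I. jact \<phi> x (u i))"
proof (induction I rule: infinite_finite_induct)
  case (insert i I)
  then show ?case by (simp add: jact_add)
qed (simp_all add: jact_def vec_eq_iff)

lemma jact_real:
  assumes "\<phi> differentiable (at x)"
  shows "jact \<phi> x v = pd v \<phi> x"
proof -
  have "pd v \<phi> x = (\<Sum>j\<in>UNIV. (v $ j) *\<^sub>R pd (axis j 1) \<phi> x)" by (rule pd_sum_axis[OF assms])
  then show ?thesis by (simp add: jact_def vec_eq_iff mult.commute)
qed

text \<open>A transition map seen as an isometry between two coordinate domains. Surjectivity of the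
  differential lets a vector be tested against images of vectors only.\<close>

locale metric_change = c: metric_coords \<Omega>c Gc + d: metric_coords \<Omega>d Gd
  for \<Omega>c \<Omega>d :: "(real^'n) set" and Gc Gd +
  fixes \<Omega> :: "(real^'n) set" and \<phi> :: "real^'n \<Rightarrow> real^'n"
  assumes open_overlap: "open \<Omega>" and overlap: "\<Omega> \<subseteq> \<Omega>c" "\<phi> ` \<Omega> \<subseteq> \<Omega>d"
    and smooth_change: "C_k_on k \<Omega> \<phi>"
    and isometric: "x \<in> \<Omega> \<Longrightarrow> ip (Gc x) u v = (ip (Gd (\<phi> x)) (pd u \<phi> x) (pd v \<phi> x) :: real)"
    and surjective: "x \<in> \<Omega> \<Longrightarrow> \<exists>u. pd u \<phi> x = v"
begin

lemma differentiable_change: "x \<in> \<Omega> \<Longrightarrow> \<phi> differentiable (at x)"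
  using smooth_change[of "Suc 0"] by simp

lemma pd_change: "x \<in> \<Omega> \<Longrightarrow> pd v \<phi> x = jact \<phi> x v"
  by (simp add: jact_real differentiable_change)

text \<open>The Koszul formula determines both sides, the left one through the compatibility of the
  connection \<open>cov Gd \<phi>\<close> with the metric.\<close>

lemma chris_change:
  assumes x: "x \<in> \<Omega>"
  shows "cov Gd \<phi> a (\<lambda>x. pd b \<phi> x) x = pd (chr Gc x a b) \<phi> x"
proof -
  define T where "T a b = cov Gd \<phi> a (\<lambda>x. pd b \<phi> x) x" for a b
  have xc: "x \<in> \<Omega>c" and xd: "\<phi> x \<in> \<Omega>d" using x overlap by auto
  have C1: "C_k_on (Suc 0) \<Omega> (\<lambda>x. pd b \<phi> x)" for b
    by (rule C_k_on_frechet_derivative[OF open_overlap smooth_change])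
  have db: "(\<lambda>x. pd b \<phi> x) differentiable (at x)" for b
    using C1 x by simp
  have Tsym: "T a b = T b a" for a b
    unfolding T_def cov_def
    using symmetric_second_derivative[OF open_overlap smooth_change x, of b a] d.chr_symmetric[OF xd]
    by simp
  have Tip: "c.dG x a b c = ip (Gd (\<phi> x)) (T a b) (pd c \<phi> x) + ip (Gd (\<phi> x)) (pd b \<phi> x) (T a c)" for a b c :: "real^'n"
  proof -
    have "c.dG x a b c = pd a (\<lambda>y. ip (Gc y) b c) x"
      using c.cov_compatible[of "\<lambda>x. x" x "\<lambda>_. b" "\<lambda>_. c" a] xc by (simp add: c.dG_compatible c.cov_const)
    also have "\<dots> = pd a (\<lambda>y. ip (Gd (\<phi> y)) (pd b \<phi> y) (pd c \<phi> y)) x"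
    proof (rule fun_cong[OF frechet_derivative_transform_within_open[OF _ open_overlap x isometric]])
      show "(\<lambda>y. ip (Gc y) b c) differentiable (at x)"
        using c.C_k_on_ip[OF c.open_domain _ C_k_on_ident C_k_on_const C_k_on_const, of "Suc 0" b c] xc by simp
    qed
    also have "\<dots> = ip (Gd (\<phi> x)) (T a b) (pd c \<phi> x) + ip (Gd (\<phi> x)) (pd b \<phi> x) (T a c)"
      unfolding T_def by (rule d.cov_compatible[OF xd differentiable_change[OF x] db db])
    finally show ?thesis .
  qed
  have "ip (Gd (\<phi> x)) (T a b - pd (chr Gc x a b) \<phi> x) v = 0" for v
  proof -
    obtain c where c: "pd c \<phi> x = v" using surjective[OF x] by blast
    have "2 * ip (Gd (\<phi> x)) (pd (chr Gc x a b) \<phi> x) (pd c \<phi> x) = 2 * ip (Gc x) (chr Gc x a b) c"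
      by (simp add: isometric[OF x])
    also have "\<dots> = c.dG x a b c + c.dG x b a c - c.dG x c a b" by (rule c.koszul[OF xc])
    also have "\<dots> = 2 * ip (Gd (\<phi> x)) (T a b) (pd c \<phi> x)"
      unfolding Tip using Tsym[of a b] Tsym[of a c] Tsym[of b c] d.ip_sym[OF xd] by simp
    finally show ?thesis by (simp add: ip_linear c)
  qed
  then have "T a b - pd (chr Gc x a b) \<phi> x = 0" by (rule d.ip_nondegenerate[OF xd])
  then show ?thesis by (simp add: T_def)
qed

text \<open>The product rule for \<open>jact\<close> produces second derivatives of
  \<open>\<phi>\<close>; on coordinate vectors these are absorbed by \<open>chris_change\<close>.
  Expanding \<open>V\<close> in coordinate vectors carries the result over to scalars
  \<open>'k\<close>.\<close>

lemma cov_change: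
  fixes V :: "'a::euclidean_space \<Rightarrow> 'k::{real_normed_field, euclidean_space}^'n"
  assumes x: "f w \<in> \<Omega>" and f: "f differentiable (at w)" and V: "V differentiable (at w)"
  shows "cov Gd (\<lambda>w. \<phi> (f w)) e (\<lambda>w. jact \<phi> (f w) (V w)) w = jact \<phi> (f w) (cov Gc f e V w)"
proof -
  note df = f[unfolded frechet_derivative_works] and dV = V[unfolded frechet_derivative_works]
  let ?x = "f w" and ?fe = "pd e f w"
  have C1: "C_k_on (Suc 0) \<Omega> (\<lambda>x. pd b \<phi> x)" for b
    by (rule C_k_on_frechet_derivative[OF open_overlap smooth_change])
  have dj: "((\<lambda>w. jact \<phi> (f w) (V w)) has_derivative
      (\<lambda>e. (\<Sum>j\<in>UNIV. V w $ j *s vof (pd (pd e f w) (\<lambda>x. pd (axis j 1) \<phi> x) ?x)) + jact \<phi> ?x (pd e V w))) (at w)"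
  proof (rule has_derivative_vecI)
    fix i
    have "((\<lambda>w. \<Sum>j\<in>UNIV. of_real (pd (axis j 1) \<phi> (f w) $ i) * V w $ j) has_derivative
       (\<lambda>e. \<Sum>j\<in>UNIV. of_real (pd (axis j 1) \<phi> (f w) $ i) * pd e V w $ j
           + of_real (pd (pd e f w) (\<lambda>x. pd (axis j 1) \<phi> x) ?x $ i) * V w $ j)) (at w)"
      by (intro has_derivative_sum has_derivative_mult bounded_linear.has_derivative[OF bounded_linear_of_real]
          has_derivative_vec_nth[OF dV] has_derivative_vec_nth
          has_derivative_compose[OF df C_k_on_has_derivative[OF C1 x]])
    then show "((\<lambda>w. jact \<phi> (f w) (V w) $ i) has_derivative (\<lambda>e. ((\<Sum>j\<in>UNIV. V w $ j *s vof (pd (pd e f w) (\<lambda>x. pd (axis j 1) \<phi> x) ?x))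
        + jact \<phi> ?x (pd e V w)) $ i)) (at w)"
      by (simp add: jact_def sum.distrib mult.commute add.commute)
  qed
  have d\<phi>: "pd e (\<lambda>w. \<phi> (f w)) w = pd ?fe \<phi> ?x"
    by (rule pd_eqI[OF has_derivative_compose[OF df differentiable_change[OF x, unfolded frechet_derivative_works]]])
  have "cov Gd (\<lambda>w. \<phi> (f w)) e (\<lambda>w. jact \<phi> (f w) (V w)) w
      = jact \<phi> ?x (pd e V w) + ((\<Sum>j\<in>UNIV. V w $ j *s vof (pd ?fe (\<lambda>x. pd (axis j 1) \<phi> x) ?x))
        + chr Gd (\<phi> ?x) (pd ?fe \<phi> ?x) (jact \<phi> ?x (V w)))"
    by (simp add: cov_def pd_eqI[OF dj] d\<phi>)
  also have "chr Gd (\<phi> ?x) (pd ?fe \<phi> ?x) (jact \<phi> ?x (V w))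
      = (\<Sum>j\<in>UNIV. V w $ j *s vof (chr Gd (\<phi> ?x) (pd ?fe \<phi> ?x) (pd (axis j 1) \<phi> ?x)))"
    unfolding jact_expand by (simp add: chr_sum_right chr_scale_right chr_vof)
  also have "(\<Sum>j\<in>UNIV. V w $ j *s vof (pd ?fe (\<lambda>x. pd (axis j 1) \<phi> x) ?x)) + \<dots>
      = (\<Sum>j\<in>UNIV. V w $ j *s vof (cov Gd \<phi> ?fe (\<lambda>x. pd (axis j 1) \<phi> x) ?x))"
    unfolding sum.distrib[symmetric] by (simp add: cov_def vec_eq_iff algebra_simps)
  also have "\<dots> = (\<Sum>j\<in>UNIV. V w $ j *s vof (jact \<phi> ?x (chr Gc ?x ?fe (axis j 1))))"
    by (simp add: chris_change[OF x] pd_change[OF x])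
  also have "\<dots> = jact \<phi> ?x (chr Gc ?x ?fe (V w))"
    by (subst (2) chr_expand) (simp add: jact_sum jact_scale jact_vof)
  finally show ?thesis by (simp add: cov_def jact_add)
qed

text \<open>Curvature is a commutator of covariant derivatives, and covariant derivatives transform
  by \<open>cov_change\<close>. This bypasses any direct computation with third derivatives of
  \<open>\<phi>\<close>.\<close>

lemma crv_change:
  assumes x: "x \<in> \<Omega>"
  shows "crv Gd (\<phi> x) (jact \<phi> x a) (jact \<phi> x b) (jact \<phi> x Z) = jact \<phi> x (crv Gc x a b (Z :: real^'n))"
proof -
  let ?Z = "\<lambda>x. jact \<phi> x Z"
  have xc: "x \<in> \<Omega>c" using x overlap by auto
  have 1: "cov Gd \<phi> b ?Z y = jact \<phi> y (cov Gc (\<lambda>x. x) b (\<lambda>_. Z) y)" if "y \<in> \<Omega>" for b y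
    using cov_change[of "\<lambda>x. x" y "\<lambda>_. Z" b] that by simp
  have CZ: "C_k_on 2 \<Omega> ?Z"
    by (rule C_k_on_cong[OF open_overlap _ C_k_on_frechet_derivative[OF open_overlap smooth_change]])
       (simp add: pd_change)
  have 2: "cov Gd \<phi> a (cov Gd \<phi> b ?Z) x = jact \<phi> x (cov Gc (\<lambda>x. x) a (cov Gc (\<lambda>x. x) b (\<lambda>_. Z)) x)" for a b
  proof -
    have "C_k_on (Suc 0) \<Omega> (cov Gd \<phi> b ?Z)"
      using CZ by (intro d.C_k_on_cov open_overlap overlap smooth_change) (simp add: numeral_2_eq_2 del: C_k_on.simps)
    then have "cov Gd \<phi> b ?Z differentiable (at x)" using x by simp
    then have "cov Gd \<phi> a (cov Gd \<phi> b ?Z) x = cov Gd \<phi> a (\<lambda>y. jact \<phi> y (cov Gc (\<lambda>x. x) b (\<lambda>_. Z) y)) x"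
      by (rule cov_cong[OF open_overlap x _ 1])
    moreover have "cov Gc (\<lambda>x. x) b (\<lambda>_. Z) differentiable (at x)"
      using c.C_k_on_cov_ident[OF C_k_on_const, of 1 b Z] xc by simp
    ultimately show ?thesis
      using cov_change[of "\<lambda>x. x" x "cov Gc (\<lambda>x. x) b (\<lambda>_. Z)" a] x by simp
  qed
  have "crv Gd (\<phi> x) (jact \<phi> x a) (jact \<phi> x b) (jact \<phi> x Z)
      = cov Gd \<phi> a (cov Gd \<phi> b ?Z) x - cov Gd \<phi> b (cov Gd \<phi> a ?Z) x"
    using d.cov_commutator[OF open_overlap x overlap(2) smooth_change CZ, of a b] by (simp add: pd_change[OF x])
  also have "\<dots> = jact \<phi> x (crv Gc x a b Z)"
    unfolding 2 jact_diff[symmetric] c.cov_commutator_ident[OF xc] ..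
  finally show ?thesis .
qed

end

section \<open>Riemannian manifolds\<close>

lemma christoffel_eq: "christoffel A g c = chris (gram A g c)"
  by (intro ext) (simp add: christoffel_def chris_def)

lemma riemann_coeff_eq: "riemann_coeff A g c = riem (gram A g c)"
  by (intro ext) (simp add: riemann_coeff_def riem_def christoffel_eq)

locale riemannian_manifold =
  fixes A :: "('m::topological_space, real^'n) chart set"
    and g :: "'m \<Rightarrow> ('m, 'n, real) tvec \<Rightarrow> ('m, 'n, real) tvec \<Rightarrow> real"
  assumes manifold: "smooth_manifold A" and metric: "riemannian_metric A g"
begin

lemma is_chart: "c \<in> A \<Longrightarrow> is_chart c"
  using manifold by (simp add: smooth_manifold_def)

lemmas chart = is_chartD[OF is_chart]

lemma chart_at: obtains c where "c \<in> A" "q \<in> fst c"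
  using manifold unfolding smooth_manifold_def by blast

definition trans :: "('m, real^'n) chart \<Rightarrow> ('m, real^'n) chart \<Rightarrow> real^'n \<Rightarrow> real^'n" where
  "trans c d = snd d \<circ> chart_inv c"

lemma trans_chart: "c \<in> A \<Longrightarrow> q \<in> fst c \<Longrightarrow> trans c d (snd c q) = snd d q"
  by (simp add: trans_def chart)

lemma open_overlap: "c \<in> A \<Longrightarrow> d \<in> A \<Longrightarrow> open (snd c ` (fst c \<inter> fst d))"
  by (intro open_chart_image is_chart open_Int chart) auto

lemma C_k_on_trans: "c \<in> A \<Longrightarrow> d \<in> A \<Longrightarrow> C_k_on k (snd c ` (fst c \<inter> fst d)) (trans c d)"
  using manifold unfolding smooth_manifold_def C_inf_on_def trans_def by blast

lemma trans_has_derivative: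
  assumes "c \<in> A" "d \<in> A" "q \<in> fst c" "q \<in> fst d"
  shows "(trans c d has_derivative (\<lambda>e. pd e (trans c d) (snd c q))) (at (snd c q))"
  using assms by (intro C_k_on_has_derivative[OF C_k_on_trans]) auto

lemma trans_differentiable:
  assumes "c \<in> A" "d \<in> A" "q \<in> fst c" "q \<in> fst d"
  shows "trans c d differentiable (at (snd c q))"
  using trans_has_derivative[OF assms] by (auto simp: differentiable_def)

lemma jact_cocycle:
  assumes "c \<in> A" "d \<in> A" "e \<in> A" "q \<in> fst c" "q \<in> fst d" "q \<in> fst e"
  shows "jact (trans d e) (snd d q) (jact (trans c d) (snd c q) u) = jact (trans c e) (snd c q) u"
proof -
  have q: "trans c d (snd c q) = snd d q" by (rule trans_chart[OF assms(1,4)])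
  have "pd v (trans d e) (snd d q) = jact (trans d e) (snd d q) v" for v
    by (rule jact_real[symmetric]) (intro trans_differentiable assms)
  moreover have "pd (pd v (trans c d) (snd c q)) (trans d e) (snd d q) = pd v (trans c e) (snd c q)" for v
  proof -
    have "((\<lambda>x. trans d e (trans c d x)) has_derivative
        (\<lambda>v. pd (pd v (trans c d) (snd c q)) (trans d e) (snd d q))) (at (snd c q))"
      by (rule has_derivative_compose[OF trans_has_derivative[OF assms(1,2,4,5)]])
         (use trans_has_derivative[OF assms(2,3,5,6)] q in simp)
    then have "(trans c e has_derivative
        (\<lambda>v. pd (pd v (trans c d) (snd c q)) (trans d e) (snd d q))) (at (snd c q))"
      by (rule has_derivative_transform_within_open[OF _ open_overlap[OF assms(1,2)]])
         (use assms trans_chart[OF assms(1), of _ d] trans_chart[OF assms(1), of _ e] trans_chart[OF assms(2), of _ e] in auto)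
    then show ?thesis by (rule pd_eqI[symmetric])
  qed
  ultimately have "jact (trans d e) (snd d q) (pd v (trans c d) (snd c q)) = pd v (trans c e) (snd c q)" for v
    by simp
  then show ?thesis
    by (simp add: jact_expand[of "trans c d"] jact_expand[of "trans c e"] jact_sum jact_scale jact_vof)
qed

lemma jact_ident:
  assumes "c \<in> A" "q \<in> fst c"
  shows "jact (trans c c) (snd c q) u = u"
proof -
  have "((\<lambda>x. x) has_derivative (\<lambda>v. v)) (at (snd c q))" by (rule has_derivative_ident)
  then have "(trans c c has_derivative (\<lambda>v. v)) (at (snd c q))"
    by (rule has_derivative_transform_within_open[OF _ chart(2)[OF assms(1)]])
       (use assms trans_chart[OF assms(1), of _ c] in auto)
  then have "pd v (trans c c) (snd c q) = v" for v by (rule pd_eqI)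
  then show ?thesis by (simp add: jact_expand flip: vec_expand)
qed

lemma tvec_at_nth:
  "tvec_at A c q u d = (if d \<in> A \<and> q \<in> fst d then jact (trans c d) (snd c q) u else 0)"
  by (simp add: tvec_at_def tfamily_def jact_def trans_def)

lemma tvec_at_in_tangent_space:
  assumes "c \<in> A" "q \<in> fst c"
  shows "tvec_at A c q u \<in> tangent_space A q"
  unfolding tangent_space_def
proof (intro CollectI ballI impI ext)
  fix d e assume "d \<in> A" "q \<in> fst d"
  then show "tvec_at A c q u e = tvec_at A d q (tvec_at A c q u d) e"
    using assms by (simp add: tvec_at_nth jact_cocycle)
qed

lemma tvec_at_self [simp]: "c \<in> A \<Longrightarrow> q \<in> fst c \<Longrightarrow> tvec_at A c q u c = u"
  by (simp add: tvec_at_nth jact_ident)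

lemma tangent_space_eq:
  assumes "c \<in> A" "q \<in> fst c" "v \<in> tangent_space A q"
  shows "v = tvec_at A c q (v c)"
  using assms unfolding tangent_space_def by blast

lemma tangent_space_change:
  assumes "c \<in> A" "q \<in> fst c" "d \<in> A" "q \<in> fst d" "v \<in> tangent_space A q"
  shows "v d = jact (trans c d) (snd c q) (v c)"
proof -
  have "v d = tvec_at A c q (v c) d" using tangent_space_eq[OF assms(1,2,5)] by (rule fun_cong)
  then show ?thesis using assms by (simp add: tvec_at_nth)
qed

lemma tangent_space_outside:
  assumes "v \<in> tangent_space A q" "\<not> (d \<in> A \<and> q \<in> fst d)"
  shows "v d = 0"
proof -
  obtain c where c: "c \<in> A" "q \<in> fst c" using chart_at by blast
  have "v d = tvec_at A c q (v c) d" using tangent_space_eq[OF c assms(1)] by (rule fun_cong)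
  then show ?thesis using assms(2) by (simp only: tvec_at_nth if_False)
qed

lemma tangent_spaceI:
  assumes "\<And>c d. c \<in> A \<Longrightarrow> q \<in> fst c \<Longrightarrow> d \<in> A \<Longrightarrow> q \<in> fst d \<Longrightarrow> v d = jact (trans c d) (snd c q) (v c)"
    and "\<And>d. \<not> (d \<in> A \<and> q \<in> fst d) \<Longrightarrow> v d = 0"
  shows "v \<in> tangent_space A q"
  unfolding tangent_space_def
proof (intro CollectI ballI impI ext)
  fix c d assume c: "c \<in> A" "q \<in> fst c"
  show "v d = tvec_at A c q (v c) d"
  proof (cases "d \<in> A \<and> q \<in> fst d")
    case True
    then show ?thesis using assms(1)[OF c, of d] by (simp only: tvec_at_nth if_True simp_thms)
  next
    case False
    then show ?thesis using assms(2)[OF False] by (simp only: tvec_at_nth if_False)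
  qed
qed

lemma tangent_space_eqI:
  assumes "c \<in> A" "q \<in> fst c" "v \<in> tangent_space A q" "w \<in> tangent_space A q" "v c = w c"
  shows "v = w"
  using tangent_space_eq[OF assms(1,2,3)] tangent_space_eq[OF assms(1,2,4)] assms(5) by metis

text \<open>Any operation on coordinate vectors that commutes with all Jacobians acts on tangent
  vectors. Sums, scalings, conjugation and real parts are the instances.\<close>

lemma tangent_space_map2:
  assumes v: "v \<in> tangent_space A q" and w: "w \<in> tangent_space A q"
    and h: "h 0 0 = 0" "\<And>\<phi> x u u'. h (jact \<phi> x u) (jact \<phi> x u') = jact \<phi> x (h u u')"
  shows "(\<lambda>c. h (v c) (w c)) \<in> tangent_space A q"
proof (rule tangent_spaceI)
  fix c d assume c: "c \<in> A" "q \<in> fst c" and d: "d \<in> A" "q \<in> fst d"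
  show "h (v d) (w d) = jact (trans c d) (snd c q) (h (v c) (w c))"
    unfolding tangent_space_change[OF c d v] tangent_space_change[OF c d w] h(2) ..
next
  fix d assume "\<not> (d \<in> A \<and> q \<in> fst d)"
  then show "h (v d) (w d) = 0" using tangent_space_outside[OF v] tangent_space_outside[OF w] h(1) by simp
qed

lemma tangent_space_map:
  assumes "v \<in> tangent_space A q" "h 0 = 0" "\<And>\<phi> x u. h (jact \<phi> x u) = jact \<phi> x (h u)"
  shows "(\<lambda>c. h (v c)) \<in> tangent_space A q"
  using tangent_space_map2[OF assms(1,1), of "\<lambda>u _. h u"] assms(2,3) by simp

lemma tangent_space_add:
  "v \<in> tangent_space A q \<Longrightarrow> w \<in> tangent_space A q \<Longrightarrow> (\<lambda>c. v c + w c) \<in> tangent_space A q"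
  by (rule tangent_space_map2) (simp_all add: jact_add)

lemma tangent_space_diff:
  "v \<in> tangent_space A q \<Longrightarrow> w \<in> tangent_space A q \<Longrightarrow> (\<lambda>c. v c - w c) \<in> tangent_space A q"
  by (rule tangent_space_map2) (simp_all add: jact_diff)

lemma tangent_space_smult: "v \<in> tangent_space A q \<Longrightarrow> (\<lambda>c. a *s v c) \<in> tangent_space A q"
  by (erule tangent_space_map) (simp_all add: jact_scale)

lemma tangent_space_zero: "(\<lambda>c. 0) \<in> tangent_space A q"
  by (intro tangent_spaceI) (auto simp: jact_def vec_eq_iff)

lemma metricD:
  assumes "u \<in> tangent_space A q" "v \<in> tangent_space A q" "w \<in> tangent_space A q"
  shows "g q u v = g q v u" "g q (\<lambda>c. a *\<^sub>R u c + v c) w = a * g q u w + g q v w"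
    "u \<noteq> (\<lambda>c. 0) \<Longrightarrow> g q u u > 0"
  using metric assms unfolding riemannian_metric_def by blast+

text \<open>Membership and evaluation are proved together, since linearity of \<open>g\<close> is
  granted only for vectors already known to be tangent.\<close>

lemma metric_sum_left:
  assumes "\<And>i. i \<in> I \<Longrightarrow> u i \<in> tangent_space A q" "w \<in> tangent_space A q" "finite I"
  shows "(\<lambda>c. \<Sum>i\<in>I. a i *\<^sub>R u i c) \<in> tangent_space A q \<and>
    g q (\<lambda>c. \<Sum>i\<in>I. a i *\<^sub>R u i c) w = (\<Sum>i\<in>I. a i * g q (u i) w)"
  using assms(3,1)
proof (induction I)
  case empty
  have "g q (\<lambda>c. 0) w = 0"
    using metricD(2)[OF tangent_space_zero tangent_space_zero assms(2), of 1] by simp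
  then show ?case by (simp add: tangent_space_zero)
next
  case (insert i I)
  then show ?case
    using metricD(2)[of "u i" q "\<lambda>c. \<Sum>i\<in>I. a i *\<^sub>R u i c" w "a i"] assms(2)
      tangent_space_add[OF tangent_space_smult[of "u i" q "a i"], of "\<lambda>c. \<Sum>i\<in>I. a i *\<^sub>R u i c"]
    by (simp add: scalar_mult_eq_scaleR)
qed

lemma gram_nth:
  assumes "c \<in> A" "q \<in> fst c"
  shows "gram A g c (snd c q) $ i $ j = g q (tvec_at A c q (axis i 1)) (tvec_at A c q (axis j 1))"
  using chart(3)[OF assms] by (simp add: gram_def)

text \<open>Expansion in the coordinate basis at \<open>q\<close>. From here on every metric
  computation takes place in a single chart with its Gram matrix.\<close>

lemma metric_eq_ip:
  assumes c: "c \<in> A" "q \<in> fst c" and u: "u \<in> tangent_space A q" and v: "v \<in> tangent_space A q"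
  shows "g q u v = ip (gram A g c (snd c q)) (u c) (v c)"
proof -
  let ?e = "\<lambda>i. tvec_at A c q (axis i 1) :: ('m, 'n, real) tvec"
  have e: "?e i \<in> tangent_space A q" for i by (rule tvec_at_in_tangent_space[OF c])
  have exp: "w = (\<lambda>d. \<Sum>i\<in>UNIV. (w c $ i) *\<^sub>R ?e i d)" if "w \<in> tangent_space A q" for w
  proof (rule tangent_space_eqI[OF c that])
    show "(\<lambda>d. \<Sum>i\<in>UNIV. (w c $ i) *\<^sub>R ?e i d) \<in> tangent_space A q"
      using metric_sum_left[of UNIV ?e, OF e that] by simp
    show "w c = (\<Sum>i\<in>UNIV. (w c $ i) *\<^sub>R ?e i c)"
      using c vec_expand[of "w c"] by (simp add: scalar_mult_eq_scaleR)
  qed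
  have "g q u v = (\<Sum>i\<in>UNIV. u c $ i * g q (?e i) v)"
    using metric_sum_left[of UNIV ?e, OF e v, of "\<lambda>i. u c $ i"] exp[OF u] by simp
  also have "\<dots> = (\<Sum>i\<in>UNIV. u c $ i * (\<Sum>j\<in>UNIV. v c $ j * g q (?e j) (?e i)))"
    using metric_sum_left[of UNIV ?e, OF e e, of "\<lambda>i. v c $ i"] exp[OF v] metricD(1)[OF e v v] by simp
  also have "\<dots> = ip (gram A g c (snd c q)) (u c) (v c)"
    using metricD(1)[OF e e e] by (simp add: ip_def gram_nth[OF c] sum_distrib_left mult_ac)
  finally show ?thesis .
qed

lemma metric_coords_gram:
  assumes c: "c \<in> A"
  shows "metric_coords (snd c ` fst c) (gram A g c)"
proof
  show "open (snd c ` fst c)" by (rule chart(2)[OF c])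
  show "C_k_on k (snd c ` fst c) (\<lambda>x. gram A g c x $ i $ j)" for k i j
    using metric c unfolding riemannian_metric_def C_inf_on_def by blast
  fix x assume x: "x \<in> snd c ` fst c"
  then obtain q where q: "q \<in> fst c" "x = snd c q" by blast
  note t = tvec_at_in_tangent_space[OF c q(1)]
  show "gram A g c x $ i $ j = gram A g c x $ j $ i" for i j
    unfolding q(2) gram_nth[OF c q(1)] by (rule metricD(1)[OF t t t])
  show "ip (gram A g c x) u u > 0" if "u \<noteq> 0" for u :: "real^'n"
  proof -
    have "tvec_at A c q u \<noteq> (\<lambda>c. 0)"
      using that tvec_at_self[OF c q(1), of u] by metis
    then have "g q (tvec_at A c q u) (tvec_at A c q u) > 0" by (rule metricD(3)[OF t t t])
    then show ?thesis by (simp add: metric_eq_ip[OF c q(1) t t] c q)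
  qed
qed

text \<open>Both Gram matrices express the same \<open>g\<close>, hence the isometry; the reverse
  transition map supplies preimages under the differential.\<close>

lemma metric_change_trans:
  assumes c: "c \<in> A" and d: "d \<in> A"
  shows "metric_change (snd c ` fst c) (snd d ` fst d) (gram A g c) (gram A g d) (snd c ` (fst c \<inter> fst d)) (trans c d)"
proof (intro metric_change.intro metric_coords_gram metric_change_axioms.intro open_overlap C_k_on_trans c d)
  show "snd c ` (fst c \<inter> fst d) \<subseteq> snd c ` fst c" by auto
  show "trans c d ` snd c ` (fst c \<inter> fst d) \<subseteq> snd d ` fst d" using trans_chart[OF c, of _ d] by auto
  fix x assume "x \<in> snd c ` (fst c \<inter> fst d)"
  then obtain q where q: "q \<in> fst c" "q \<in> fst d" "x = snd c q" by blast
  have T: "trans c d x = snd d q" using q trans_chart[OF c q(1)] by simp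
  have J: "pd u (trans c d) x = jact (trans c d) x u" for u
    using jact_real[OF trans_differentiable[OF c d q(1,2)]] q(3) by simp
  show "ip (gram A g c x) u v = ip (gram A g d (trans c d x)) (pd u (trans c d) x) (pd v (trans c d) x)" for u v :: "real^'n"
    using metric_eq_ip[OF c q(1) tvec_at_in_tangent_space[OF c q(1)] tvec_at_in_tangent_space[OF c q(1)], of u v]
      metric_eq_ip[OF d q(2) tvec_at_in_tangent_space[OF c q(1)] tvec_at_in_tangent_space[OF c q(1)], of u v]
    unfolding T J unfolding q(3) using c d q by (simp add: tvec_at_nth jact_ident)
  show "\<exists>u. pd u (trans c d) x = v" for v
    unfolding J unfolding q(3) using jact_cocycle[OF d c d q(2,1,2), of v] jact_ident[OF d q(2), of v] by metis
qed

lemma curvature_nth: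
  assumes "c \<in> A" "q \<in> fst c"
  shows "curvature A g q X Y Z c = crv (gram A g c) (snd c q) (X c) (Y c) (Z c)"
  using assms by (simp add: curvature_def tfamily_def crv_def riemann_coeff_eq)

text \<open>The curvature is defined chart by chart, so only \<open>crv_change\<close> makes its
  values a coherent family of coordinate vectors.\<close>

lemma curvature_in_tangent_space:
  fixes X Y Z :: "('m, 'n, real) tvec"
  assumes XYZ: "X \<in> tangent_space A q" "Y \<in> tangent_space A q" "Z \<in> tangent_space A q"
  shows "curvature A g q X Y Z \<in> tangent_space A q"
proof (rule tangent_spaceI)
  fix c d assume c: "c \<in> A" "q \<in> fst c" and d: "d \<in> A" "q \<in> fst d"
  interpret metric_change "snd c ` fst c" "snd d ` fst d" "gram A g c" "gram A g d" "snd c ` (fst c \<inter> fst d)" "trans c d"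
    by (rule metric_change_trans[OF c(1) d(1)])
  have "snd c q \<in> snd c ` (fst c \<inter> fst d)" using c d by auto
  from crv_change[OF this, of "X c" "Y c" "Z c"]
  show "curvature A g q X Y Z d = jact (trans c d) (snd c q) (curvature A g q X Y Z c)"
    using trans_chart[OF c] XYZ[THEN tangent_space_change[OF c d]] by (simp add: curvature_nth c d)
qed (auto simp: curvature_def tfamily_def)

lemma tRe_in_tangent_space: "V \<in> tangent_space A q \<Longrightarrow> tRe V \<in> tangent_space A q"
  unfolding tRe_def by (erule tangent_space_map) (simp_all add: jact_def vec_eq_iff Re_sum)

lemma tIm_in_tangent_space: "V \<in> tangent_space A q \<Longrightarrow> tIm V \<in> tangent_space A q"
  unfolding tIm_def by (erule tangent_space_map) (simp_all add: jact_def vec_eq_iff Im_sum)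

lemma tcnj_in_tangent_space: "V \<in> tangent_space A q \<Longrightarrow> tcnj V \<in> tangent_space A q"
  unfolding tcnj_def by (erule tangent_space_map) (simp_all add: jact_def vec_eq_iff cnj_sum)

lemma tof_real_in_tangent_space: "v \<in> tangent_space A q \<Longrightarrow> tof_real v \<in> tangent_space A q"
  unfolding tof_real_def by (erule tangent_space_map) (simp_all add: jact_def vec_eq_iff)

end

definition vcnj :: "complex^'n \<Rightarrow> complex^'n" where "vcnj v = (\<chi> i. cnj (v $ i))"
definition vRe :: "complex^'n \<Rightarrow> real^'n" where "vRe v = (\<chi> i. Re (v $ i))"
definition vIm :: "complex^'n \<Rightarrow> real^'n" where "vIm v = (\<chi> i. Im (v $ i))"

lemma vcnj_simps [simp]: "vcnj (u + v) = vcnj u + vcnj v" "vcnj (u - v) = vcnj u - vcnj v" "vcnj (- v) = - vcnj v"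
    "vcnj (a *s v) = cnj a *s vcnj v" "vcnj (vcnj v) = v" "vcnj (vof r) = vof r" "vcnj 0 = 0"
  by (simp_all add: vcnj_def vec_eq_iff)

lemma vRe_vIm: "v = vof (vRe v) + \<i> *s vof (vIm v)"
  by (simp add: vec_eq_iff vRe_def vIm_def complex_eq_iff)

lemma vRe_simps [simp]: "vRe (u + v) = vRe u + vRe v" "vRe (u - v) = vRe u - vRe v" "vRe (vof r) = r" "vRe (\<i> *s v) = - vIm v"
    "vRe (vcnj v) = vRe v"
  and vIm_simps [simp]: "vIm (u + v) = vIm u + vIm v" "vIm (u - v) = vIm u - vIm v" "vIm (vof r) = 0" "vIm (\<i> *s v) = vRe v"
    "vIm (vcnj v) = - vIm v"
  by (simp_all add: vRe_def vIm_def vcnj_def vec_eq_iff)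

lemma ip_vof: "ip M (vof u) (vof v) = (of_real (ip M u v) :: 'k::real_normed_field)"
  by (simp add: ip_def)

lemma cnj_ip: "cnj (ip M u v) = ip M (vcnj u) (vcnj v)"
  by (simp add: ip_def vcnj_def cnj_sum)

lemma ip_complex: "ip M u v = Complex (ip M (vRe u) (vRe v) - ip M (vIm u) (vIm v)) (ip M (vRe u) (vIm v) + ip M (vIm u) (vRe v))"
  by (subst (1) vRe_vIm[of u], subst (1) vRe_vIm[of v])
     (simp add: ip_linear ip_vof complex_eq_iff)

lemma tRe_nth: "tRe V c = vRe (V c)" and tIm_nth: "tIm V c = vIm (V c)" and tcnj_nth: "tcnj V c = vcnj (V c)"
  and tof_real_nth: "tof_real v c = vof (v c)"
  by (simp_all add: tRe_def tIm_def tcnj_def tof_real_def vRe_def vIm_def vcnj_def vof_def)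

lemma (in riemannian_manifold) metric_bilinear_eq:
  assumes "c \<in> A" "q \<in> fst c" "V \<in> tangent_space A q" "W \<in> tangent_space A q"
  shows "metric_bilinear g q V W = ip (gram A g c (snd c q)) (V c) (W c)"
  unfolding metric_bilinear_def ip_complex
  using assms by (simp add: metric_eq_ip[OF assms(1,2)] tRe_in_tangent_space tIm_in_tangent_space tRe_nth tIm_nth)


section \<open>Vector fields along a map of the surface\<close>

lemma cov_cong_map:
  assumes "open U" "w \<in> U" "f differentiable (at w)" "V differentiable (at w)"
    and "\<And>w. w \<in> U \<Longrightarrow> f w = f' w" "\<And>w. w \<in> U \<Longrightarrow> V w = V' w"
  shows "cov G f e V w = cov G f' e V' w"
  using frechet_derivative_transform_within_open[OF assms(3,1,2,5)]
    frechet_derivative_transform_within_open[OF assms(4,1,2,6)] assms(2,5,6) by (simp add: cov_def)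

locale surface_map = S: riemann_surface S + M: riemannian_manifold A g
  for S :: "('s::{t2_space, second_countable_topology}, complex) chart set"
    and A :: "('m::topological_space, real^'n) chart set"
    and g :: "'m \<Rightarrow> ('m, 'n, real) tvec \<Rightarrow> ('m, 'n, real) tvec \<Rightarrow> real" +
  fixes F :: "'s \<Rightarrow> 'm"
  assumes smooth_map: "smooth_map S A F"
begin

definition coords :: "('s, complex) chart \<Rightarrow> ('m, real^'n) chart \<Rightarrow> complex \<Rightarrow> real^'n" where
  "coords z c = snd c \<circ> F \<circ> chart_inv z"

text \<open>The region of the coordinate plane where the chart \<open>z\<close> of the surface and
  the chart \<open>c\<close> of the target can be used simultaneously; the extra set
  \<open>N\<close> accommodates sections that exist only locally.\<close>

definition patch :: "'s set \<Rightarrow> ('s, complex) chart \<Rightarrow> ('m, real^'n) chart \<Rightarrow> complex set" where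
  "patch N z c = snd z ` (N \<inter> fst z \<inter> F -` fst c)"

abbreviation G :: "('m, real^'n) chart \<Rightarrow> real^'n \<Rightarrow> real^'n^'n" where
  "G c \<equiv> gram A g c"

lemma open_preimage: "c \<in> A \<Longrightarrow> open (F -` fst c)"
  by (rule open_vimage[OF M.chart(1)]) (use smooth_map in \<open>simp_all add: smooth_map_def\<close>)

lemma open_patch: "open N \<Longrightarrow> z \<in> S \<Longrightarrow> c \<in> A \<Longrightarrow> open (patch N z c)"
  unfolding patch_def by (intro open_chart_image S.is_chart open_Int S.chart open_preimage) auto

lemma in_patch: "p \<in> N \<Longrightarrow> p \<in> fst z \<Longrightarrow> F p \<in> fst c \<Longrightarrow> snd z p \<in> patch N z c"
  by (auto simp: patch_def)

lemma patchE:
  assumes "w \<in> patch N z c" "z \<in> S"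
  obtains p where "p \<in> N" "p \<in> fst z" "F p \<in> fst c" "w = snd z p" "chart_inv z w = p"
  using assms S.chart(3)[OF assms(2)] unfolding patch_def by auto

lemma patch_mono: "N \<subseteq> N' \<Longrightarrow> patch N z c \<subseteq> patch N' z c"
  by (auto simp: patch_def)

lemma coords_at: "z \<in> S \<Longrightarrow> p \<in> fst z \<Longrightarrow> coords z c (snd z p) = snd c (F p)"
  by (simp add: coords_def S.chart)

lemma C_k_on_coords:
  assumes "z \<in> S" "c \<in> A"
  shows "C_k_on k (patch N z c) (coords z c)"
proof -
  have "C_k_on k (patch UNIV z c) (coords z c)"
    using smooth_map assms unfolding smooth_map_def C_inf_on_def coords_def patch_def by simp
  then show ?thesis by (rule C_k_on_subset) (rule patch_mono, simp)
qed

lemma coords_image: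
  assumes "z \<in> S"
  shows "coords z c ` patch N z c \<subseteq> snd c ` fst c"
  using coords_at[OF assms, of _ c] by (auto simp: patch_def)

lemma differentiable_coords:
  assumes "z \<in> S" "c \<in> A" "p \<in> fst z" "F p \<in> fst c"
  shows "coords z c differentiable (at (snd z p))"
  using C_k_on_coords[OF assms(1,2), of "Suc 0" UNIV] in_patch[OF UNIV_I assms(3,4)] by simp

lemma C_k_on_section:
  "smooth_section_on S A F N v \<Longrightarrow> z \<in> S \<Longrightarrow> c \<in> A \<Longrightarrow> C_k_on k (patch N z c) (\<lambda>w. v (chart_inv z w) c)"
  unfolding smooth_section_on_def C_inf_on_def patch_def by blast

lemma differentiable_section:
  assumes "smooth_section_on S A F N v" "z \<in> S" "c \<in> A" "p \<in> N" "p \<in> fst z" "F p \<in> fst c"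
  shows "(\<lambda>w. v (chart_inv z w) c) differentiable (at (snd z p))"
  using C_k_on_section[OF assms(1-3), of "Suc 0"] in_patch[OF assms(4-6)] by simp

lemma section_in_tangent_space: "smooth_section_on S A F N v \<Longrightarrow> p \<in> N \<Longrightarrow> v p \<in> tangent_space A (F p)"
  by (simp add: smooth_section_on_def)

lemma smooth_section_on_subset:
  assumes "smooth_section_on S A F N v" "N' \<subseteq> N"
  shows "smooth_section_on S A F N' v"
  unfolding smooth_section_on_def C_inf_on_def
proof (intro conjI ballI allI)
  fix z c k assume "z \<in> S" "c \<in> A"
  then show "C_k_on k (snd z ` (N' \<inter> fst z \<inter> F -` fst c)) (\<lambda>w. v (chart_inv z w) c)"
    using C_k_on_subset[OF C_k_on_section[OF assms(1)] patch_mono[OF assms(2)]] by (simp add: patch_def)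
qed (use assms in \<open>auto simp: smooth_section_on_def\<close>)

lemma smooth_section_onI:
  assumes "\<And>p. p \<in> N \<Longrightarrow> v p \<in> tangent_space A (F p)"
    and "\<And>z c k. z \<in> S \<Longrightarrow> c \<in> A \<Longrightarrow> C_k_on k (patch N z c) (\<lambda>w. v (chart_inv z w) c)"
  shows "smooth_section_on S A F N v"
  unfolding smooth_section_on_def C_inf_on_def using assms by (simp add: patch_def)

lemma pushforward_nth:
  assumes "c \<in> A" "F p \<in> fst c"
  shows "pushforward A F z e p c = pd e (coords z c) (snd z p)"
  using assms by (simp add: pushforward_def tfamily_def coord_deriv_def coords_def)

lemma nabla_nth:
  assumes "z \<in> S" "c \<in> A" "p \<in> fst z" "F p \<in> fst c"
  shows "nabla A g F z e v p c = cov (G c) (coords z c) e (\<lambda>w. v (chart_inv z w) c) (snd z p)"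
  using assms by (simp add: nabla_def tfamily_def cov_def chr_def vec_eq_iff pushforward_nth coords_at
      christoffel_eq coord_deriv_def comp_def S.chart)

lemma nabla_nth_patch:
  assumes "z \<in> S" "c \<in> A" "w \<in> patch N z c"
  shows "nabla A g F z e v (chart_inv z w) c = cov (G c) (coords z c) e (\<lambda>w. v (chart_inv z w) c) w"
  using assms(3,1) by (rule patchE) (simp add: nabla_nth[OF assms(1,2)])

lemma coords_change:
  assumes "z \<in> S" "c \<in> A" "d \<in> A" "w \<in> patch (F -` fst d) z c"
  shows "coords z d w = M.trans c d (coords z c w)" "coords z c w \<in> snd c ` (fst c \<inter> fst d)"
  using assms(4,1)
  by (rule patchE, simp add: coords_at assms(1) M.trans_chart[OF assms(2)])
     (use assms(4,1) in \<open>rule patchE, simp add: coords_at assms(1)\<close>)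

lemma pushforward_in_tangent_space:
  assumes z: "z \<in> S" "p \<in> fst z"
  shows "pushforward A F z e p \<in> tangent_space A (F p)"
proof (rule M.tangent_spaceI)
  fix c d assume c: "c \<in> A" "F p \<in> fst c" and d: "d \<in> A" "F p \<in> fst d"
  have w: "snd z p \<in> patch (F -` fst d) z c" using z d c by (intro in_patch) auto
  have t: "(M.trans c d has_derivative (\<lambda>v. pd v (M.trans c d) (snd c (F p)))) (at (coords z c (snd z p)))"
    using M.trans_has_derivative[OF c(1) d(1) c(2) d(2)] by (simp add: coords_at z)
  have "((\<lambda>w. M.trans c d (coords z c w)) has_derivative
      (\<lambda>e. pd (pd e (coords z c) (snd z p)) (M.trans c d) (snd c (F p)))) (at (snd z p))"
    by (rule has_derivative_compose[OF differentiable_coords[OF z(1) c(1) z(2) c(2), unfolded frechet_derivative_works] t])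
  then have "(coords z d has_derivative (\<lambda>e. pd (pd e (coords z c) (snd z p)) (M.trans c d) (snd c (F p)))) (at (snd z p))"
    by (rule has_derivative_transform_within_open[OF _ open_patch[OF open_preimage[OF d(1)] z(1) c(1)] w])
       (simp add: coords_change[OF z(1) c(1) d(1)])
  from pd_eqI[OF this, of e]
  show "pushforward A F z e p d = jact (M.trans c d) (snd c (F p)) (pushforward A F z e p c)"
    using c d by (simp add: pushforward_nth jact_real M.trans_differentiable)
qed (auto simp: pushforward_def tfamily_def)

text \<open>Between two charts of the target the local expressions are related by
  \<open>cov_change\<close> along the transition map. Openness of \<open>N\<close> is used because
  derivatives at \<open>p\<close> look at a whole neighbourhood.\<close>

lemma nabla_in_tangent_space:
  assumes v: "smooth_section_on S A F N v" and N: "open N" "p \<in> N" and z: "z \<in> S" "p \<in> fst z"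
  shows "nabla A g F z e v p \<in> tangent_space A (F p)"
proof (rule M.tangent_spaceI)
  fix c d assume c: "c \<in> A" "F p \<in> fst c" and d: "d \<in> A" "F p \<in> fst d"
  interpret metric_change "snd c ` fst c" "snd d ` fst d" "G c" "G d" "snd c ` (fst c \<inter> fst d)" "M.trans c d"
    by (rule M.metric_change_trans[OF c(1) d(1)])
  let ?D = "patch (N \<inter> F -` fst d) z c"
  let ?w = "snd z p"
  have w: "?w \<in> ?D" using z d c N by (intro in_patch) auto
  have oD: "open ?D" using open_patch[OF _ z(1) c(1)] N open_preimage[OF d(1)] by blast
  have D: "x \<in> patch (F -` fst d) z c" if "x \<in> ?D" for x
    using that patch_mono[of "N \<inter> F -` fst d" "F -` fst d" z c] by auto
  have x: "coords z c ?w \<in> snd c ` (fst c \<inter> fst d)"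
    using coords_change(2)[OF z(1) c(1) d(1) D[OF w]] .
  have "nabla A g F z e v p d = cov (G d) (coords z d) e (\<lambda>w. v (chart_inv z w) d) ?w"
    by (rule nabla_nth[OF z(1) d(1) z(2) d(2)])
  also have "\<dots> = cov (G d) (\<lambda>w. M.trans c d (coords z c w)) e (\<lambda>w. jact (M.trans c d) (coords z c w) (v (chart_inv z w) c)) ?w"
  proof (rule cov_cong_map[OF oD w])
    show "coords z d differentiable (at ?w)" by (rule differentiable_coords[OF z(1) d(1) z(2) d(2)])
    show "(\<lambda>w. v (chart_inv z w) d) differentiable (at ?w)" by (rule differentiable_section[OF v z(1) d(1) N(2) z(2) d(2)])
    show "coords z d x = M.trans c d (coords z c x)" if "x \<in> ?D" for x
      by (rule coords_change(1)[OF z(1) c(1) d(1) D[OF that]])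
    show "v (chart_inv z x) d = jact (M.trans c d) (coords z c x) (v (chart_inv z x) c)" if "x \<in> ?D" for x
      using that z(1)
    proof (rule patchE)
      fix q assume q: "q \<in> N \<inter> F -` fst d" "q \<in> fst z" "F q \<in> fst c" "x = snd z q" "chart_inv z x = q"
      show ?thesis
        using M.tangent_space_change[OF c(1) q(3) d(1) _ section_in_tangent_space[OF v]] q
        by (simp add: coords_at z)
    qed
  qed
  also have "\<dots> = jact (M.trans c d) (coords z c ?w) (cov (G c) (coords z c) e (\<lambda>w. v (chart_inv z w) c) ?w)"
    by (rule cov_change[OF x differentiable_coords[OF z(1) c(1) z(2) c(2)] differentiable_section[OF v z(1) c(1) N(2) z(2) c(2)]])
  also have "\<dots> = jact (M.trans c d) (snd c (F p)) (nabla A g F z e v p c)"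
    by (simp add: nabla_nth[OF z(1) c(1) z(2) c(2)] coords_at z)
  finally show "nabla A g F z e v p d = jact (M.trans c d) (snd c (F p)) (nabla A g F z e v p c)" .
qed (auto simp: nabla_def tfamily_def)

lemma pushforward_change:
  assumes z: "z \<in> S" "y \<in> S" "p \<in> fst z" "p \<in> fst y"
  shows "pushforward A F z e p = pushforward A F y (S.jac z y p * e) p"
proof
  fix c
  show "pushforward A F z e p c = pushforward A F y (S.jac z y p * e) p c"
  proof (cases "c \<in> A \<and> F p \<in> fst c")
    case True
    then have "(snd c \<circ> F \<circ> chart_inv y) differentiable (at (snd y p))"
      using differentiable_coords[OF z(2) _ z(4), of c] by (simp add: coords_def)
    then show ?thesis
      using S.coord_deriv_change(1)[OF z] True by (simp add: pushforward_def tfamily_def)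
  qed (auto simp: pushforward_def tfamily_def)
qed

text \<open>The direction \<open>e\<close> in the chart \<open>z\<close> is the direction
  \<open>jac * e\<close> in the chart \<open>y\<close>; together with linearity in the direction
  this yields the transformation laws of all densities below.\<close>

lemma nabla_change:
  assumes v: "smooth_section_on S A F N v" "p \<in> N" and z: "z \<in> S" "y \<in> S" "p \<in> fst z" "p \<in> fst y"
  shows "nabla A g F z e v p = nabla A g F y (S.jac z y p * e) v p"
proof
  fix c
  show "nabla A g F z e v p c = nabla A g F y (S.jac z y p * e) v p c"
  proof (cases "c \<in> A \<and> F p \<in> fst c")
    case True
    then have "((\<lambda>q. v q c) \<circ> chart_inv y) differentiable (at (snd y p))"
      using differentiable_section[OF v(1) z(2) _ v(2) z(4), of c] by (simp add: comp_def)
    then show ?thesis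
      using S.coord_deriv_change(1)[OF z, of "\<lambda>q. v q c"] pushforward_change[OF z] True
      by (simp add: nabla_def tfamily_def)
  qed (auto simp: nabla_def tfamily_def)
qed

lemma pd_linear: "f differentiable (at w) \<Longrightarrow> linear (\<lambda>e. pd e f w)"
  using frechet_derivative_works has_derivative_linear by blast

lemma pushforward_linear:
  assumes "z \<in> S" "p \<in> fst z"
  shows "pushforward A F z e p c = Re e *\<^sub>R pushforward A F z 1 p c + Im e *\<^sub>R pushforward A F z \<i> p c"
proof (cases "c \<in> A \<and> F p \<in> fst c")
  case True
  then show ?thesis
    using linear_complex[OF pd_linear[OF differentiable_coords[OF assms(1) _ assms(2)]], of c e]
    by (simp add: pushforward_nth)
qed (auto simp: pushforward_def tfamily_def)

lemma nabla_linear: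
  assumes "smooth_section_on S A F N v" "p \<in> N" "z \<in> S" "p \<in> fst z"
  shows "nabla A g F z e v p c = Re e *\<^sub>R nabla A g F z 1 v p c + Im e *\<^sub>R nabla A g F z \<i> v p c"
proof (cases "c \<in> A \<and> F p \<in> fst c")
  case True
  then have d: "coords z c differentiable (at (snd z p))" "(\<lambda>w. v (chart_inv z w) c) differentiable (at (snd z p))"
    using differentiable_coords differentiable_section assms by blast+
  have "linear (\<lambda>e. cov (G c) (coords z c) e (\<lambda>w. v (chart_inv z w) c) (snd z p))"
    using pd_linear[OF d(1)] pd_linear[OF d(2)]
    by (auto simp: cov_def linear_iff chr_add_left chr_scaleR_left scaleR_add_right)
  from linear_complex[OF this, of e] show ?thesis
    using True by (simp add: nabla_nth assms)
qed (auto simp: nabla_def tfamily_def)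

lemma C_k_on_nabla:
  assumes v: "smooth_section_on S A F N v" and N: "open N" and z: "z \<in> S" and c: "c \<in> A"
  shows "C_k_on k (patch N z c) (\<lambda>w. nabla A g F z e v (chart_inv z w) c)"
proof (rule C_k_on_cong[OF open_patch[OF N z c]])
  interpret metric_coords "snd c ` fst c" "G c" by (rule M.metric_coords_gram[OF c])
  show "C_k_on k (patch N z c) (cov (G c) (coords z c) e (\<lambda>w. v (chart_inv z w) c))"
    by (rule C_k_on_cov[OF open_patch[OF N z c] coords_image[OF z] C_k_on_coords[OF z c] C_k_on_section[OF v z c]])
qed (simp add: nabla_nth_patch[OF z c])

lemma C_k_on_pushforward:
  assumes z: "z \<in> S" and c: "c \<in> A" and N: "open N"
  shows "C_k_on k (patch N z c) (\<lambda>w. pushforward A F z e (chart_inv z w) c)"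
proof (rule C_k_on_cong[OF open_patch[OF N z c]])
  show "C_k_on k (patch N z c) (\<lambda>w. pd e (coords z c) w)"
    by (rule C_k_on_frechet_derivative[OF open_patch[OF N z c] C_k_on_coords[OF z c]])
  fix w assume "w \<in> patch N z c"
  then show "pd e (coords z c) w = pushforward A F z e (chart_inv z w) c"
    using z by (rule patchE) (simp add: pushforward_nth c)
qed

lemma C_k_on_ip_section:
  fixes V W :: "complex \<Rightarrow> 'k::{real_normed_field, euclidean_space}^'n"
  assumes z: "z \<in> S" and c: "c \<in> A" and N: "open N" and VW: "C_k_on k (patch N z c) V" "C_k_on k (patch N z c) W"
  shows "C_k_on k (patch N z c) (\<lambda>w. ip (G c (coords z c w)) (V w) (W w))"
proof -
  interpret metric_coords "snd c ` fst c" "G c" by (rule M.metric_coords_gram[OF c])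
  show ?thesis by (rule C_k_on_ip[OF open_patch[OF N z c] coords_image[OF z] C_k_on_coords[OF z c] VW])
qed

lemma nabla_compatible:
  fixes V W :: "'s \<Rightarrow> ('m, 'n, 'k::{real_normed_field, euclidean_space}) tvec"
  assumes V: "smooth_section_on S A F N V" and W: "smooth_section_on S A F N W"
    and p: "p \<in> N" "p \<in> fst z" "F p \<in> fst c" and z: "z \<in> S" and c: "c \<in> A"
  shows "pd e (\<lambda>w. ip (G c (coords z c w)) (V (chart_inv z w) c) (W (chart_inv z w) c)) (snd z p)
    = ip (G c (snd c (F p))) (nabla A g F z e V p c) (W p c) + ip (G c (snd c (F p))) (V p c) (nabla A g F z e W p c)"
proof -
  interpret metric_coords "snd c ` fst c" "G c" by (rule M.metric_coords_gram[OF c])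
  have x: "coords z c (snd z p) \<in> snd c ` fst c" using p z by (simp add: coords_at)
  show ?thesis
    using cov_compatible[OF x differentiable_coords[OF z c p(2,3)] differentiable_section[OF V z c p] differentiable_section[OF W z c p], of e]
    using p z c by (simp add: nabla_nth coords_at S.chart)
qed

end

section \<open>The ramified tangent bundle\<close>

lemma bounded_linear_vof: "bounded_linear (vof :: real^'n \<Rightarrow> 'k::{real_normed_field, euclidean_space}^'n)"
  unfolding linear_conv_bounded_linear[symmetric]
  by (rule linearI) (simp_all add: vec_eq_iff scaleR_conv_of_real[where ?'a = 'k])

lemma bounded_linear_vcnj: "bounded_linear vcnj"
  unfolding linear_conv_bounded_linear[symmetric]
  by (rule linearI) (simp_all add: vec_eq_iff vcnj_def)

lemma bounded_linear_vIm: "bounded_linear vIm"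
  unfolding linear_conv_bounded_linear[symmetric]
  by (rule linearI) (simp_all add: vec_eq_iff vIm_def)

lemma chr_vcnj: "chr G x a (vcnj v) = vcnj (chr G x a v)"
  by (simp add: chr_def vcnj_def vec_eq_iff cnj_sum)

lemma cov_vof:
  assumes "V differentiable (at w)"
  shows "cov G f e (\<lambda>w. vof (V w)) w = (vof (cov G f e V w) :: 'k::{real_normed_field, euclidean_space}^'n)"
  using frechet_derivative_linear[OF bounded_linear_vof assms, of e]
  by (simp add: cov_def chr_vof bounded_linear.linear[OF bounded_linear_vof] linear_add)

lemma cov_vcnj:
  assumes "V differentiable (at w)"
  shows "cov G f e (\<lambda>w. vcnj (V w)) w = vcnj (cov G f e V w)"
  using frechet_derivative_linear[OF bounded_linear_vcnj assms, of e] by (simp add: cov_def chr_vcnj)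

text \<open>Carries identities over an isolated branch point: they are proved where
  \<open>F_z\<close> is nonzero and extended by continuity.\<close>

lemma continuous_eq_zero_at:
  fixes h :: "complex \<Rightarrow> 'b::real_normed_vector"
  assumes "continuous_on U h" "open U" "a \<in> U" "\<And>w. w \<in> U \<Longrightarrow> w \<noteq> a \<Longrightarrow> h w = 0"
  shows "h a = 0"
proof -
  have "(h \<longlongrightarrow> h a) (at a)"
    using assms(1-3) by (simp add: continuous_on_eq_continuous_at isCont_def)
  moreover have "eventually (\<lambda>w. h w = 0) (at a)"
    using assms(2-4) eventually_at_topological by blast
  then have "(h \<longlongrightarrow> 0) (at a)" by (rule tendsto_eventually)
  ultimately show ?thesis by (rule tendsto_unique[OF trivial_limit_at])
qed

lemma F_z_nth: "F_z A F z p c = (1/2) *s (vof (pushforward A F z 1 p c) - \<i> *s vof (pushforward A F z \<i> p c))"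
  by (simp add: F_z_def tcomplex_def vec_eq_iff complex_eq_iff)

context metric_coords
begin

lemma hermitian_positive:
  assumes "x \<in> \<Omega>" "v \<noteq> 0"
  shows "Re (ip (G x) v (vcnj v)) > 0" "ip (G x) v (vcnj v) \<noteq> 0"
proof -
  have e: "Re (ip (G x) v (vcnj v)) = ip (G x) (vRe v) (vRe v) + ip (G x) (vIm v) (vIm v)"
    by (simp add: ip_complex ip_linear)
  have nn: "ip (G x) u u \<ge> (0::real)" for u
    using positive[OF assms(1), of u] by (cases "u = 0") (auto simp: ip_linear)
  have "vRe v \<noteq> 0 \<or> vIm v \<noteq> 0" using assms(2) vRe_vIm[of v] by (auto simp: vec_eq_iff vRe_def vIm_def complex_eq_iff)
  then show "Re (ip (G x) v (vcnj v)) > 0"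
    unfolding e using positive[OF assms(1)] nn add_pos_nonneg add_nonneg_pos by metis
  then show "ip (G x) v (vcnj v) \<noteq> 0" by auto
qed

lemma hermitian_real:
  assumes "x \<in> \<Omega>"
  shows "ip (G x) v (vcnj v) = of_real (Re (ip (G x) v (vcnj v)))"
  using ip_sym[OF assms, of "vRe v" "vIm v"] by (simp add: ip_complex complex_eq_iff ip_linear)

end

locale branched_surface = surface_map S A g F
  for S :: "('s::{t2_space, second_countable_topology}, complex) chart set"
    and A :: "('m::topological_space, real^'n) chart set"
    and g :: "'m \<Rightarrow> ('m, 'n, real) tvec \<Rightarrow> ('m, 'n, real) tvec \<Rightarrow> real"
    and F :: "'s \<Rightarrow> 'm" +
  fixes \<Xi> :: "'s \<Rightarrow> ('m, 'n, complex) tvec set"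
  assumes immersion: "branched_minimal_immersion S A g F"
    and ramified: "ramified_tangent_bundle S A F \<Xi>"
begin

abbreviation gr :: "('m, real^'n) chart \<Rightarrow> 's \<Rightarrow> real^'n^'n" where
  "gr c p \<equiv> G c (snd c (F p))"

text \<open>A nonvanishing local section of the (1,0) part that is null and annihilated by the
  derivative in direction \<open>zbar\<close>. The differential equation is demanded in all charts
  of the surface, since the frame has to outlive the chart in which it was constructed. The factor
  \<open>u\<close> relating it to \<open>F_z\<close> is zero exactly where \<open>F_z\<close>
  is.\<close>

definition frame :: "'s set \<Rightarrow> ('s \<Rightarrow> ('m, 'n, complex) tvec) \<Rightarrow> bool" where
  "frame N W \<longleftrightarrow> open N \<and> smooth_section_on S A F N W \<and>
     (\<forall>q\<in>N. W q \<noteq> (\<lambda>c. 0) \<and> \<Xi> q = {(\<lambda>c. a *s W q c) | a. True} \<and>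
       (\<forall>c\<in>A. F q \<in> fst c \<longrightarrow> ip (gr c q) (W q c) (W q c) = 0) \<and>
       (\<forall>z\<in>S. q \<in> fst z \<longrightarrow> (\<forall>c. nabla A g F z 1 W q c + \<i> *s nabla A g F z \<i> W q c = 0) \<and>
          (\<exists>u. F_z A F z q = (\<lambda>c. u *s W q c))))"

text \<open>The real and imaginary parts of the square of \<open>F_z\<close> are, up to constants,
  the two conformality equations.\<close>

lemma F_z_null:
  assumes "z \<in> S" "p \<in> fst z" "c \<in> A" "F p \<in> fst c"
  shows "ip (gr c p) (F_z A F z p c) (F_z A F z p c) = 0"
proof -
  interpret metric_coords "snd c ` fst c" "G c" by (rule M.metric_coords_gram[OF assms(3)])
  have "g (F p) (pushforward A F z 1 p) (pushforward A F z 1 p) = g (F p) (pushforward A F z \<i> p) (pushforward A F z \<i> p)"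
    "g (F p) (pushforward A F z 1 p) (pushforward A F z \<i> p) = 0"
    using immersion assms unfolding branched_minimal_immersion_def by blast+
  moreover note M.metric_eq_ip[OF assms(3,4) pushforward_in_tangent_space[OF assms(1,2)] pushforward_in_tangent_space[OF assms(1,2)]]
  moreover have "ip (gr c p) (pushforward A F z \<i> p c) (pushforward A F z 1 p c) = ip (gr c p) (pushforward A F z 1 p c) (pushforward A F z \<i> p c)"
    using assms by (intro ip_sym) auto
  ultimately show ?thesis
    by (simp add: F_z_nth ip_linear ip_vof)
qed

lemma smooth_F_z:
  assumes "z \<in> S" "c \<in> A"
  shows "C_k_on k (patch UNIV z c) (\<lambda>w. F_z A F z (chart_inv z w) c)"
proof -
  have o: "open (patch UNIV z c)" using open_patch assms by blast
  have *: "C_k_on k (patch UNIV z c) (\<lambda>w. vof (pushforward A F z e (chart_inv z w) c) :: complex^'n)" for e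
    by (rule C_k_on_linear[OF bounded_linear_vof o C_k_on_pushforward[OF assms open_UNIV]])
  show ?thesis
  proof (rule C_k_on_vec[OF o])
    fix i
    have "C_k_on k (patch UNIV z c) (\<lambda>w. (1/2) * ((vof (pushforward A F z 1 (chart_inv z w) c) :: complex^'n) $ i
       - \<i> * (vof (pushforward A F z \<i> (chart_inv z w) c) :: complex^'n) $ i))"
      by (intro C_k_on_mult C_k_on_const C_k_on_diff o C_k_on_vec_nth[OF o *])
    then show "C_k_on k (patch UNIV z c) (\<lambda>w. F_z A F z (chart_inv z w) c $ i)"
      by (simp add: F_z_nth diff_divide_distrib)
  qed
qed

text \<open>The derivative of \<open>F_x - i F_y\<close> in direction \<open>zbar\<close> has the
  tension field as one part and the torsion as the other; harmonicity kills the first, symmetry of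
  the Christoffel symbols the second.\<close>

lemma F_z_holomorphic:
  assumes z: "z \<in> S" "p \<in> fst z" and c: "c \<in> A" "F p \<in> fst c"
  shows "cov (G c) (coords z c) 1 (\<lambda>w. F_z A F z (chart_inv z w) c) (snd z p)
    + \<i> *s cov (G c) (coords z c) \<i> (\<lambda>w. F_z A F z (chart_inv z w) c) (snd z p) = 0"
proof -
  interpret metric_coords "snd c ` fst c" "G c" by (rule M.metric_coords_gram[OF c(1)])
  let ?P = "\<lambda>e w. pushforward A F z e (chart_inv z w) c"
  let ?w = "snd z p"
  let ?D = "patch UNIV z c"
  have oD: "open ?D" by (rule open_patch[OF open_UNIV z(1) c(1)])
  have w: "?w \<in> ?D" using z c by (intro in_patch) auto
  have "C_k_on (Suc 0) ?D (?P e)" for e by (rule C_k_on_pushforward[OF z(1) c(1) open_UNIV])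
  then have dP: "?P e differentiable (at ?w)" for e using w by simp
  note dvP = bounded_linear.has_derivative[OF bounded_linear_vof dP[unfolded frechet_derivative_works]]
  have dv: "(\<lambda>w. vof (?P e w) :: complex^'n) differentiable (at ?w)" for e
    using dvP by (auto simp: differentiable_def)
  have dc: "(\<lambda>w. a :: complex) differentiable (at ?w)" for a by simp
  have dm: "(\<lambda>w. a *s (vof (?P e w) :: complex^'n)) differentiable (at ?w)" for a :: complex and e
    using has_derivative_smult[OF dc[unfolded frechet_derivative_works] dvP] by (auto simp: differentiable_def)
  have Fz: "cov (G c) (coords z c) e (\<lambda>w. F_z A F z (chart_inv z w) c) ?w
      = (1/2) *s vof (cov (G c) (coords z c) e (?P 1) ?w) + (- \<i>/2) *s vof (cov (G c) (coords z c) e (?P \<i>) ?w)" for e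
  proof -
    have "(\<lambda>w. F_z A F z (chart_inv z w) c) = (\<lambda>w. (1/2) *s vof (?P 1 w) + (- \<i>/2) *s vof (?P \<i> w))"
      by (simp add: F_z_nth fun_eq_iff vec_eq_iff field_simps)
    moreover have "cov (G c) (coords z c) e (\<lambda>w. a *s vof (?P e' w)) ?w = a *s vof (cov (G c) (coords z c) e (?P e') ?w)"
      for a :: complex and e'
      using cov_smult[OF dc dv] cov_vof[OF dP, where ?'k = complex] by simp
    ultimately show ?thesis by (simp only: cov_add[OF dm dm])
  qed
  have harm: "cov (G c) (coords z c) 1 (?P 1) ?w + cov (G c) (coords z c) \<i> (?P \<i>) ?w = 0"
    using immersion z nabla_nth[OF z(1) c(1) z(2) c(2)] unfolding branched_minimal_immersion_def by metis
  \<comment> \<open>Mixed second derivatives of the coordinates of \<open>F\<close> agree, and so do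
    the Christoffel terms.\<close>
  have tors: "cov (G c) (coords z c) 1 (?P \<i>) ?w = cov (G c) (coords z c) \<i> (?P 1) ?w"
  proof -
    have *: "pd e (?P e') ?w = pd e (\<lambda>w. pd e' (coords z c) w) ?w" for e e'
    proof (rule fun_cong[OF frechet_derivative_transform_within_open[OF dP oD w]])
      fix x assume "x \<in> ?D"
      then show "?P e' x = pd e' (coords z c) x"
        using z(1) by (rule patchE) (simp add: pushforward_nth c)
    qed
    have "pd 1 (?P \<i>) ?w = pd \<i> (?P 1) ?w"
      unfolding * by (rule symmetric_second_derivative[OF oD C_k_on_coords[OF z(1) c(1)] w])
    moreover have "?P e ?w = pd e (coords z c) ?w" for e
      using z c by (simp add: pushforward_nth S.chart)
    moreover have "coords z c ?w \<in> snd c ` fst c" using z c by (simp add: coords_at)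
    ultimately show ?thesis by (simp add: cov_def chr_symmetric)
  qed
  show ?thesis
    unfolding Fz tors using harm
    by (simp add: vec_eq_iff algebra_simps flip: of_real_add) (simp flip: add_divide_distrib of_real_add)
qed

lemma F_z_change:
  assumes "z \<in> S" "y \<in> S" "p \<in> fst z" "p \<in> fst y"
  shows "F_z A F y p c = S.jac y z p *s F_z A F z p c"
proof -
  have P: "pushforward A F y e p c = Re (S.jac y z p * e) *\<^sub>R pushforward A F z 1 p c + Im (S.jac y z p * e) *\<^sub>R pushforward A F z \<i> p c" for e
    using pushforward_change[OF assms(2,1,4,3), of e] pushforward_linear[OF assms(1,3)] by metis
  show ?thesis unfolding F_z_nth P by (simp add: vec_eq_iff complex_eq_iff algebra_simps)
qed

text \<open>Near \<open>p\<close> one has \<open>F_z = u W\<close> with the holomorphic function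
  \<open>u\<close>, a power of the coordinate difference. Where \<open>u\<close> is nonzero, both
  properties of \<open>F_z\<close> pass to \<open>W\<close> by division; at \<open>p\<close> itself
  continuity takes over.\<close>

lemma frame_exists: obtains N W where "p \<in> N" "frame N W"
proof -
  obtain z N W m where z: "z \<in> S" and N: "open N" "p \<in> N" "N \<subseteq> fst z" and W: "smooth_section_on S A F N W"
    and fr: "\<And>q. q \<in> N \<Longrightarrow> W q \<noteq> (\<lambda>c. 0) \<and> F_z A F z q = (\<lambda>c. (snd z q - snd z p) ^ m *s W q c) \<and>
           \<Xi> q = {(\<lambda>c. a *s W q c) | a. True}"
    using ramified unfolding ramified_tangent_bundle_def by meson
  have u0: "(snd z q - snd z p) ^ m \<noteq> 0" if "q \<in> N" "q \<noteq> p" for q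
    using that N S.chart(8)[OF z] by (auto simp: inj_on_def)
  have off: "chart_inv z w \<in> N \<and> chart_inv z w \<noteq> p \<and> F (chart_inv z w) \<in> fst c \<and> chart_inv z w \<in> fst z \<and> w = snd z (chart_inv z w)"
    if "w \<in> patch N z c" "w \<noteq> snd z p" for w c
    using that(1) z by (rule patchE) (use that(2) in auto)
  have at_p: "h q = 0" if q: "q \<in> N" "F q \<in> fst c" "c \<in> A" and cont: "C_k_on 0 (patch N z c) (\<lambda>w. h (chart_inv z w))"
    and zero: "\<And>q. q \<in> N \<Longrightarrow> q \<noteq> p \<Longrightarrow> F q \<in> fst c \<Longrightarrow> h q = 0" for c q and h :: "'s \<Rightarrow> 'b::real_normed_vector"
  proof (cases "q = p")
    case True
    have "h (chart_inv z (snd z p)) = 0"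
    proof (rule continuous_eq_zero_at)
      show "continuous_on (patch N z c) (\<lambda>w. h (chart_inv z w))" using cont by simp
      show "open (patch N z c)" by (rule open_patch[OF N(1) z q(3)])
      show "snd z p \<in> patch N z c" using q N True by (intro in_patch) auto
      show "h (chart_inv z w) = 0" if "w \<in> patch N z c" "w \<noteq> snd z p" for w
        using off[OF that] zero by blast
    qed
    then show ?thesis using True S.chart(3)[OF z] N by auto
  qed (use that in auto)
  have null: "ip (gr c q) (W q c) (W q c) = 0" if "q \<in> N" "F q \<in> fst c" "c \<in> A" for q c
  proof (rule at_p[OF that])
    have "C_k_on 0 (patch N z c) (\<lambda>w. ip (G c (coords z c w)) (W (chart_inv z w) c) (W (chart_inv z w) c))"
      by (rule C_k_on_ip_section[OF z that(3) N(1) C_k_on_section[OF W z that(3)] C_k_on_section[OF W z that(3)]])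
    then show "C_k_on 0 (patch N z c) (\<lambda>w. ip (gr c (chart_inv z w)) (W (chart_inv z w) c) (W (chart_inv z w) c))"
      by (simp add: coords_def comp_def)
    fix q assume q: "q \<in> N" "q \<noteq> p" "F q \<in> fst c"
    have "ip (gr c q) (F_z A F z q c) (F_z A F z q c) = 0"
      using F_z_null[OF z _ that(3) q(3)] q N by auto
    then show "ip (gr c q) (W q c) (W q c) = 0"
      using fr[OF q(1)] u0[OF q(1,2)] by (auto simp: ip_linear)
  qed
  have dbar: "nabla A g F z 1 W q c + \<i> *s nabla A g F z \<i> W q c = 0" if "q \<in> N" for q c
  proof (cases "c \<in> A \<and> F q \<in> fst c")
    case True
    then have c: "c \<in> A" "F q \<in> fst c" by auto
    show ?thesis
    proof (rule at_p[OF that c(2,1)])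
      let ?D = "patch N z c"
      have o: "open ?D" by (rule open_patch[OF N(1) z c(1)])
      show "C_k_on 0 ?D (\<lambda>w. nabla A g F z 1 W (chart_inv z w) c + \<i> *s nabla A g F z \<i> W (chart_inv z w) c)"
      proof (rule C_k_on_vec[OF o])
        fix i
        have "C_k_on 0 ?D (\<lambda>w. nabla A g F z 1 W (chart_inv z w) c $ i + \<i> * nabla A g F z \<i> W (chart_inv z w) c $ i)"
          by (intro C_k_on_add C_k_on_mult C_k_on_const o C_k_on_vec_nth[OF o C_k_on_nabla[OF W N(1) z c(1)]])
        then show "C_k_on 0 ?D (\<lambda>w. (nabla A g F z 1 W (chart_inv z w) c + \<i> *s nabla A g F z \<i> W (chart_inv z w) c) $ i)"
          by simp
      qed
      fix q assume q: "q \<in> N" "q \<noteq> p" "F q \<in> fst c"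
      then have qz: "q \<in> fst z" using N by auto
      let ?w = "snd z q"
      define u where "u w = (w - snd z p) ^ m" for w :: complex
      have w: "?w \<in> ?D" using q qz by (intro in_patch) auto
      have dW: "(\<lambda>w. W (chart_inv z w) c) differentiable (at ?w)"
        by (rule differentiable_section[OF W z c(1) q(1) qz q(3)])
      define u' where "u' = deriv u ?w"
      have "u holomorphic_on UNIV" unfolding u_def by (intro holomorphic_intros)
      then have u': "(u has_derivative (*) u') (at ?w)"
        using holomorphic_derivI[of u UNIV ?w] by (simp add: has_field_derivative_def u'_def)
      have dF: "(\<lambda>w. F_z A F z (chart_inv z w) c) differentiable (at ?w)"
        using smooth_F_z[OF z c(1), of "Suc 0"] w patch_mono[of N UNIV z c] by auto
      have "cov (G c) (coords z c) e (\<lambda>w. F_z A F z (chart_inv z w) c) ?w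
          = (u' * e) *s W q c + u ?w *s nabla A g F z e W q c" for e
      proof -
        have "cov (G c) (coords z c) e (\<lambda>w. F_z A F z (chart_inv z w) c) ?w
            = cov (G c) (coords z c) e (\<lambda>w. u w *s W (chart_inv z w) c) ?w"
        proof (rule cov_cong[OF o w dF])
          fix x assume "x \<in> ?D"
          then show "F_z A F z (chart_inv z x) c = u x *s W (chart_inv z x) c"
            using z by (rule patchE) (simp add: fr u_def)
        qed
        then show ?thesis
          using cov_smult[OF differentiableI[OF u'] dW, of "G c" "coords z c" e] pd_eqI[OF u', of e]
            nabla_nth[OF z c(1) qz q(3), of e W] S.chart(3)[OF z qz] by simp
      qed
      \<comment> \<open>The derivative of \<open>u\<close> is complex linear in the direction, so
        its contributions for the directions \<open>1\<close> and \<open>\<i>\<close> cancel: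
        \<open>u' + \<i> * (u' * \<i>) = 0\<close>.\<close>
      then have "u ?w *s (nabla A g F z 1 W q c + \<i> *s nabla A g F z \<i> W q c) = 0"
        using F_z_holomorphic[OF z qz c(1) q(3)] by (simp add: vec_eq_iff algebra_simps)
      then show "nabla A g F z 1 W q c + \<i> *s nabla A g F z \<i> W q c = 0"
        using u0[OF q(1,2)] unfolding u_def vector_mul_eq_0 by blast
    qed
  qed (auto simp: nabla_def tfamily_def)
  have "frame N W"
    unfolding frame_def
  proof (intro conjI ballI impI allI)
    fix q y c assume q: "q \<in> N" "y \<in> S" "q \<in> fst y"
    have qz: "q \<in> fst z" using q N by auto
    have P: "nabla A g F y e W q c = Re (S.jac y z q * e) *\<^sub>R nabla A g F z 1 W q c + Im (S.jac y z q * e) *\<^sub>R nabla A g F z \<i> W q c" for e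
      using nabla_change[OF W q(1,2) z q(3) qz, of e] nabla_linear[OF W q(1) z qz] by metis
    \<comment> \<open>A holomorphic change of coordinate multiplies the derivative in direction
      \<open>zbar\<close> by the conjugate Jacobian, so its vanishing does not depend on the
      chart.\<close>
    have "nabla A g F y 1 W q c + \<i> *s nabla A g F y \<i> W q c
        = cnj (S.jac y z q) *s (nabla A g F z 1 W q c + \<i> *s nabla A g F z \<i> W q c)"
      unfolding P by (simp add: vec_eq_iff complex_eq_iff algebra_simps)
    then show "nabla A g F y 1 W q c + \<i> *s nabla A g F y \<i> W q c = 0"
      using dbar[OF q(1)] by simp
    have "F_z A F y q = (\<lambda>c. (S.jac y z q * (snd z q - snd z p) ^ m) *s W q c)"
      using F_z_change[OF z q(2) qz q(3)] fr[OF q(1)] by (simp add: fun_eq_iff)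
    then show "\<exists>u. F_z A F y q = (\<lambda>c. u *s W q c)" by blast
  qed (use N W fr null in blast)+
  then show ?thesis using that N by blast
qed


section \<open>Projections and type decomposition expressed in a frame\<close>

lemma frameD:
  assumes "frame N W"
  shows "open N" "smooth_section_on S A F N W" "q \<in> N \<Longrightarrow> W q \<noteq> (\<lambda>c. 0)"
    "q \<in> N \<Longrightarrow> \<Xi> q = {(\<lambda>c. a *s W q c) | a. True}"
    "q \<in> N \<Longrightarrow> c \<in> A \<Longrightarrow> F q \<in> fst c \<Longrightarrow> ip (gr c q) (W q c) (W q c) = 0"
    "q \<in> N \<Longrightarrow> z \<in> S \<Longrightarrow> q \<in> fst z \<Longrightarrow> nabla A g F z 1 W q c + \<i> *s nabla A g F z \<i> W q c = 0"
    "q \<in> N \<Longrightarrow> z \<in> S \<Longrightarrow> q \<in> fst z \<Longrightarrow> \<exists>u. F_z A F z q = (\<lambda>c. u *s W q c)"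
    "q \<in> N \<Longrightarrow> W q \<in> tangent_space A (F q)"
  using assms section_in_tangent_space[of N W q] unfolding frame_def by (simp_all, blast+)

text \<open>The squared Hermitian length of the frame, kept as a complex number because it is the
  denominator of complex coefficients.\<close>

definition mass :: "('s \<Rightarrow> ('m, 'n, complex) tvec) \<Rightarrow> ('m, real^'n) chart \<Rightarrow> 's \<Rightarrow> complex" where
  "mass W c q = ip (gr c q) (W q c) (vcnj (W q c))"

context
  fixes N W q c
  assumes fr: "frame N W" and q: "q \<in> N" and c: "c \<in> A" "F q \<in> fst c"
begin

interpretation metric_coords "snd c ` fst c" "G c" by (rule M.metric_coords_gram[OF c(1)])

lemma in_chart: "snd c (F q) \<in> snd c ` fst c" using c by auto

lemma frame_nonzero: "W q c \<noteq> 0"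
  using M.tangent_space_eqI[OF c frameD(8)[OF fr q] M.tangent_space_zero] frameD(3)[OF fr q] by blast

lemma mass_nonzero: "mass W c q \<noteq> 0" and mass_positive: "Re (mass W c q) > 0"
  and mass_real: "mass W c q = of_real (Re (mass W c q))"
  unfolding mass_def using hermitian_positive[OF in_chart frame_nonzero] hermitian_real[OF in_chart] by blast+

lemma frame_null: "ip (gr c q) (W q c) (W q c) = 0" "ip (gr c q) (vcnj (W q c)) (vcnj (W q c)) = 0"
  using frameD(5)[OF fr q c] cnj_ip[of "gr c q" "W q c" "W q c"] by simp_all

lemma frame_mass: "ip (gr c q) (W q c) (vcnj (W q c)) = mass W c q" "ip (gr c q) (vcnj (W q c)) (W q c) = mass W c q"
  using ip_sym[OF in_chart, of "W q c" "vcnj (W q c)"] by (simp_all add: mass_def)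

lemma xi01_frame: "xi01 (\<Xi> q) = {(\<lambda>d. a *s tcnj (W q) d) | a. True}"
proof -
  have "tcnj (\<lambda>c. a *s W q c) = (\<lambda>c. cnj a *s tcnj (W q) c)" for a
    by (simp add: fun_eq_iff tcnj_nth)
  then show ?thesis
    unfolding xi01_def frameD(4)[OF fr q] by (auto simp: image_iff) (metis complex_cnj_cnj)
qed

lemma xi_complex_frame: "xi_complex (\<Xi> q) = {(\<lambda>d. a *s W q d + b *s tcnj (W q) d) | a b. True}"
  unfolding xi_complex_def unfolding xi01_frame unfolding frameD(4)[OF fr q]
  by auto (rule exI, rule exI, rule conjI, rule refl, blast)

lemma combination_in_tangent_space: "(\<lambda>d. a *s W q d + b *s tcnj (W q) d) \<in> tangent_space A (F q)"
  by (intro M.tangent_space_add M.tangent_space_smult M.tcnj_in_tangent_space frameD(8)[OF fr q])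

text \<open>Normality is defined by pairing with real vectors of \<open>xi\<close>. The real and
  imaginary parts of \<open>W q\<close> are such vectors, and every other one is a combination of
  \<open>W q\<close> and its conjugate, so two complex equations suffice.\<close>

lemma nu_complex_frame:
  assumes V: "V \<in> tangent_space A (F q)"
  shows "V \<in> nu_complex A g (F q) (\<Xi> q) \<longleftrightarrow> ip (gr c q) (V c) (W q c) = 0 \<and> ip (gr c q) (V c) (vcnj (W q c)) = 0"
proof -
  have xiT: "u \<in> tangent_space A (F q)" if "u \<in> xi (\<Xi> q)" for u
  proof -
    have "tof_real u \<in> tangent_space A (F q)"
      using that combination_in_tangent_space unfolding xi_def xi_complex_frame by auto
    from M.tRe_in_tangent_space[OF this] show ?thesis
      by (simp add: tRe_def tof_real_def)
  qed
  have nu: "v \<in> nu A g (F q) (\<Xi> q) \<longleftrightarrow> (\<forall>u\<in>xi (\<Xi> q). ip (gr c q) (u c) (v c) = 0)"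
    if "v \<in> tangent_space A (F q)" for v
    using that xiT M.metric_eq_ip[OF c] unfolding nu_def by auto
  have "V \<in> nu_complex A g (F q) (\<Xi> q) \<longleftrightarrow> (\<forall>u\<in>xi (\<Xi> q). ip (gr c q) (vof (u c)) (V c) = 0)"
    unfolding nu_complex_def mem_Collect_eq nu[OF M.tRe_in_tangent_space[OF V]] nu[OF M.tIm_in_tangent_space[OF V]]
    by (auto simp: ip_complex[of _ "vof _" "V c"] tRe_nth tIm_nth complex_eq_iff ip_linear)
  also have "\<dots> \<longleftrightarrow> ip (gr c q) (V c) (W q c) = 0 \<and> ip (gr c q) (V c) (vcnj (W q c)) = 0"
  proof
    assume *: "\<forall>u\<in>xi (\<Xi> q). ip (gr c q) (vof (u c)) (V c) = 0"
    have "tof_real (tRe (W q)) = (\<lambda>d. (1/2) *s W q d + (1/2) *s tcnj (W q) d)"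
      by (simp add: fun_eq_iff vec_eq_iff tof_real_def tRe_def tcnj_def complex_eq_iff)
    then have "tRe (W q) \<in> xi (\<Xi> q)" unfolding xi_def xi_complex_frame by blast
    moreover have "tof_real (tIm (W q)) = (\<lambda>d. (- \<i>/2) *s W q d + (\<i>/2) *s tcnj (W q) d)"
      by (simp add: fun_eq_iff vec_eq_iff tof_real_def tIm_def tcnj_def complex_eq_iff)
    then have "tIm (W q) \<in> xi (\<Xi> q)" unfolding xi_def xi_complex_frame by blast
    ultimately have RI: "ip (gr c q) (vof (vRe (W q c))) (V c) = 0" "ip (gr c q) (vof (vIm (W q c))) (V c) = 0"
      using * by (auto simp: tRe_nth tIm_nth)
    have w: "W q c = vof (vRe (W q c)) + \<i> *s vof (vIm (W q c))" by (rule vRe_vIm)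
    then have "vcnj (W q c) = vcnj (vof (vRe (W q c)) + \<i> *s vof (vIm (W q c)))" by (rule arg_cong)
    then have w': "vcnj (W q c) = vof (vRe (W q c)) + (- \<i>) *s vof (vIm (W q c))" by simp
    have "ip (gr c q) (W q c) (V c) = 0" by (subst w) (simp only: ip_linear RI, simp)
    moreover have "ip (gr c q) (vcnj (W q c)) (V c) = 0" by (subst w') (simp only: ip_linear RI, simp)
    ultimately show "ip (gr c q) (V c) (W q c) = 0 \<and> ip (gr c q) (V c) (vcnj (W q c)) = 0"
      using ip_sym[OF in_chart, of "V c"] by simp
  next
    assume *: "ip (gr c q) (V c) (W q c) = 0 \<and> ip (gr c q) (V c) (vcnj (W q c)) = 0"
    show "\<forall>u\<in>xi (\<Xi> q). ip (gr c q) (vof (u c)) (V c) = 0"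
    proof
      fix u assume "u \<in> xi (\<Xi> q)"
      then obtain a b where "tof_real u = (\<lambda>d. a *s W q d + b *s tcnj (W q) d)"
        unfolding xi_def xi_complex_frame by auto
      then have "vof (u c) = a *s W q c + b *s vcnj (W q c)"
        by (metis tof_real_nth tcnj_nth)
      then show "ip (gr c q) (vof (u c)) (V c) = 0"
        using * ip_sym[OF in_chart, of "V c"] by (simp add: ip_linear)
    qed
  qed
  finally show ?thesis .
qed

text \<open>Since \<open>W\<close> and its conjugate are both null, each is paired nontrivially only
  with the other: the coefficient of one is found by pairing with the other. The computation also
  shows existence and uniqueness for the definite description.\<close>

lemma tangential_frame:
  assumes V: "V \<in> tangent_space A (F q)"
  shows "tangential A g (F q) (\<Xi> q) V = (\<lambda>d. (ip (gr c q) (V c) (vcnj (W q c)) / mass W c q) *s W q d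
    + (ip (gr c q) (V c) (W q c) / mass W c q) *s tcnj (W q) d)"
proof -
  have iff: "(\<lambda>d. V d - (a *s W q d + b *s tcnj (W q) d)) \<in> nu_complex A g (F q) (\<Xi> q)
     \<longleftrightarrow> b = ip (gr c q) (V c) (W q c) / mass W c q \<and> a = ip (gr c q) (V c) (vcnj (W q c)) / mass W c q" for a b
    unfolding nu_complex_frame[OF M.tangent_space_diff[OF V combination_in_tangent_space]]
    using mass_nonzero by (simp add: ip_linear frame_null frame_mass tcnj_nth field_simps) auto
  show ?thesis
    unfolding tangential_def
  proof (rule the_equality, goal_cases)
    case 1
    then show ?case unfolding xi_complex_frame using iff by blast
  next
    case (2 T)
    then obtain a b where "T = (\<lambda>d. a *s W q d + b *s tcnj (W q) d)" unfolding xi_complex_frame by blast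
    then show ?case using 2 iff by simp
  qed
qed

text \<open>Pairing with \<open>W\<close> isolates the coefficient of the conjugate frame; reality
  of \<open>u\<close> forces the other coefficient to be its conjugate.\<close>

lemma part01_frame:
  assumes u: "u \<in> xi (\<Xi> q)"
  defines "h \<equiv> ip (gr c q) (vof (u c)) (W q c) / mass W c q"
  shows "part01 (\<Xi> q) u = (\<lambda>d. h *s tcnj (W q) d)" "vof (u d) = cnj h *s W q d + h *s vcnj (W q d)"
proof -
  obtain a b where "tof_real u = (\<lambda>d. a *s W q d + b *s tcnj (W q) d)"
    using u unfolding xi_def xi_complex_frame by auto
  then have ab: "vof (u d) = a *s W q d + b *s vcnj (W q d)" for d
    by (metis tof_real_nth tcnj_nth)
  have b: "b = h"
    unfolding h_def ab using mass_nonzero by (simp add: ip_linear frame_null frame_mass)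
  have "vcnj (vof (u c)) = vof (u c)" by simp
  then have "cnj a *s vcnj (W q c) + cnj b *s W q c = a *s W q c + b *s vcnj (W q c)"
    unfolding ab by simp
  then have "ip (gr c q) (cnj a *s vcnj (W q c) + cnj b *s W q c) (vcnj (W q c))
      = ip (gr c q) (a *s W q c + b *s vcnj (W q c)) (vcnj (W q c))" by simp
  then have a: "a = cnj b"
    using mass_nonzero by (simp add: ip_linear frame_null frame_mass)
  show "vof (u d) = cnj h *s W q d + h *s vcnj (W q d)" using ab a b by simp
  show "part01 (\<Xi> q) u = (\<lambda>d. h *s tcnj (W q) d)"
    unfolding part01_def
  proof (rule the_equality)
    have "(\<lambda>c. tof_real u c - h *s tcnj (W q) c) = (\<lambda>c. cnj h *s W q c)"
      using ab a b by (simp add: fun_eq_iff tof_real_nth tcnj_nth)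
    then show "(\<lambda>d. h *s tcnj (W q) d) \<in> xi01 (\<Xi> q) \<and> (\<lambda>c. tof_real u c - h *s tcnj (W q) c) \<in> \<Xi> q"
      unfolding xi01_frame unfolding frameD(4)[OF fr q] by blast
    fix V assume V: "V \<in> xi01 (\<Xi> q) \<and> (\<lambda>c. tof_real u c - V c) \<in> \<Xi> q"
    then obtain b' a' where V': "V = (\<lambda>d. b' *s tcnj (W q) d)" and "(\<lambda>c. tof_real u c - V c) = (\<lambda>c. a' *s W q c)"
      unfolding xi01_frame unfolding frameD(4)[OF fr q] by blast
    then have "vof (u c) - b' *s vcnj (W q c) = a' *s W q c" by (metis tof_real_nth tcnj_nth)
    then have "ip (gr c q) (vof (u c) - b' *s vcnj (W q c)) (W q c) = ip (gr c q) (a' *s W q c) (W q c)" by simp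
    then have "b' = h" unfolding h_def using mass_nonzero by (simp add: ip_linear frame_null frame_mass field_simps)
    then show "V = (\<lambda>d. h *s tcnj (W q) d)" using V' by simp
  qed
qed

lemma hermitian_norm_tangential:
  assumes V: "V \<in> tangent_space A (F q)"
  shows "hermitian_norm_sq g (F q) (tangential A g (F q) (\<Xi> q) V)
      = ((cmod (ip (gr c q) (V c) (W q c)))\<^sup>2 + (cmod (ip (gr c q) (V c) (vcnj (W q c))))\<^sup>2) / Re (mass W c q)"
proof -
  define a b where "a = ip (gr c q) (V c) (vcnj (W q c)) / mass W c q" and "b = ip (gr c q) (V c) (W q c) / mass W c q"
  have T: "tangential A g (F q) (\<Xi> q) V = (\<lambda>d. a *s W q d + b *s tcnj (W q) d)"
    unfolding a_def b_def by (rule tangential_frame[OF V])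
  have "metric_bilinear g (F q) (tangential A g (F q) (\<Xi> q) V) (tcnj (tangential A g (F q) (\<Xi> q) V))
      = ip (gr c q) (a *s W q c + b *s vcnj (W q c)) (vcnj (a *s W q c + b *s vcnj (W q c)))"
    unfolding T
    using M.metric_bilinear_eq[OF c combination_in_tangent_space[of a b] M.tcnj_in_tangent_space[OF combination_in_tangent_space[of a b]]]
    by (simp add: tcnj_nth)
  also have "\<dots> = (a * cnj a + b * cnj b) * mass W c q"
    by (simp add: ip_linear frame_null frame_mass algebra_simps)
  also have "a * cnj a + b * cnj b = of_real ((cmod a)\<^sup>2 + (cmod b)\<^sup>2)"
    by (simp only: complex_norm_square of_real_add)
  finally have "hermitian_norm_sq g (F q) (tangential A g (F q) (\<Xi> q) V) = ((cmod a)\<^sup>2 + (cmod b)\<^sup>2) * Re (mass W c q)"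
    unfolding hermitian_norm_sq_def by (subst (asm) mass_real) (simp flip: of_real_mult)
  moreover have "cmod (mass W c q) = Re (mass W c q)"
    using mass_real mass_positive by (metis abs_of_pos norm_of_real)
  ultimately show ?thesis
    using mass_positive by (simp add: a_def b_def norm_divide power_divide add_divide_distrib[symmetric] power2_eq_square)
qed

lemma tangential_add:
  assumes "V \<in> tangent_space A (F q)" "V' \<in> tangent_space A (F q)"
  shows "tangential A g (F q) (\<Xi> q) (\<lambda>d. V d + V' d)
    = (\<lambda>d. tangential A g (F q) (\<Xi> q) V d + tangential A g (F q) (\<Xi> q) V' d)"
  unfolding tangential_frame[OF assms(1)] tangential_frame[OF assms(2)]
    tangential_frame[OF M.tangent_space_add[OF assms]]
  by (simp add: fun_eq_iff vec_eq_iff ip_linear add_divide_distrib algebra_simps)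

lemma tangential_in_tangent_space:
  "V \<in> tangent_space A (F q) \<Longrightarrow> tangential A g (F q) (\<Xi> q) V \<in> tangent_space A (F q)"
  by (simp add: tangential_frame combination_in_tangent_space)

lemma hermitian_norm_tangential_eq_0:
  assumes V: "V \<in> tangent_space A (F q)" 
    and "hermitian_norm_sq g (F q) (tangential A g (F q) (\<Xi> q) V) = 0"
  shows "tangential A g (F q) (\<Xi> q) V = (\<lambda>d. 0)"
proof -
  have "ip (gr c q) (V c) (W q c) = 0" "ip (gr c q) (V c) (vcnj (W q c)) = 0"
    using assms(2) mass_positive unfolding hermitian_norm_tangential[OF V]
    by (auto simp: add_nonneg_eq_0_iff)
  then show ?thesis by (simp add: tangential_frame[OF V])
qed

text \<open>Pythagoras: the remainder after subtracting the tangential part \<open>t\<close> is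
  Hermitian orthogonal to \<open>t\<close>.\<close>

lemma hermitian_norm_normal:
  assumes V: "V \<in> tangent_space A (F q)"
  shows "hermitian_norm_sq g (F q) (normal A g (F q) (\<Xi> q) V)
    = Re (ip (gr c q) (V c) (vcnj (V c))) - hermitian_norm_sq g (F q) (tangential A g (F q) (\<Xi> q) V)"
proof -
  define a b where "a = ip (gr c q) (V c) (vcnj (W q c)) / mass W c q" and "b = ip (gr c q) (V c) (W q c) / mass W c q"
  define t where "t = a *s W q c + b *s vcnj (W q c)"
  have T: "tangential A g (F q) (\<Xi> q) V = (\<lambda>d. a *s W q d + b *s tcnj (W q) d)"
    unfolding a_def b_def by (rule tangential_frame[OF V])
  have TT: "tangential A g (F q) (\<Xi> q) V \<in> tangent_space A (F q)" by (rule tangential_in_tangent_space[OF V])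
  have n: "hermitian_norm_sq g (F q) (normal A g (F q) (\<Xi> q) V) = Re (ip (gr c q) (V c - t) (vcnj (V c - t)))"
    unfolding hermitian_norm_sq_def normal_def
    using M.metric_bilinear_eq[OF c M.tangent_space_diff[OF V TT] M.tcnj_in_tangent_space[OF M.tangent_space_diff[OF V TT]]]
    by (simp add: T t_def tcnj_nth)
  have h: "hermitian_norm_sq g (F q) (tangential A g (F q) (\<Xi> q) V) = Re (ip (gr c q) t (vcnj t))"
    unfolding hermitian_norm_sq_def
    using M.metric_bilinear_eq[OF c TT M.tcnj_in_tangent_space[OF TT]]
    by (simp add: T t_def tcnj_nth)
  have orth: "ip (gr c q) (V c - t) (vcnj t) = 0"
    using mass_nonzero by (simp add: t_def a_def b_def ip_linear frame_null frame_mass)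
  then have "cnj (ip (gr c q) (V c - t) (vcnj t)) = 0" by simp
  then have "ip (gr c q) (vcnj (V c - t)) t = 0" by (simp add: cnj_ip)
  then have "ip (gr c q) t (vcnj (V c - t)) = 0" using ip_sym[OF in_chart] by metis
  with orth show ?thesis unfolding n h by (simp add: ip_linear)
qed

end

end

section \<open>Comparison of the second variations\<close>

lemma pd_zero:
  assumes "open U" "w \<in> U" "\<And>w. w \<in> U \<Longrightarrow> f w = 0"
  shows "pd e f w = 0"
proof -
  have "frechet_derivative (\<lambda>x. 0) (at w) = frechet_derivative f (at w)"
    by (rule frechet_derivative_transform_within_open[OF _ assms(1,2)]) (use assms(3) in auto)
  then show ?thesis by (metis frechet_derivative_const)
qed

lemma C_k_on_smult:
  fixes a :: "'a::euclidean_space \<Rightarrow> 'k::{real_normed_field, euclidean_space}"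
  assumes "open U" "C_k_on k U a" "C_k_on k U V"
  shows "C_k_on k U (\<lambda>w. a w *s V w)"
proof (rule C_k_on_vec[OF assms(1)])
  show "C_k_on k U (\<lambda>w. (a w *s V w) $ i)" for i
    using C_k_on_mult[OF assms(1,2) C_k_on_vec_nth[OF assms(1,3)], of i] by simp
qed

section \<open>Operations on sections and the energy density\<close>

context surface_map
begin

lemma nabla_outside: "\<not> (c \<in> A \<and> F p \<in> fst c) \<Longrightarrow> nabla A g F z e v p c = 0"
  by (simp only: nabla_def tfamily_def if_False)

lemma nabla_tof_real:
  assumes v: "smooth_section_on S A F N v" "p \<in> N" and z: "z \<in> S" "p \<in> fst z"
  shows "nabla A g F z e (\<lambda>q. tof_real (v q)) p c = vof (nabla A g F z e v p c)"
proof (cases "c \<in> A \<and> F p \<in> fst c")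
  case True
  then show ?thesis
    using cov_vof[OF differentiable_section[OF v(1) z(1) _ v(2) z(2)], where ?'k = complex]
    by (simp add: nabla_nth[OF z(1) _ z(2)] tof_real_nth)
next
  case False
  then show ?thesis by (simp add: nabla_outside vec_eq_iff)
qed

lemma nabla_tcnj:
  assumes v: "smooth_section_on S A F N v" "p \<in> N" and z: "z \<in> S" "p \<in> fst z"
  shows "nabla A g F z e (\<lambda>q. tcnj (v q)) p c = vcnj (nabla A g F z e v p c)"
proof (cases "c \<in> A \<and> F p \<in> fst c")
  case True
  then show ?thesis
    using cov_vcnj[OF differentiable_section[OF v(1) z(1) _ v(2) z(2)]]
    by (simp add: nabla_nth[OF z(1) _ z(2)] tcnj_nth)
qed (simp add: nabla_outside)

lemma nabla_add:
  assumes v: "smooth_section_on S A F N v" and v': "smooth_section_on S A F N v'" "p \<in> N" and z: "z \<in> S" "p \<in> fst z"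
  shows "nabla A g F z e (\<lambda>q d. v q d + v' q d) p c = nabla A g F z e v p c + nabla A g F z e v' p c"
proof (cases "c \<in> A \<and> F p \<in> fst c")
  case True
  then show ?thesis
    using cov_add[OF differentiable_section[OF v z(1) _ v'(2) z(2)] differentiable_section[OF v'(1) z(1) _ v'(2) z(2)]]
    by (simp add: nabla_nth[OF z(1) _ z(2)])
qed (simp add: nabla_outside)

lemma nabla_smult:
  assumes v: "smooth_section_on S A F N v" "p \<in> N" and z: "z \<in> S" "p \<in> fst z"
  shows "nabla A g F z e (\<lambda>q d. a *s v q d) p c = a *s nabla A g F z e v p c"
proof (cases "c \<in> A \<and> F p \<in> fst c")
  case True
  then show ?thesis
    using cov_smult[OF differentiable_const[of a] differentiable_section[OF v(1) z(1) _ v(2) z(2)]]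
    by (simp add: nabla_nth[OF z(1) _ z(2)])
qed (simp add: nabla_outside)

lemma smooth_section_tcnj:
  assumes "smooth_section_on S A F N v" "open N"
  shows "smooth_section_on S A F N (\<lambda>q. tcnj (v q))"
proof (rule smooth_section_onI)
  show "C_k_on k (patch N z c) (\<lambda>w. tcnj (v (chart_inv z w)) c)" if "z \<in> S" "c \<in> A" for z c k
    unfolding tcnj_nth by (rule C_k_on_linear[OF bounded_linear_vcnj open_patch[OF assms(2) that] C_k_on_section[OF assms(1) that]])
qed (simp add: M.tcnj_in_tangent_space section_in_tangent_space[OF assms(1)])

lemma smooth_section_tof_real:
  assumes "smooth_section_on S A F N v" "open N"
  shows "smooth_section_on S A F N (\<lambda>q. tof_real (v q))"
proof (rule smooth_section_onI)
  show "C_k_on k (patch N z c) (\<lambda>w. tof_real (v (chart_inv z w)) c)" if "z \<in> S" "c \<in> A" for z c k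
    unfolding tof_real_nth by (rule C_k_on_linear[OF bounded_linear_vof open_patch[OF assms(2) that] C_k_on_section[OF assms(1) that]])
qed (simp add: M.tof_real_in_tangent_space section_in_tangent_space[OF assms(1)])

lemma smooth_section_tIm:
  assumes "smooth_section_on S A F N v" "open N"
  shows "smooth_section_on S A F N (\<lambda>q. tIm (v q))"
proof (rule smooth_section_onI)
  show "C_k_on k (patch N z c) (\<lambda>w. tIm (v (chart_inv z w)) c)" if "z \<in> S" "c \<in> A" for z c k
    unfolding tIm_nth by (rule C_k_on_linear[OF bounded_linear_vIm open_patch[OF assms(2) that] C_k_on_section[OF assms(1) that]])
qed (simp add: M.tIm_in_tangent_space section_in_tangent_space[OF assms(1)])

lemma smooth_section_add:
  assumes "smooth_section_on S A F N v" "smooth_section_on S A F N v'" "open N"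
  shows "smooth_section_on S A F N (\<lambda>q d. v q d + v' q d)"
proof (rule smooth_section_onI)
  show "C_k_on k (patch N z c) (\<lambda>w. v (chart_inv z w) c + v' (chart_inv z w) c)" if "z \<in> S" "c \<in> A" for z c k
    by (rule C_k_on_add[OF open_patch[OF assms(3) that] C_k_on_section[OF assms(1) that] C_k_on_section[OF assms(2) that]])
qed (simp add: M.tangent_space_add section_in_tangent_space[OF assms(1)] section_in_tangent_space[OF assms(2)])

lemma smooth_section_smult:
  assumes "smooth_section_on S A F N v" "open N"
  shows "smooth_section_on S A F N (\<lambda>q d. a *s v q d)"
proof (rule smooth_section_onI)
  show "C_k_on k (patch N z c) (\<lambda>w. a *s v (chart_inv z w) c)" if "z \<in> S" "c \<in> A" for z c k
    by (rule C_k_on_smult[OF open_patch[OF assms(2) that] C_k_on_const C_k_on_section[OF assms(1) that]])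
qed (simp add: M.tangent_space_smult section_in_tangent_space[OF assms(1)])

text \<open>A density is a scalar on the surface, but its formula involves a chart of the target and
  possibly a frame, both available only near a given point. Regularity is therefore checked point by
  point with varying \<open>N\<close>, \<open>c\<close> and \<open>h\<close>.\<close>

lemma C_k_on_density:
  assumes "z \<in> S"
    and "\<And>p. p \<in> fst z \<Longrightarrow> \<exists>N c h. open N \<and> p \<in> N \<and> c \<in> A \<and> F p \<in> fst c \<and> C_k_on k (patch N z c) h \<and>
      (\<forall>q\<in>N. q \<in> fst z \<longrightarrow> F q \<in> fst c \<longrightarrow> f q = h (snd z q))"
  shows "C_k_on k (snd z ` fst z) (\<lambda>w. f (chart_inv z w))"
proof (rule C_k_on_local)
  fix w assume "w \<in> snd z ` fst z"
  then obtain p where p: "p \<in> fst z" "w = snd z p" by blast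
  obtain N c h where *: "open N" "p \<in> N" "c \<in> A" "F p \<in> fst c" "C_k_on k (patch N z c) h"
      "\<And>q. q \<in> N \<Longrightarrow> q \<in> fst z \<Longrightarrow> F q \<in> fst c \<Longrightarrow> f q = h (snd z q)"
    using assms(2)[OF p(1)] by blast
  have o: "open (patch N z c)" by (rule open_patch[OF *(1) assms(1) *(3)])
  have "C_k_on k (patch N z c) (\<lambda>w. f (chart_inv z w))"
  proof (rule C_k_on_cong[OF o _ *(5)])
    fix x assume "x \<in> patch N z c"
    then show "h x = f (chart_inv z x)"
      using assms(1) by (rule patchE) (simp add: *(6))
  qed
  then show "\<exists>V. open V \<and> w \<in> V \<and> C_k_on k V (\<lambda>w. f (chart_inv z w))"
    using o in_patch[OF *(2) p(1) *(4)] p(2) by blast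
qed

definition energy_density :: "('s \<Rightarrow> ('m, 'n, real) tvec) \<Rightarrow> ('s, complex) chart \<Rightarrow> 's \<Rightarrow> real" where
  "energy_density v z p =
     g (F p) (nabla A g F z 1 v p) (nabla A g F z 1 v p)
     + g (F p) (nabla A g F z \<i> v p) (nabla A g F z \<i> v p)
     - g (F p) (curvature A g (F p) (v p) (pushforward A F z 1 p) (pushforward A F z 1 p)) (v p)
     - g (F p) (curvature A g (F p) (v p) (pushforward A F z \<i> p) (pushforward A F z \<i> p)) (v p)"

lemma energy_density_coords:
  assumes v: "smooth_section_on S A F UNIV v" and z: "z \<in> S" "p \<in> fst z" and c: "c \<in> A" "F p \<in> fst c"
  shows "energy_density v z p =
     (let M = G c (snd c (F p)); R = crv (G c) (snd c (F p)); X = pushforward A F z 1 p c; Y = pushforward A F z \<i> p c in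
     ip M (nabla A g F z 1 v p c) (nabla A g F z 1 v p c) + ip M (nabla A g F z \<i> v p c) (nabla A g F z \<i> v p c)
     - ip M (R (v p c) X X) (v p c) - ip M (R (v p c) Y Y) (v p c))"
proof -
  note nT = nabla_in_tangent_space[OF v open_UNIV UNIV_I z]
  note vT = section_in_tangent_space[OF v UNIV_I]
  note pT = pushforward_in_tangent_space[OF z]
  show ?thesis
    by (simp add: energy_density_def Let_def M.metric_eq_ip[OF c] nT vT pT M.curvature_in_tangent_space M.curvature_nth c)
qed

text \<open>The density is a quadratic expression in the direction, summed over the directions
  \<open>1\<close> and \<open>\<i>\<close>. Replacing \<open>e\<close> by \<open>j * e\<close>
  scales the sum by the squared modulus of \<open>j\<close>, because the mixed terms of the two
  directions cancel.\<close>

lemma two_form_energy_density: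
  assumes v: "smooth_section_on S A F UNIV v"
  shows "S.two_form (energy_density v)"
  unfolding S.two_form_def
proof (intro conjI ballI)
  fix z assume z: "z \<in> S"
  have "C_k_on 0 (snd z ` fst z) (\<lambda>w. energy_density v z (chart_inv z w))"
  proof (rule C_k_on_density[OF z])
    fix p assume p: "p \<in> fst z"
    obtain c where c: "c \<in> A" "F p \<in> fst c" using M.chart_at by blast
    interpret metric_coords "snd c ` fst c" "G c" by (rule M.metric_coords_gram[OF c(1)])
    let ?D = "patch UNIV z c"
    have o: "open ?D" by (rule open_patch[OF open_UNIV z c(1)])
    let ?V = "\<lambda>e w. nabla A g F z e v (chart_inv z w) c" and ?P = "\<lambda>e w. pushforward A F z e (chart_inv z w) c"
      and ?v = "\<lambda>w. v (chart_inv z w) c"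
    let ?h = "\<lambda>w. ip (G c (coords z c w)) (?V 1 w) (?V 1 w) + ip (G c (coords z c w)) (?V \<i> w) (?V \<i> w)
      - ip (G c (coords z c w)) (crv (G c) (coords z c w) (?v w) (?P 1 w) (?P 1 w)) (?v w)
      - ip (G c (coords z c w)) (crv (G c) (coords z c w) (?v w) (?P \<i> w) (?P \<i> w)) (?v w)"
    note V = C_k_on_nabla[OF v open_UNIV z c(1)] and P = C_k_on_pushforward[OF z c(1) open_UNIV]
      and v' = C_k_on_section[OF v z c(1)]
    note R = C_k_on_crv[OF o coords_image[OF z] C_k_on_coords[OF z c(1)] v' P P]
    have "C_k_on 0 ?D ?h"
      by (intro C_k_on_diff C_k_on_add o C_k_on_ip_section[OF z c(1) open_UNIV V V] C_k_on_ip_section[OF z c(1) open_UNIV R v'])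
    moreover have "energy_density v z q = ?h (snd z q)" if "q \<in> fst z" "F q \<in> fst c" for q
      using that energy_density_coords[OF v z that(1) c(1) that(2)] S.chart(3)[OF z]
      by (simp add: Let_def coords_at[OF z])
    ultimately show "\<exists>N c h. open N \<and> p \<in> N \<and> c \<in> A \<and> F p \<in> fst c \<and> C_k_on 0 (patch N z c) h \<and>
      (\<forall>q\<in>N. q \<in> fst z \<longrightarrow> F q \<in> fst c \<longrightarrow> energy_density v z q = h (snd z q))"
      using c by (intro exI[of _ UNIV] exI[of _ c] exI[of _ ?h]) simp
  qed
  then show "continuous_on (snd z ` fst z) (\<lambda>w. energy_density v z (chart_inv z w))" by simp
next
  fix z y p assume z: "z \<in> S" "y \<in> S" "p \<in> fst z \<inter> fst y"
  then have p: "p \<in> fst z" "p \<in> fst y" by auto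
  obtain c where c: "c \<in> A" "F p \<in> fst c" using M.chart_at by blast
  interpret metric_coords "snd c ` fst c" "G c" by (rule M.metric_coords_gram[OF c(1)])
  define j where "j = S.jac z y p"
  have V: "nabla A g F z e v p c = Re (j * e) *s nabla A g F y 1 v p c + Im (j * e) *s nabla A g F y \<i> v p c" for e
    unfolding j_def scalar_mult_eq_scaleR
    using nabla_change[OF v UNIV_I z(1,2) p, of e] nabla_linear[OF v UNIV_I z(2) p(2)] by metis
  have P: "pushforward A F z e p c = Re (j * e) *s pushforward A F y 1 p c + Im (j * e) *s pushforward A F y \<i> p c" for e
    unfolding j_def scalar_mult_eq_scaleR
    using pushforward_change[OF z(1,2) p, of e] pushforward_linear[OF z(2) p(2)] by metis
  have x: "snd c (F p) \<in> snd c ` fst c" using c by auto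
  note sym = ip_sym[OF x, of "nabla A g F y \<i> v p c" "nabla A g F y 1 v p c"]
  show "energy_density v z p = (cmod (S.jac z y p))\<^sup>2 * energy_density v y p"
    unfolding energy_density_coords[OF v z(1) p(1) c] energy_density_coords[OF v z(2) p(2) c] Let_def V P cmod_power2 j_def[symmetric]
    by (simp add: ip_linear crv_add crv_diff crv_scale sym power2_eq_square algebra_simps)
qed

lemma second_variation_energy_eq: "second_variation_energy S A g F v = surface_integral S (energy_density v)"
  unfolding second_variation_energy_def energy_density_def[abs_def] ..

end


section \<open>The (0,1) part of the tangential section and its first derivatives\<close>

locale variation = branched_surface S A g F \<Xi>
  for S :: "('s::{t2_space, second_countable_topology}, complex) chart set"
    and A :: "('m::topological_space, real^'n) chart set"
    and g :: "'m \<Rightarrow> ('m, 'n, real) tvec \<Rightarrow> ('m, 'n, real) tvec \<Rightarrow> real"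
    and F :: "'s \<Rightarrow> 'm" and \<Xi> :: "'s \<Rightarrow> ('m, 'n, complex) tvec set" +
  fixes s \<sigma> :: "'s \<Rightarrow> ('m, 'n, real) tvec"
  assumes normal_section: "smooth_normal_section S A g F \<Xi> s"
    and tangential_section: "smooth_tangential_section S A F \<Xi> \<sigma>"
begin

lemma s_section: "smooth_section_on S A F UNIV s"
  using normal_section by (simp add: smooth_normal_section_def)

lemma sigma_section: "smooth_section_on S A F UNIV \<sigma>" and sigma_xi: "\<sigma> p \<in> xi (\<Xi> p)"
  using tangential_section by (simp_all add: smooth_tangential_section_def)

definition \<tau> :: "'s \<Rightarrow> ('m, 'n, complex) tvec" where
  "\<tau> p = part01 (\<Xi> p) (\<sigma> p)"

text \<open>Up to sign, \<open>\<kappa>\<close> is the image of \<open>\<sigma>\<close> under the complex structure of the ramified tangent bundle.\<close>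

definition \<kappa> :: "'s \<Rightarrow> ('m, 'n, real) tvec" where
  "\<kappa> p = (\<lambda>c. 2 *s tIm (\<tau> p) c)"

definition coeff :: "('s \<Rightarrow> ('m, 'n, complex) tvec) \<Rightarrow> ('m, real^'n) chart \<Rightarrow> 's \<Rightarrow> complex" where
  "coeff W c q = ip (gr c q) (vof (\<sigma> q c)) (W q c) / mass W c q"

lemma tau_frame:
  assumes "frame N W" "q \<in> N" "c \<in> A" "F q \<in> fst c"
  shows "\<tau> q = (\<lambda>d. coeff W c q *s tcnj (W q) d)"
    and "vof (\<sigma> q d) = cnj (coeff W c q) *s W q d + coeff W c q *s vcnj (W q d)"
  unfolding \<tau>_def coeff_def by (rule part01_frame[OF assms sigma_xi])+

lemma C_k_on_coeff:
  assumes fr: "frame N W" and z: "z \<in> S" and c: "c \<in> A"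
  shows "C_k_on k (patch N z c) (\<lambda>w. coeff W c (chart_inv z w))"
proof -
  note N = frameD(1)[OF fr]
  have o: "open (patch N z c)" by (rule open_patch[OF N z c])
  note W = C_k_on_section[OF frameD(2)[OF fr] z c]
  note W' = C_k_on_linear[OF bounded_linear_vcnj o W]
  have "C_k_on k (patch N z c) (\<lambda>w. vof (\<sigma> (chart_inv z w) c) :: complex^'n)"
    using C_k_on_section[OF smooth_section_on_subset[OF sigma_section] z c, of N]
    by (intro C_k_on_linear[OF bounded_linear_vof o]) auto
  then have "C_k_on k (patch N z c) (\<lambda>w. ip (G c (coords z c w)) (vof (\<sigma> (chart_inv z w) c)) (W (chart_inv z w) c)
      * inverse (ip (G c (coords z c w)) (W (chart_inv z w) c) (vcnj (W (chart_inv z w) c))))"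
  proof (intro C_k_on_mult C_k_on_inverse o C_k_on_ip_section[OF z c N] W W')
    fix w assume "w \<in> patch N z c"
    then show "ip (G c (coords z c w)) (W (chart_inv z w) c) (vcnj (W (chart_inv z w) c)) \<noteq> 0"
      using z
    proof (rule patchE)
      fix q assume q: "q \<in> N" "q \<in> fst z" "F q \<in> fst c" "w = snd z q" "chart_inv z w = q"
      show ?thesis
        using mass_nonzero[OF fr q(1) c q(3)] q(5) coords_at[OF z q(2), of c] unfolding q(4) mass_def by simp
    qed
  qed
  then show ?thesis
    by (simp add: coeff_def mass_def coords_def comp_def divide_inverse)
qed

text \<open>The definition through \<open>part01\<close> is pointwise; smoothness, also across
  branch points, comes from the coefficient with respect to a smooth frame, a quotient with
  nonvanishing denominator.\<close>

lemma tau_section: "smooth_section_on S A F UNIV \<tau>"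
proof (rule smooth_section_onI)
  fix p
  obtain N W where fr: "p \<in> N" "frame N W" using frame_exists by blast
  obtain c where c: "c \<in> A" "F p \<in> fst c" using M.chart_at by blast
  show "\<tau> p \<in> tangent_space A (F p)"
    unfolding tau_frame(1)[OF fr(2,1) c]
    by (intro M.tangent_space_smult M.tcnj_in_tangent_space frameD(8)[OF fr(2,1)])
next
  fix z c k assume z: "z \<in> S" and c: "c \<in> A"
  show "C_k_on k (patch UNIV z c) (\<lambda>w. \<tau> (chart_inv z w) c)"
  proof (rule C_k_on_local)
    fix w assume "w \<in> patch UNIV z c"
    then obtain p where p: "p \<in> fst z" "F p \<in> fst c" "w = snd z p" using z by (rule patchE)
    obtain N W where fr: "p \<in> N" "frame N W" using frame_exists by blast
    have o: "open (patch N z c)" by (rule open_patch[OF frameD(1)[OF fr(2)] z c])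
    have "C_k_on k (patch N z c) (\<lambda>w. coeff W c (chart_inv z w) *s vcnj (W (chart_inv z w) c))"
      by (rule C_k_on_smult[OF o C_k_on_coeff[OF fr(2) z c] C_k_on_linear[OF bounded_linear_vcnj o C_k_on_section[OF frameD(2)[OF fr(2)] z c]]])
    then have "C_k_on k (patch N z c) (\<lambda>w. \<tau> (chart_inv z w) c)"
    proof (rule C_k_on_cong[OF o, rotated])
      fix w assume "w \<in> patch N z c"
      then show "coeff W c (chart_inv z w) *s vcnj (W (chart_inv z w) c) = \<tau> (chart_inv z w) c"
        using z by (rule patchE) (simp add: tau_frame(1)[OF fr(2) _ c] tcnj_nth)
    qed
    moreover have "w \<in> patch N z c" unfolding p(3) by (rule in_patch[OF fr(1) p(1,2)])
    ultimately show "\<exists>V. open V \<and> w \<in> V \<and> C_k_on k V (\<lambda>w. \<tau> (chart_inv z w) c)" using o by blast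
  qed
qed

lemma kappa_section: "smooth_section_on S A F UNIV \<kappa>"
  unfolding \<kappa>_def[abs_def] by (rule smooth_section_smult[OF smooth_section_tIm[OF tau_section open_UNIV] open_UNIV])

text \<open>The real section \<open>\<sigma>\<close> is the sum of \<open>\<tau>\<close> and its
  conjugate, so the real part of \<open>\<tau>\<close> is half of \<open>\<sigma>\<close>; the
  factor 2 in \<open>\<kappa>\<close> matches this.\<close>

lemma tau_eq: "\<tau> p d = (1/2) *s (tof_real (\<sigma> p) d + \<i> *s tof_real (\<kappa> p) d)"
proof -
  obtain N W where fr: "p \<in> N" "frame N W" using frame_exists by blast
  obtain c where c: "c \<in> A" "F p \<in> fst c" using M.chart_at by blast
  have "vof (\<sigma> p d) = vcnj (\<tau> p d) + \<tau> p d"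
    unfolding tau_frame(2)[OF fr(2,1) c] tau_frame(1)[OF fr(2,1) c] by (simp add: tcnj_nth)
  then have "vRe (vof (\<sigma> p d) :: complex^'n) = vRe (vcnj (\<tau> p d) + \<tau> p d)" by simp
  then have "\<sigma> p d = vRe (\<tau> p d) + vRe (\<tau> p d)" by simp
  then show ?thesis
    unfolding tof_real_nth \<kappa>_def tIm_nth
    by (subst vRe_vIm[of "\<tau> p d"]) (simp add: vec_eq_iff)
qed

lemma nabla_tau:
  assumes z: "z \<in> S" "p \<in> fst z"
  shows "nabla A g F z e \<tau> p c = (1/2) *s (vof (nabla A g F z e \<sigma> p c) + \<i> *s vof (nabla A g F z e \<kappa> p c))"
proof -
  note s1 = smooth_section_tof_real[OF sigma_section open_UNIV]
    and s2 = smooth_section_smult[OF smooth_section_tof_real[OF kappa_section open_UNIV] open_UNIV]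
  have \<tau>': "\<tau> = (\<lambda>p d. (1/2) *s (tof_real (\<sigma> p) d + \<i> *s tof_real (\<kappa> p) d))"
    by (intro ext) (rule tau_eq)
  show ?thesis
    unfolding \<tau>' nabla_smult[OF smooth_section_add[OF s1 s2 open_UNIV] UNIV_I z]
      nabla_add[OF s1 s2 UNIV_I z] nabla_smult[OF smooth_section_tof_real[OF kappa_section open_UNIV] UNIV_I z]
      nabla_tof_real[OF sigma_section UNIV_I z] nabla_tof_real[OF kappa_section UNIV_I z] ..
qed

context
  fixes N W z p c
  assumes fr: "frame N W" and p: "p \<in> N" "p \<in> fst z" "F p \<in> fst c" and z: "z \<in> S" and c: "c \<in> A"
begin

interpretation metric_coords "snd c ` fst c" "G c" by (rule M.metric_coords_gram[OF c])

lemma in_chart': "snd c (F p) \<in> snd c ` fst c" using p by auto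

text \<open>Write \<open>\<tau>\<close> as a function times the conjugate frame. Conjugating the
  equation for \<open>W\<close> shows that the derivative in direction \<open>z\<close> annihilates
  the conjugate frame, so only the function is differentiated.\<close>

lemma nabla_tau_holomorphic:
  "\<exists>b. nabla A g F z 1 \<tau> p c - \<i> *s nabla A g F z \<i> \<tau> p c = b *s vcnj (W p c)"
proof -
  let ?D = "patch N z c" and ?w = "snd z p"
  note Wc = smooth_section_tcnj[OF frameD(2)[OF fr] frameD(1)[OF fr]]
  have o: "open ?D" by (rule open_patch[OF frameD(1)[OF fr] z c])
  have w: "?w \<in> ?D" by (rule in_patch[OF p])
  have dh: "(\<lambda>w. coeff W c (chart_inv z w)) differentiable (at ?w)"
    using C_k_on_coeff[OF fr z c, of "Suc 0"] w by simp
  have n: "nabla A g F z e \<tau> p c = pd e (\<lambda>w. coeff W c (chart_inv z w)) ?w *s vcnj (W p c)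
      + coeff W c p *s vcnj (nabla A g F z e W p c)" for e
  proof -
    have "nabla A g F z e \<tau> p c = cov (G c) (coords z c) e (\<lambda>w. \<tau> (chart_inv z w) c) ?w"
      by (rule nabla_nth[OF z c p(2,3)])
    also have "\<dots> = cov (G c) (coords z c) e (\<lambda>w. coeff W c (chart_inv z w) *s tcnj (W (chart_inv z w)) c) ?w"
    proof (rule cov_cong[OF o w])
      show "(\<lambda>w. \<tau> (chart_inv z w) c) differentiable (at ?w)"
        by (rule differentiable_section[OF tau_section z c UNIV_I p(2,3)])
      fix x assume "x \<in> ?D"
      then show "\<tau> (chart_inv z x) c = coeff W c (chart_inv z x) *s tcnj (W (chart_inv z x)) c"
        using z by (rule patchE) (simp add: tau_frame(1)[OF fr _ c])
    qed
    also have "\<dots> = pd e (\<lambda>w. coeff W c (chart_inv z w)) ?w *s vcnj (W p c) + coeff W c p *s nabla A g F z e (\<lambda>q. tcnj (W q)) p c"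
      using cov_smult[OF dh differentiable_section[OF Wc z c p]] nabla_nth[OF z c p(2,3), of e "\<lambda>q. tcnj (W q)"]
        S.chart(3)[OF z p(2)] by (simp add: tcnj_nth)
    finally show ?thesis using nabla_tcnj[OF frameD(2)[OF fr] p(1) z p(2)] by simp
  qed
  have "vcnj (nabla A g F z 1 W p c + \<i> *s nabla A g F z \<i> W p c) = 0"
    using frameD(6)[OF fr p(1) z p(2)] by simp
  then have d: "vcnj (nabla A g F z 1 W p c) = \<i> *s vcnj (nabla A g F z \<i> W p c)"
    by (simp add: vec_eq_iff)
  have "nabla A g F z 1 \<tau> p c - \<i> *s nabla A g F z \<i> \<tau> p c
    = (pd 1 (\<lambda>w. coeff W c (chart_inv z w)) ?w - \<i> * pd \<i> (\<lambda>w. coeff W c (chart_inv z w)) ?w) *s vcnj (W p c)"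
    unfolding n d by (simp add: vec_eq_iff algebra_simps)
  then show ?thesis by blast
qed

text \<open>Differentiate two identities: the conjugate frame is null, and \<open>\<tau>\<close> is
  orthogonal to it. The first makes the derivative of the conjugate frame orthogonal to that frame,
  hence to \<open>\<tau>\<close>; the second then gives the claim, in every direction
  \<open>e\<close>.\<close>

lemma nabla_tau_orthogonal: "ip (gr c p) (nabla A g F z e \<tau> p c) (vcnj (W p c)) = 0"
proof -
  let ?D = "patch N z c" and ?w = "snd z p"
  let ?W = "\<lambda>q. tcnj (W q)"
  note Wc = smooth_section_tcnj[OF frameD(2)[OF fr] frameD(1)[OF fr]]
  note t = smooth_section_on_subset[OF tau_section subset_UNIV, of N]
  have o: "open ?D" by (rule open_patch[OF frameD(1)[OF fr] z c])
  have w: "?w \<in> ?D" by (rule in_patch[OF p])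
  have 0: "ip (G c (coords z c x)) (?W (chart_inv z x) c) (?W (chart_inv z x) c) = 0"
    "ip (G c (coords z c x)) (\<tau> (chart_inv z x) c) (?W (chart_inv z x) c) = 0" if "x \<in> ?D" for x
  proof -
    obtain q where q: "q \<in> N" "q \<in> fst z" "F q \<in> fst c" "x = snd z q" "chart_inv z x = q"
      using \<open>x \<in> ?D\<close> z by (rule patchE)
    show "ip (G c (coords z c x)) (?W (chart_inv z x) c) (?W (chart_inv z x) c) = 0"
      "ip (G c (coords z c x)) (\<tau> (chart_inv z x) c) (?W (chart_inv z x) c) = 0"
      unfolding q(5) unfolding q(4) coords_at[OF z q(2)] tau_frame(1)[OF fr q(1) c q(3)]
      using frame_null(2)[OF fr q(1) c q(3)] by (simp_all add: tcnj_nth ip_linear)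
  qed
  have "2 * ip (gr c p) (?W p c) (nabla A g F z e ?W p c) = 0"
    using nabla_compatible[OF Wc Wc p z c, of e] pd_zero[OF o w 0(1), where e = e] ip_sym[OF in_chart', of "?W p c"] by simp
  then have "ip (gr c p) (?W p c) (nabla A g F z e ?W p c) = 0" by simp
  then have "ip (gr c p) (\<tau> p c) (nabla A g F z e ?W p c) = 0"
    unfolding tau_frame(1)[OF fr p(1) c p(3)] by (simp add: ip_linear)
  then show ?thesis
    using nabla_compatible[OF t Wc p z c, of e] pd_zero[OF o w 0(2), where e = e] by (simp add: tcnj_nth)
qed

text \<open>The sum of squares factors as the product of \<open>?a + \<i> *s ?b\<close> and
  \<open>?a - \<i> *s ?b\<close>. The second factor is a multiple of the conjugate frame, to which
  both derivatives are orthogonal.\<close>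

lemma nabla_tau_null:
  "ip (gr c p) (nabla A g F z 1 \<tau> p c) (nabla A g F z 1 \<tau> p c) + ip (gr c p) (nabla A g F z \<i> \<tau> p c) (nabla A g F z \<i> \<tau> p c) = 0"
proof -
  let ?a = "nabla A g F z 1 \<tau> p c" and ?b = "nabla A g F z \<i> \<tau> p c"
  obtain b where b: "?a - \<i> *s ?b = b *s vcnj (W p c)" using nabla_tau_holomorphic by blast
  have "ip (gr c p) (?a + \<i> *s ?b) (?a - \<i> *s ?b) = 0"
    unfolding b by (simp add: ip_linear nabla_tau_orthogonal)
  then show ?thesis
    using ip_sym[OF in_chart', of ?b ?a] by (simp add: ip_linear algebra_simps)
qed

text \<open>Real part of the preceding identity for
  \<open>\<tau> = (\<sigma> + i\<kappa>) / 2\<close>.\<close>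

lemma nabla_sigma_kappa:
  "ip (gr c p) (nabla A g F z 1 \<sigma> p c) (nabla A g F z 1 \<sigma> p c) + ip (gr c p) (nabla A g F z \<i> \<sigma> p c) (nabla A g F z \<i> \<sigma> p c)
   = ip (gr c p) (nabla A g F z 1 \<kappa> p c) (nabla A g F z 1 \<kappa> p c) + ip (gr c p) (nabla A g F z \<i> \<kappa> p c) (nabla A g F z \<i> \<kappa> p c)"
proof -
  have "Re (ip (gr c p) (nabla A g F z 1 \<tau> p c) (nabla A g F z 1 \<tau> p c) + ip (gr c p) (nabla A g F z \<i> \<tau> p c) (nabla A g F z \<i> \<tau> p c)) = 0"
    using nabla_tau_null by simp
  then show ?thesis
    unfolding nabla_tau[OF z p(2)] by (simp add: ip_linear ip_vof)
qed

text \<open>Where \<open>F_z\<close> is nonzero, \<open>\<sigma>\<close> and \<open>\<kappa>\<close>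
  are combinations of \<open>F_x\<close> and \<open>F_y\<close> that differ by a quarter turn, and
  antisymmetry of the curvature gives the identity. Where \<open>F_z\<close> vanishes, so do
  \<open>F_x\<close> and \<open>F_y\<close> and both sides are zero; branch points are thus covered
  without a limit.\<close>

lemma curvature_sigma_kappa:
  "crv (G c) (snd c (F p)) (\<sigma> p c) (pushforward A F z 1 p c) (pushforward A F z 1 p c)
   + crv (G c) (snd c (F p)) (\<sigma> p c) (pushforward A F z \<i> p c) (pushforward A F z \<i> p c)
   = crv (G c) (snd c (F p)) (pushforward A F z 1 p c) (pushforward A F z \<i> p c) (\<kappa> p c)"
proof -
  let ?X = "pushforward A F z 1 p c" and ?Y = "pushforward A F z \<i> p c"
  obtain u where u: "F_z A F z p = (\<lambda>c. u *s W p c)" using frameD(7)[OF fr p(1) z p(2)] by blast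
  then have u': "(1/2) *s (vof ?X - \<i> *s vof ?Y) = u *s W p c" using F_z_nth by metis
  show ?thesis
  proof (cases "u = 0")
    case True
    have "(1/2) *s (vof ?X - \<i> *s vof ?Y) = 0" using u' True by (simp only: vector_smult_lzero)
    then have "vof ?X - \<i> *s vof ?Y = 0" unfolding vector_mul_eq_0 by simp
    then have "?X = 0" "?Y = 0" by (simp_all add: vec_eq_iff complex_eq_iff)
    then show ?thesis by simp
  next
    case False
    define k where "k = coeff W c p / cnj u"
    have "vcnj ((1/2) *s (vof ?X - \<i> *s vof ?Y)) = vcnj (u *s W p c)" using u' by simp
    then have "(1/2) *s (vof ?X + \<i> *s vof ?Y) = cnj u *s vcnj (W p c)" by (simp add: vec_eq_iff)
    then have "\<tau> p c = k *s ((1/2) *s (vof ?X + \<i> *s vof ?Y))"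
      unfolding tau_frame(1)[OF fr p(1) c p(3)] using False by (simp add: k_def tcnj_nth)
    moreover have "vof (\<sigma> p c) + \<i> *s vof (\<kappa> p c) = 2 *s \<tau> p c"
      unfolding tau_eq tof_real_nth by (simp add: vec_eq_iff)
    ultimately have e: "vof (\<sigma> p c) + \<i> *s vof (\<kappa> p c) = k *s (vof ?X + \<i> *s vof ?Y)"
      by (simp add: vec_eq_iff)
    have "vRe (vof (\<sigma> p c) + \<i> *s vof (\<kappa> p c)) = vRe (k *s (vof ?X + \<i> *s vof ?Y))"
      "vIm (vof (\<sigma> p c) + \<i> *s vof (\<kappa> p c)) = vIm (k *s (vof ?X + \<i> *s vof ?Y))" by (simp_all only: e)
    then have \<sigma>: "\<sigma> p c = Re k *s ?X - Im k *s ?Y" and \<kappa>: "\<kappa> p c = Im k *s ?X + Re k *s ?Y"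
      by (simp_all add: vRe_def vIm_def vec_eq_iff)
    have 0: "crv (G c) x X X Z = 0" for x and X Z :: "real^'n"
      using crv_antisym[of "G c" x X X Z] by (simp add: vec_eq_iff)
    show ?thesis
      unfolding \<sigma> \<kappa> crv_add crv_diff crv_scale 0 crv_antisym[of "G c" "snd c (F p)" ?Y ?X ?X] by (simp add: vec_eq_iff)
  qed
qed

end


section \<open>The densities, the exact term and the pointwise identity\<close>

definition defect :: "('s \<Rightarrow> ('m, 'n, complex) tvec) \<Rightarrow> ('s, complex) chart \<Rightarrow> 's \<Rightarrow> real" where
  "defect V z p = hermitian_norm_sq g (F p) (tangential A g (F p) (\<Xi> p) (nabla_z A g F z V p))"

lemma nabla_z_in_tangent_space:
  assumes "smooth_section_on S A F UNIV V" "z \<in> S" "p \<in> fst z"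
  shows "nabla_z A g F z V p \<in> tangent_space A (F p)"
  unfolding nabla_z_def
  by (intro M.tangent_space_smult M.tangent_space_diff nabla_in_tangent_space[OF assms(1) open_UNIV UNIV_I assms(2,3)])

lemma nabla_z_nth: "nabla_z A g F z V p c = (1/2) *s (nabla A g F z 1 V p c - \<i> *s nabla A g F z \<i> V p c)"
  by (simp add: nabla_z_def)

lemma defect_frame:
  assumes V: "smooth_section_on S A F UNIV V" and fr: "frame N W" and p: "p \<in> N" "p \<in> fst z" "F p \<in> fst c"
    and z: "z \<in> S" and c: "c \<in> A"
  shows "defect V z p = ((cmod (ip (gr c p) (nabla_z A g F z V p c) (W p c)))\<^sup>2
    + (cmod (ip (gr c p) (nabla_z A g F z V p c) (vcnj (W p c))))\<^sup>2) / Re (mass W c p)"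
  unfolding defect_def by (rule hermitian_norm_tangential[OF fr p(1) c p(3) nabla_z_in_tangent_space[OF V z p(2)]])

text \<open>The derivative in direction \<open>z\<close> is multiplied by \<open>jac\<close> under a
  change of chart, and its tangential part enters quadratically. Continuity is visible in
  \<open>defect_frame\<close>, whose denominator is positive.\<close>

lemma two_form_defect:
  assumes V: "smooth_section_on S A F UNIV V"
  shows "S.two_form (defect V)"
  unfolding S.two_form_def
proof (intro conjI ballI)
  fix z assume z: "z \<in> S"
  have "C_k_on 0 (snd z ` fst z) (\<lambda>w. defect V z (chart_inv z w))"
  proof (rule C_k_on_density[OF z])
    fix p assume p: "p \<in> fst z"
    obtain N W where fr: "p \<in> N" "frame N W" using frame_exists by blast
    obtain c where c: "c \<in> A" "F p \<in> fst c" using M.chart_at by blast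
    let ?D = "patch N z c"
    have o: "open ?D" by (rule open_patch[OF frameD(1)[OF fr(2)] z c(1)])
    let ?V = "\<lambda>w. nabla_z A g F z V (chart_inv z w) c" and ?W = "\<lambda>w. W (chart_inv z w) c"
    let ?M = "\<lambda>w. G c (coords z c w)"
    let ?h = "\<lambda>w. ((cmod (ip (?M w) (?V w) (?W w)))\<^sup>2 + (cmod (ip (?M w) (?V w) (vcnj (?W w))))\<^sup>2) / Re (ip (?M w) (?W w) (vcnj (?W w)))"
    have nV: "C_k_on 0 ?D (\<lambda>w. nabla A g F z e V (chart_inv z w) c)" for e
      by (rule C_k_on_nabla[OF smooth_section_on_subset[OF V subset_UNIV] frameD(1)[OF fr(2)] z c(1)])
    have CV: "C_k_on 0 ?D ?V"
      unfolding nabla_z_nth by (intro C_k_on_smult C_k_on_diff C_k_on_const o nV)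
    note CW = C_k_on_section[OF frameD(2)[OF fr(2)] z c(1), of 0]
    note CW' = C_k_on_linear[OF bounded_linear_vcnj o CW]
    note ipc = C_k_on_ip_section[OF z c(1) frameD(1)[OF fr(2)]]
    have eq: "Re (ip (?M w) (?W w) (vcnj (?W w))) \<noteq> 0" "defect V z (chart_inv z w) = ?h w" if "w \<in> ?D" for w
    proof -
      obtain q where q: "q \<in> N" "q \<in> fst z" "F q \<in> fst c" "w = snd z q" "chart_inv z w = q"
        using \<open>w \<in> ?D\<close> z by (rule patchE)
      have "coords z c w = snd c (F q)" using coords_at[OF z q(2)] q(4) by simp
      then show "Re (ip (?M w) (?W w) (vcnj (?W w))) \<noteq> 0" "defect V z (chart_inv z w) = ?h w"
        using mass_positive[OF fr(2) q(1) c(1) q(3)] defect_frame[OF V fr(2) q(1,2,3) z c(1)]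
        unfolding q(5) by (simp_all add: mass_def)
    qed
    have "continuous_on ?D ?h"
      using eq(1) ipc[OF CV CW] ipc[OF CV CW'] ipc[OF CW CW'] by (intro continuous_intros) simp_all
    then have "C_k_on 0 ?D ?h" by simp
    moreover have "defect V z q = ?h (snd z q)" if "q \<in> N" "q \<in> fst z" "F q \<in> fst c" for q
      using eq(2)[OF in_patch[OF that]] S.chart(3)[OF z that(2)] by simp
    ultimately show "\<exists>N c h. open N \<and> p \<in> N \<and> c \<in> A \<and> F p \<in> fst c \<and> C_k_on 0 (patch N z c) h \<and>
      (\<forall>q\<in>N. q \<in> fst z \<longrightarrow> F q \<in> fst c \<longrightarrow> defect V z q = h (snd z q))"
      using c fr(1) frameD(1)[OF fr(2)] by (intro exI[of _ N] exI[of _ c] exI[of _ ?h]) blast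
  qed
  then show "continuous_on (snd z ` fst z) (\<lambda>w. defect V z (chart_inv z w))" by simp
next
  fix z y p assume z: "z \<in> S" "y \<in> S" "p \<in> fst z \<inter> fst y"
  then have p: "p \<in> fst z" "p \<in> fst y" by auto
  obtain N W where fr: "p \<in> N" "frame N W" using frame_exists by blast
  obtain c where c: "c \<in> A" "F p \<in> fst c" using M.chart_at by blast
  define j where "j = S.jac z y p"
  have n: "nabla A g F z e V p c = Re (j * e) *\<^sub>R nabla A g F y 1 V p c + Im (j * e) *\<^sub>R nabla A g F y \<i> V p c" for e
    unfolding j_def
    using nabla_change[OF V UNIV_I z(1,2) p, of e] nabla_linear[OF V UNIV_I z(2) p(2)] by metis
  have "nabla_z A g F z V p c = j *s nabla_z A g F y V p c"
    unfolding nabla_z_nth n by (simp add: vec_eq_iff complex_eq_iff field_simps)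
  then show "defect V z p = (cmod (S.jac z y p))\<^sup>2 * defect V y p"
    unfolding defect_frame[OF V fr(2,1) p(1) c(2) z(1) c(1)] defect_frame[OF V fr(2,1) p(2) c(2) z(2) c(1)] j_def[symmetric]
    by (simp add: ip_linear norm_mult power_mult_distrib distrib_left)
qed

definition area_density :: "('s, complex) chart \<Rightarrow> 's \<Rightarrow> real" where
  "area_density z p = (let ds = nabla_z A g F z (tof_real \<circ> s) p in
     hermitian_norm_sq g (F p) (normal A g (F p) (\<Xi> p) ds)
     - hermitian_norm_sq g (F p) (tangential A g (F p) (\<Xi> p) ds)
     - Re (metric_bilinear g (F p)
         (curvature A g (F p) (tof_real (s p)) (F_z A F z p) (tcnj (F_z A F z p)))
         (tof_real (s p))))"

lemma second_variation_area_eq: "second_variation_area S A g F \<Xi> s = 4 * surface_integral S area_density"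
  unfolding second_variation_area_def area_density_def[abs_def] ..

lemma vof_s_section: "smooth_section_on S A F UNIV (tof_real \<circ> s)"
  using smooth_section_tof_real[OF s_section open_UNIV] by (simp add: comp_def)

text \<open>The squared length of \<open>nabla_z\<close> of a real field is a quarter of the sum
  over the two real directions. The normal part is the total minus the tangential part, so the
  tangential square is subtracted twice; with the prefactor 4 this gives 8.\<close>

lemma area_density_eq:
  assumes z: "z \<in> S" "p \<in> fst z"
  shows "4 * area_density z p = energy_density s z p - 8 * defect (tof_real \<circ> s) z p"
proof -
  obtain N W where fr: "p \<in> N" "frame N W" using frame_exists by blast
  obtain c where c: "c \<in> A" "F p \<in> fst c" using M.chart_at by blast
  interpret metric_coords "snd c ` fst c" "G c" by (rule M.metric_coords_gram[OF c(1)])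
  have x: "snd c (F p) \<in> snd c ` fst c" using c by auto
  let ?X = "pushforward A F z 1 p" and ?Y = "pushforward A F z \<i> p"
  let ?S1 = "nabla A g F z 1 s p c" and ?S2 = "nabla A g F z \<i> s p c"
  let ?R = "curvature A g (F p)"
  have T: "?X \<in> tangent_space A (F p)" "?Y \<in> tangent_space A (F p)" "s p \<in> tangent_space A (F p)"
    by (intro pushforward_in_tangent_space z section_in_tangent_space[OF s_section UNIV_I])+
  have ns: "nabla_z A g F z (tof_real \<circ> s) p c = (1/2) *s (vof ?S1 - \<i> *s vof ?S2)"
    using nabla_tof_real[OF s_section UNIV_I z] by (simp add: nabla_z_nth comp_def)
  have "Re (ip (gr c p) (nabla_z A g F z (tof_real \<circ> s) p c) (vcnj (nabla_z A g F z (tof_real \<circ> s) p c)))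
      = (ip (gr c p) ?S1 ?S1 + ip (gr c p) ?S2 ?S2) / 4"
    unfolding ns by (simp add: ip_linear ip_vof)
  moreover have "hermitian_norm_sq g (F p) (normal A g (F p) (\<Xi> p) (nabla_z A g F z (tof_real \<circ> s) p))
     = Re (ip (gr c p) (nabla_z A g F z (tof_real \<circ> s) p c) (vcnj (nabla_z A g F z (tof_real \<circ> s) p c))) - defect (tof_real \<circ> s) z p"
    unfolding defect_def by (rule hermitian_norm_normal[OF fr(2,1) c nabla_z_in_tangent_space[OF vof_s_section z]])
  moreover have "Re (metric_bilinear g (F p) (?R (tof_real (s p)) (F_z A F z p) (tcnj (F_z A F z p))) (tof_real (s p)))
      = (ip (gr c p) (?R (s p) ?X ?X c) (s p c) + ip (gr c p) (?R (s p) ?Y ?Y c) (s p c)) / 4"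
  proof -
    \<comment> \<open>Expanding \<open>F_z\<close> and its conjugate leaves the mixed curvature
      terms with a factor \<open>\<i>\<close>; paired with the real section \<open>s\<close> they
      are purely imaginary and disappear from the real part.\<close>
    have curv: "?R (tof_real (s p)) (F_z A F z p) (tcnj (F_z A F z p)) d
      = (1/4) *s (vof (?R (s p) ?X ?X d) + vof (?R (s p) ?Y ?Y d) + \<i> *s (vof (?R (s p) ?X ?Y d) - vof (?R (s p) ?Y ?X d)))" for d
    proof (cases "d \<in> A \<and> F p \<in> fst d")
      case True
      have v: "crv (G d) y (vof a) (vof b) (vof e) = (vof (crv (G d) y a b e) :: complex^'n)" for y and a b e :: "real^'n"
        by (simp add: crv_def vec_eq_iff)
      have "?R (tof_real (s p)) (F_z A F z p) (tcnj (F_z A F z p)) d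
        = crv (G d) (snd d (F p)) (vof (s p d)) ((1/2) *s (vof (?X d) - \<i> *s vof (?Y d))) ((1/2) *s (vof (?X d) + \<i> *s vof (?Y d)))"
        using True by (simp add: M.curvature_nth tof_real_nth F_z_nth tcnj_nth)
      also have "\<dots> = (1/4) *s (vof (?R (s p) ?X ?X d) + vof (?R (s p) ?Y ?Y d) + \<i> *s (vof (?R (s p) ?X ?Y d) - vof (?R (s p) ?Y ?X d)))"
        unfolding crv_scale crv_add crv_diff v using True
        by (simp add: M.curvature_nth vec_eq_iff field_simps)
      finally show ?thesis .
    next
      case False
      have 0: "curvature A g (F p) a b e d = 0" for a b e :: "('m, 'n, 'k::real_normed_field) tvec"
        using False by (simp only: curvature_def tfamily_def if_False)
      show ?thesis unfolding 0 by (simp add: vec_eq_iff)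
    qed
    have "?R (tof_real (s p)) (F_z A F z p) (tcnj (F_z A F z p)) \<in> tangent_space A (F p)"
      unfolding curv[abs_def]
      by (intro M.tangent_space_smult M.tangent_space_add M.tangent_space_diff
          M.tof_real_in_tangent_space[unfolded tof_real_nth[abs_def]] M.curvature_in_tangent_space T)
    from M.metric_bilinear_eq[OF c this M.tof_real_in_tangent_space[OF T(3)]] show ?thesis
      unfolding curv tof_real_nth by (simp add: ip_linear ip_vof)
  qed
  ultimately show ?thesis
    unfolding area_density_def energy_density_coords[OF s_section z c] Let_def defect_def
    by (simp add: M.curvature_nth[OF c] algebra_simps)
qed

text \<open>The weights come from polarisation: in the energy at \<open>s + \<sigma>\<close> the
  curvature of \<open>\<sigma>\<close> is paired once with \<open>\<sigma>\<close> and twice with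
  \<open>s\<close>.\<close>

definition \<alpha> :: "('s, complex) chart \<Rightarrow> complex \<Rightarrow> 's \<Rightarrow> real" where
  "\<alpha> z e p = - g (F p) (\<lambda>c. \<sigma> p c + 2 *s s p c) (nabla A g F z e \<kappa> p)"

abbreviation \<sigma>s :: "'s \<Rightarrow> ('m, 'n, real) tvec" where
  "\<sigma>s \<equiv> \<lambda>p c. \<sigma> p c + 2 *s s p c"

lemma ss_section: "smooth_section_on S A F UNIV \<sigma>s"
  by (rule smooth_section_add[OF sigma_section smooth_section_smult[OF s_section open_UNIV] open_UNIV])

lemma alpha_coords:
  assumes z: "z \<in> S" "p \<in> fst z" and c: "c \<in> A" "F p \<in> fst c"
  shows "\<alpha> z e p = - ip (gr c p) (\<sigma>s p c) (nabla A g F z e \<kappa> p c)"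
  unfolding \<alpha>_def
  using M.metric_eq_ip[OF c section_in_tangent_space[OF ss_section UNIV_I] nabla_in_tangent_space[OF kappa_section open_UNIV UNIV_I z]]
  by simp

lemma C_k_on_alpha_coords:
  assumes z: "z \<in> S" and c: "c \<in> A"
  shows "C_k_on k (patch UNIV z c) (\<lambda>w. ip (G c (coords z c w)) (\<sigma>s (chart_inv z w) c) (nabla A g F z e \<kappa> (chart_inv z w) c))"
  by (rule C_k_on_ip_section[OF z c open_UNIV C_k_on_section[OF ss_section z c] C_k_on_nabla[OF kappa_section open_UNIV z c]])

lemma one_form_alpha: "S.one_form \<alpha>"
  unfolding S.one_form_def
proof (intro conjI ballI allI)
  fix z e assume z: "z \<in> S"
  show "C_k_on 1 (snd z ` fst z) (\<lambda>w. \<alpha> z e (chart_inv z w))"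
  proof (rule C_k_on_density[OF z])
    fix p assume p: "p \<in> fst z"
    obtain c where c: "c \<in> A" "F p \<in> fst c" using M.chart_at by blast
    let ?h = "\<lambda>w. - ip (G c (coords z c w)) (\<sigma>s (chart_inv z w) c) (nabla A g F z e \<kappa> (chart_inv z w) c)"
    have "C_k_on 1 (patch UNIV z c) ?h"
      by (rule C_k_on_uminus[OF open_patch[OF open_UNIV z c(1)] C_k_on_alpha_coords[OF z c(1)]])
    moreover have "\<alpha> z e q = ?h (snd z q)" if "q \<in> fst z" "F q \<in> fst c" for q
      using alpha_coords[OF z that(1) c(1) that(2)] S.chart(3)[OF z that(1)] coords_at[OF z that(1), of c] by simp
    ultimately show "\<exists>N c h. open N \<and> p \<in> N \<and> c \<in> A \<and> F p \<in> fst c \<and> C_k_on 1 (patch N z c) h \<and>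
      (\<forall>q\<in>N. q \<in> fst z \<longrightarrow> F q \<in> fst c \<longrightarrow> \<alpha> z e q = h (snd z q))"
      using c by (intro exI[of _ UNIV] exI[of _ c] exI[of _ ?h]) blast
  qed
next
  fix z p assume z: "z \<in> S" "p \<in> fst z"
  obtain c where c: "c \<in> A" "F p \<in> fst c" using M.chart_at by blast
  have *: "\<alpha> z e p = - ip (gr c p) (\<sigma>s p c) (Re e *s nabla A g F z 1 \<kappa> p c + Im e *s nabla A g F z \<i> \<kappa> p c)" for e
    unfolding alpha_coords[OF z c] scalar_mult_eq_scaleR using nabla_linear[OF kappa_section UNIV_I z] by metis
  show "linear (\<lambda>e. \<alpha> z e p)"
    unfolding * by (rule linearI) (simp_all add: ip_linear algebra_simps)
next
  fix z y p e assume z: "z \<in> S" "y \<in> S" "p \<in> fst z \<inter> fst y"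
  then have p: "p \<in> fst z" "p \<in> fst y" by auto
  show "\<alpha> z e p = \<alpha> y (S.jac z y p * e) p"
    unfolding \<alpha>_def using nabla_change[OF kappa_section UNIV_I z(1,2) p, of e] by simp
qed

text \<open>The second derivatives of \<open>\<kappa>\<close> occur only through their commutator,
  which \<open>cov_commutator\<close> turns into curvature; what remains are products of first
  derivatives.\<close>

lemma exterior_alpha:
  assumes z: "z \<in> S" "p \<in> fst z" and c: "c \<in> A" "F p \<in> fst c"
  shows "S.exterior \<alpha> z p =
    - ip (gr c p) (nabla A g F z 1 \<sigma> p c + 2 *s nabla A g F z 1 s p c) (nabla A g F z \<i> \<kappa> p c)
    + ip (gr c p) (nabla A g F z \<i> \<sigma> p c + 2 *s nabla A g F z \<i> s p c) (nabla A g F z 1 \<kappa> p c)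
    - ip (gr c p) (\<sigma> p c + 2 *s s p c) (crv (G c) (snd c (F p)) (pushforward A F z 1 p c) (pushforward A F z \<i> p c) (\<kappa> p c))"
proof -
  interpret metric_coords "snd c ` fst c" "G c" by (rule M.metric_coords_gram[OF c(1)])
  let ?D = "patch UNIV z c" and ?w = "snd z p"
  have o: "open ?D" by (rule open_patch[OF open_UNIV z(1) c(1)])
  have w: "?w \<in> ?D" by (rule in_patch[OF UNIV_I z(2) c(2)])
  have x: "coords z c ?w \<in> snd c ` fst c" using c z by (simp add: coords_at)
  let ?k = "\<lambda>w. \<kappa> (chart_inv z w) c"
  let ?cov = "cov (G c) (coords z c)"
  let ?a = "\<lambda>e w. ip (G c (coords z c w)) (\<sigma>s (chart_inv z w) c) (nabla A g F z e \<kappa> (chart_inv z w) c)"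
  have C1: "C_k_on (Suc 0) ?D (\<lambda>w. nabla A g F z e \<kappa> (chart_inv z w) c)" for e
    by (rule C_k_on_nabla[OF kappa_section open_UNIV z(1) c(1)])
  then have dn: "(\<lambda>w. nabla A g F z e \<kappa> (chart_inv z w) c) differentiable (at ?w)" for e
    using w by simp
  have cd: "coord_deriv z e (\<alpha> z e') p = - (ip (gr c p) (nabla A g F z e \<sigma>s p c) (nabla A g F z e' \<kappa> p c)
      + ip (gr c p) (\<sigma>s p c) (?cov e (?cov e' ?k) ?w))" for e e'
  proof -
    have "C_k_on (Suc 0) ?D (?a e')" by (rule C_k_on_alpha_coords[OF z(1) c(1)])
    then have da: "?a e' differentiable (at ?w)" using w by simp
    have "pd e (\<lambda>w. - ?a e' w) ?w = - pd e (?a e') ?w"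
      by (rule pd_eqI[OF has_derivative_minus[OF da[unfolded frechet_derivative_works]]])
    moreover have "pd e (\<lambda>w. - ?a e' w) ?w = pd e (\<alpha> z e' \<circ> chart_inv z) ?w"
    proof (rule fun_cong[OF frechet_derivative_transform_within_open[OF differentiable_minus[OF da] o w]])
      fix x assume "x \<in> ?D"
      then show "- ?a e' x = (\<alpha> z e' \<circ> chart_inv z) x"
        using z(1) by (rule patchE) (simp add: alpha_coords[OF z(1) _ c(1)] coords_at[OF z(1)])
    qed
    moreover have "pd e (?a e') ?w = ip (G c (coords z c ?w)) (?cov e (\<lambda>w. \<sigma>s (chart_inv z w) c) ?w) (nabla A g F z e' \<kappa> (chart_inv z ?w) c)
      + ip (G c (coords z c ?w)) (\<sigma>s (chart_inv z ?w) c) (?cov e (\<lambda>w. nabla A g F z e' \<kappa> (chart_inv z w) c) ?w)"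
      by (rule cov_compatible[OF x differentiable_coords[OF z(1) c(1) z(2) c(2)]
            differentiable_section[OF ss_section z(1) c(1) UNIV_I z(2) c(2)] dn])
    moreover have "?cov e (\<lambda>w. nabla A g F z e' \<kappa> (chart_inv z w) c) ?w = ?cov e (?cov e' ?k) ?w"
      by (rule cov_cong[OF o w dn]) (rule nabla_nth_patch[OF z(1) c(1)])
    ultimately show ?thesis
      using nabla_nth[OF z(1) c(1) z(2) c(2), of e \<sigma>s] S.chart(3)[OF z] coords_at[OF z, of c]
      by (simp add: coord_deriv_def)
  qed
  have com: "?cov 1 (?cov \<i> ?k) ?w - ?cov \<i> (?cov 1 ?k) ?w
      = crv (G c) (snd c (F p)) (pushforward A F z 1 p c) (pushforward A F z \<i> p c) (\<kappa> p c)"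
    using cov_commutator[OF o w coords_image[OF z(1)] C_k_on_coords[OF z(1) c(1)] C_k_on_section[OF kappa_section z(1) c(1)], of 1 \<i>]
      S.chart(3)[OF z] coords_at[OF z, of c] c by (simp add: pushforward_nth)
  have n: "nabla A g F z e \<sigma>s p c = nabla A g F z e \<sigma> p c + 2 *s nabla A g F z e s p c" for e
    unfolding nabla_add[OF sigma_section smooth_section_smult[OF s_section open_UNIV] UNIV_I z]
      nabla_smult[OF s_section UNIV_I z] ..
  show ?thesis
    unfolding S.exterior_def cd n com[symmetric] ip_diff_right by simp
qed

text \<open>The combination whose tangential \<open>z\<close>-derivative measures the failure of the
  equality condition: it is the sum of \<open>D_z\<close> of the (0,1) part of
  \<open>\<sigma>\<close> and the tangential part of the derivative of \<open>s\<close>.\<close>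

definition s_tau :: "'s \<Rightarrow> ('m, 'n, complex) tvec" where
  "s_tau = (\<lambda>p c. (tof_real \<circ> s) p c + \<tau> p c)"

lemma s_tau_section: "smooth_section_on S A F UNIV s_tau"
  unfolding s_tau_def by (rule smooth_section_add[OF vof_s_section tau_section open_UNIV])

lemma nabla_z_s_tau:
  assumes "z \<in> S" "p \<in> fst z"
  shows "nabla_z A g F z s_tau p = (\<lambda>c. nabla_z A g F z (tof_real \<circ> s) p c + nabla_z A g F z \<tau> p c)"
  unfolding s_tau_def nabla_z_nth[abs_def] nabla_add[OF vof_s_section tau_section UNIV_I assms]
  by (rule ext) (simp add: vec_eq_iff algebra_simps add_divide_distrib)

text \<open>The curvature terms involving \<open>\<sigma>\<close> cancel against the curvature in
  \<open>exterior_alpha\<close>. Among first derivatives, the terms mixed with \<open>s\<close>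
  match after \<open>8 * 2 / 8 = 2\<close>. For those quadratic in \<open>\<sigma>\<close>, the
  factor \<open>8 / 16 = 1/2\<close> multiplies the squares of the derivatives of both
  \<open>\<sigma>\<close> and \<open>\<kappa>\<close>; these have equal sums by
  \<open>nabla_sigma_kappa\<close>, so one full copy for \<open>\<sigma>\<close> results.\<close>

lemma energy_density_eq:
  assumes z: "z \<in> S" "p \<in> fst z"
  shows "energy_density (\<lambda>p c. s p c + \<sigma> p c) z p = 4 * area_density z p + 8 * defect s_tau z p + S.exterior \<alpha> z p"
proof -
  obtain N W where fr: "p \<in> N" "frame N W" using frame_exists by blast
  obtain c where c: "c \<in> A" "F p \<in> fst c" using M.chart_at by blast
  interpret metric_coords "snd c ` fst c" "G c" by (rule M.metric_coords_gram[OF c(1)])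
  have x: "snd c (F p) \<in> snd c ` fst c" using c by auto
  let ?M = "gr c p"
  define S1 S2 where "S1 = nabla A g F z 1 s p c" and "S2 = nabla A g F z \<i> s p c"
  define P1 P2 where "P1 = nabla A g F z 1 \<sigma> p c" and "P2 = nabla A g F z \<i> \<sigma> p c"
  define Q1 Q2 where "Q1 = nabla A g F z 1 \<kappa> p c" and "Q2 = nabla A g F z \<i> \<kappa> p c"
  define X Y where "X = pushforward A F z 1 p c" and "Y = pushforward A F z \<i> p c"
  let ?R = "crv (G c) (snd c (F p))"
  define a where "a = nabla_z A g F z (tof_real \<circ> s) p c"
  define b where "b = nabla_z A g F z \<tau> p c"
  have a: "a = (1/2) *s (vof S1 - \<i> *s vof S2)"
    unfolding a_def S1_def S2_def using nabla_tof_real[OF s_section UNIV_I z] by (simp add: nabla_z_nth comp_def)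
  \<comment> \<open>The derivative of \<open>(\<sigma> + i\<kappa>) / 2\<close> in direction
    \<open>z\<close>, sorted into the two Cauchy-Riemann combinations of real derivatives.\<close>
  have b: "b = (1/4) *s (vof (P1 + Q2) + \<i> *s vof (Q1 - P2))"
    unfolding b_def P1_def P2_def Q1_def Q2_def nabla_z_nth nabla_tau[OF z]
    by (simp add: vec_eq_iff complex_eq_iff)
  obtain k where "nabla A g F z 1 \<tau> p c - \<i> *s nabla A g F z \<i> \<tau> p c = k *s vcnj (W p c)"
    using nabla_tau_holomorphic[OF fr(2,1) z(2) c(2) z(1) c(1)] by blast
  then have bk: "b = (k/2) *s vcnj (W p c)" by (simp add: b_def nabla_z_nth)
  \<comment> \<open>Since \<open>b\<close> is a multiple of the conjugate frame, adding it changes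
    only the pairing with \<open>W\<close>. Expanding that one square polarises
    \<open>defect\<close>, although \<open>a\<close> also has a normal component.\<close>
  have "defect s_tau z p = defect (tof_real \<circ> s) z p + 2 * Re (ip ?M a (vcnj b)) + Re (ip ?M b (vcnj b))"
  proof -
    define m where "m = Re (mass W c p)"
    have m: "m > 0" "mass W c p = of_real m"
      using mass_positive[OF fr(2,1) c] mass_real[OF fr(2,1) c] by (simp_all add: m_def)
    note null = frame_null[OF fr(2,1) c] frame_mass[OF fr(2,1) c]
    define t where "t = ip ?M a (W p c)"
    have 1: "ip ?M (a + b) (W p c) = t + (k/2) * of_real m" "ip ?M (a + b) (vcnj (W p c)) = ip ?M a (vcnj (W p c))"
      unfolding bk t_def by (simp_all add: ip_linear null m(2))
    have 2: "ip ?M a (vcnj b) = cnj (k/2) * t" "ip ?M b (vcnj b) = (k/2) * cnj (k/2) * of_real m"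
      unfolding bk t_def by (simp_all add: ip_linear null m(2))
    define E where "E = 2 * Re (cnj (k/2) * t) + Re ((k/2) * cnj (k/2) * of_real m)"
    have "(cmod (t + (k/2) * of_real m))\<^sup>2 = (cmod t)\<^sup>2 + m * E"
      by (simp add: cmod_power2 E_def) (simp add: power2_eq_square field_simps)
    then have "((cmod (t + (k/2) * of_real m))\<^sup>2 + B) / m = ((cmod t)\<^sup>2 + B) / m + E" for B
      using m(1) by (simp add: field_simps)
    then show ?thesis
      unfolding defect_frame[OF s_tau_section fr(2,1) z(2) c(2) z(1) c(1)] defect_frame[OF vof_s_section fr(2,1) z(2) c(2) z(1) c(1)]
        nabla_z_s_tau[OF z] a_def[symmetric] b_def[symmetric] 1 2 m_def[symmetric] t_def[symmetric]
      by (simp add: E_def)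
  qed
  moreover have "Re (ip ?M a (vcnj b)) = (ip ?M S1 (P1 + Q2) - ip ?M S2 (Q1 - P2)) / 8"
    unfolding a b by (simp add: ip_linear ip_vof) (simp add: field_simps)
  moreover have "Re (ip ?M b (vcnj b)) = (ip ?M (P1 + Q2) (P1 + Q2) + ip ?M (Q1 - P2) (Q1 - P2)) / 16"
    unfolding b by (simp add: ip_linear ip_vof) (simp add: field_simps)
  moreover have "ip ?M P1 P1 + ip ?M P2 P2 = ip ?M Q1 Q1 + ip ?M Q2 Q2"
    unfolding P1_def P2_def Q1_def Q2_def by (rule nabla_sigma_kappa[OF fr(2,1) z(2) c(2) z(1) c(1)])
  moreover have "?R (\<sigma> p c) X X + ?R (\<sigma> p c) Y Y = ?R X Y (\<kappa> p c)"
    unfolding X_def Y_def by (rule curvature_sigma_kappa[OF fr(2,1) z(2) c(2) z(1) c(1)])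
  then have "ip ?M (?R (\<sigma> p c) X X + ?R (\<sigma> p c) Y Y) (\<sigma> p c + 2 *s s p c) = ip ?M (\<sigma> p c + 2 *s s p c) (?R X Y (\<kappa> p c))"
    using ip_sym[OF x] by simp
  moreover have "energy_density (\<lambda>p c. s p c + \<sigma> p c) z p
     = ip ?M (S1 + P1) (S1 + P1) + ip ?M (S2 + P2) (S2 + P2)
       - ip ?M (?R (s p c + \<sigma> p c) X X) (s p c + \<sigma> p c) - ip ?M (?R (s p c + \<sigma> p c) Y Y) (s p c + \<sigma> p c)"
    unfolding energy_density_coords[OF smooth_section_add[OF s_section sigma_section open_UNIV] z c] Let_def
      nabla_add[OF s_section sigma_section UNIV_I z] S1_def S2_def P1_def P2_def X_def Y_def ..
  moreover have "4 * area_density z p = ip ?M S1 S1 + ip ?M S2 S2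
       - ip ?M (?R (s p c) X X) (s p c) - ip ?M (?R (s p c) Y Y) (s p c) - 8 * defect (tof_real \<circ> s) z p"
    unfolding area_density_eq[OF z] energy_density_coords[OF s_section z c] Let_def S1_def S2_def X_def Y_def ..
  moreover have "S.exterior \<alpha> z p = - ip ?M (P1 + 2 *s S1) Q2 + ip ?M (P2 + 2 *s S2) Q1 - ip ?M (\<sigma> p c + 2 *s s p c) (?R X Y (\<kappa> p c))"
    unfolding exterior_alpha[OF z c] S1_def S2_def P1_def P2_def Q1_def Q2_def X_def Y_def ..
  moreover note jacobi_symmetric[OF x, of "s p c" X "\<sigma> p c"] jacobi_symmetric[OF x, of "s p c" Y "\<sigma> p c"]
    ip_sym[OF x, of P1 S1] ip_sym[OF x, of P2 S2] ip_sym[OF x, of Q2 P1] ip_sym[OF x, of Q1 P2]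
  ultimately show ?thesis
    unfolding crv_add ip_linear by (simp add: field_simps)
qed

lemma second_variation_comparison:
  "second_variation_area S A g F \<Xi> s \<le> second_variation_energy S A g F (\<lambda>p c. s p c + \<sigma> p c)"
  "second_variation_area S A g F \<Xi> s = second_variation_energy S A g F (\<lambda>p c. s p c + \<sigma> p c) \<longleftrightarrow>
    (\<forall>z\<in>S. \<forall>p\<in>fst z. D_z A g F \<Xi> z (\<lambda>q. part01 (\<Xi> q) (\<sigma> q)) p
       = (\<lambda>c. - tangential A g (F p) (\<Xi> p) (nabla_z A g F z (tof_real \<circ> s) p) c))"
proof -
  obtain C \<rho> where pou: "partition_of_unity S C \<rho>" using S.partition_of_unity_exists by blast
  have combine: "S.two_form (\<lambda>z p. a * \<omega> z p + b * \<omega>' z p)" if "S.two_form \<omega>" "S.two_form \<omega>'" for a b \<omega> \<omega>'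
    unfolding S.two_form_def
  proof (intro conjI ballI)
    show "continuous_on (snd z ` fst z) (\<lambda>w. a * \<omega> z (chart_inv z w) + b * \<omega>' z (chart_inv z w))" if "z \<in> S" for z
      by (intro continuous_intros S.two_form_continuous \<open>S.two_form \<omega>\<close> \<open>S.two_form \<omega>'\<close> that)
    fix z y p assume "z \<in> S" "y \<in> S" "p \<in> fst z \<inter> fst y"
    then show "a * \<omega> z p + b * \<omega>' z p = (cmod (S.jac z y p))\<^sup>2 * (a * \<omega> y p + b * \<omega>' y p)"
      using S.two_form_change[OF \<open>S.two_form \<omega>\<close>, of z y p] S.two_form_change[OF \<open>S.two_form \<omega>'\<close>, of z y p]
      by (simp add: algebra_simps)
  qed
  have cong: "S.two_form \<omega>'" if "S.two_form \<omega>" and eq: "\<And>z p. z \<in> S \<Longrightarrow> p \<in> fst z \<Longrightarrow> \<omega> z p = \<omega>' z p" for \<omega> \<omega>'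
    unfolding S.two_form_def
  proof (intro conjI ballI)
    show "continuous_on (snd z ` fst z) (\<lambda>w. \<omega>' z (chart_inv z w))" if "z \<in> S" for z
      by (rule continuous_on_eq[OF S.two_form_continuous[OF \<open>S.two_form \<omega>\<close> that]]) (rule eq[OF that S.chart(4)[OF that]])
    fix z y p assume "z \<in> S" "y \<in> S" "p \<in> fst z \<inter> fst y"
    then show "\<omega>' z p = (cmod (S.jac z y p))\<^sup>2 * \<omega>' y p"
      using S.two_form_change[OF \<open>S.two_form \<omega>\<close>, of z y p] eq[of z p] eq[of y p] by simp
  qed
  \<comment> \<open>The coefficient law of the area density is inherited from the energy density and
    the defect, through \<open>area_density_eq\<close>.\<close>
  have area: "S.two_form area_density"
    by (rule cong[OF combine[OF two_form_energy_density[OF s_section] two_form_defect[OF vof_s_section], of "1/4" "-2"]])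
       (use area_density_eq in \<open>simp add: field_simps\<close>)
  have area4: "S.two_form (\<lambda>z p. 4 * area_density z p)"
    using combine[OF area area, of 4 0] by simp
  \<comment> \<open>The factor 4 stands outside a chosen value, so it is moved inside by evaluating
    both integrals with the same partition \<open>pou\<close>.\<close>
  have "second_variation_area S A g F \<Xi> s = surface_integral S (\<lambda>z p. 4 * area_density z p)"
    unfolding second_variation_area_eq S.surface_integral_eq[OF area pou] S.surface_integral_eq[OF area4 pou]
      sum_distrib_left S.chart_integral_def
    by (simp add: mult.left_commute)
  moreover have "second_variation_energy S A g F (\<lambda>p c. s p c + \<sigma> p c) = surface_integral S (energy_density (\<lambda>p c. s p c + \<sigma> p c))"
    by (rule second_variation_energy_eq)
  moreover have d8: "S.two_form (\<lambda>z p. 8 * defect s_tau z p)"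
    using combine[OF two_form_defect[OF s_tau_section] two_form_defect[OF s_tau_section], of 8 0] by simp
  have nonneg: "8 * defect s_tau z p \<ge> 0" if "z \<in> S" "p \<in> fst z" for z p
  proof -
    obtain N W where fr: "p \<in> N" "frame N W" using frame_exists by blast
    obtain c where c: "c \<in> A" "F p \<in> fst c" using M.chart_at by blast
    show ?thesis
      unfolding defect_frame[OF s_tau_section fr(2,1) that(2) c(2) that(1) c(1)]
      using mass_positive[OF fr(2,1) c] by simp
  qed
  note cmp = S.surface_integral_compare[OF two_form_energy_density[OF smooth_section_add[OF s_section sigma_section open_UNIV]]
      area4 d8 one_form_alpha energy_density_eq nonneg]
  \<comment> \<open>Positivity of the metric turns the vanishing of the square into the vanishing of
    the tangential part, and additivity of the projection splits that part into the two sides of the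
    equality condition.\<close>
  have "8 * defect s_tau z p = 0 \<longleftrightarrow> D_z A g F \<Xi> z (\<lambda>q. part01 (\<Xi> q) (\<sigma> q)) p
       = (\<lambda>c. - tangential A g (F p) (\<Xi> p) (nabla_z A g F z (tof_real \<circ> s) p) c)" if z: "z \<in> S" "p \<in> fst z" for z p
  proof -
    obtain N W where fr: "p \<in> N" "frame N W" using frame_exists by blast
    obtain c where c: "c \<in> A" "F p \<in> fst c" using M.chart_at by blast
    note uT = nabla_z_in_tangent_space[OF s_tau_section z]
    have T: "tangential A g (F p) (\<Xi> p) (nabla_z A g F z s_tau p)
      = (\<lambda>c. tangential A g (F p) (\<Xi> p) (nabla_z A g F z (tof_real \<circ> s) p) c + tangential A g (F p) (\<Xi> p) (nabla_z A g F z \<tau> p) c)"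
      unfolding nabla_z_s_tau[OF z]
      by (rule tangential_add[OF fr(2,1) c nabla_z_in_tangent_space[OF vof_s_section z] nabla_z_in_tangent_space[OF tau_section z]])
    have "defect s_tau z p = 0 \<longleftrightarrow> tangential A g (F p) (\<Xi> p) (nabla_z A g F z s_tau p) = (\<lambda>c. 0)"
    proof
      assume "tangential A g (F p) (\<Xi> p) (nabla_z A g F z s_tau p) = (\<lambda>c. 0)"
      then show "defect s_tau z p = 0"
        using M.metric_bilinear_eq[OF c M.tangent_space_zero M.tcnj_in_tangent_space[OF M.tangent_space_zero]]
        by (simp add: defect_def hermitian_norm_sq_def ip_linear)
    qed (rule hermitian_norm_tangential_eq_0[OF fr(2,1) c uT], simp add: defect_def)
    also have "\<dots> \<longleftrightarrow> D_z A g F \<Xi> z (\<lambda>q. part01 (\<Xi> q) (\<sigma> q)) p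
       = (\<lambda>c. - tangential A g (F p) (\<Xi> p) (nabla_z A g F z (tof_real \<circ> s) p) c)"
      unfolding T D_z_def \<tau>_def[abs_def] fun_eq_iff by (simp add: eq_neg_iff_add_eq_0 add.commute)
    finally show ?thesis by simp
  qed
  then have "(\<forall>z\<in>S. \<forall>p\<in>fst z. 8 * defect s_tau z p = 0) \<longleftrightarrow> (\<forall>z\<in>S. \<forall>p\<in>fst z. D_z A g F \<Xi> z (\<lambda>q. part01 (\<Xi> q) (\<sigma> q)) p
       = (\<lambda>c. - tangential A g (F p) (\<Xi> p) (nabla_z A g F z (tof_real \<circ> s) p) c))" by blast
  with cmp calculation
  show "second_variation_area S A g F \<Xi> s \<le> second_variation_energy S A g F (\<lambda>p c. s p c + \<sigma> p c)"
    and "second_variation_area S A g F \<Xi> s = second_variation_energy S A g F (\<lambda>p c. s p c + \<sigma> p c) \<longleftrightarrow>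
    (\<forall>z\<in>S. \<forall>p\<in>fst z. D_z A g F \<Xi> z (\<lambda>q. part01 (\<Xi> q) (\<sigma> q)) p
       = (\<lambda>c. - tangential A g (F p) (\<Xi> p) (nabla_z A g F z (tof_real \<circ> s) p) c))"
    by simp_all
qed

end

theorem theorem2p1:
  fixes S :: "('s::{t2_space, second_countable_topology}, complex) chart set"
    and A :: "('m::{t2_space, second_countable_topology}, real^'n) chart set"
    and g :: "'m \<Rightarrow> ('m, 'n, real) tvec \<Rightarrow> ('m, 'n, real) tvec \<Rightarrow> real"
    and F :: "'s \<Rightarrow> 'm"
    and \<Xi> :: "'s \<Rightarrow> ('m, 'n, complex) tvec set"
    and s \<sigma> :: "'s \<Rightarrow> ('m, 'n, real) tvec"
  assumes "closed_riemann_surface S"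
    and "smooth_manifold A"
    and "riemannian_metric A g"
    and "branched_minimal_immersion S A g F"
    and "ramified_tangent_bundle S A F \<Xi>"
    and "smooth_normal_section S A g F \<Xi> s"
    and "smooth_tangential_section S A F \<Xi> \<sigma>"
  shows "second_variation_area S A g F \<Xi> s
           \<le> second_variation_energy S A g F (\<lambda>p c. s p c + \<sigma> p c) \<and>
         (second_variation_area S A g F \<Xi> s
            = second_variation_energy S A g F (\<lambda>p c. s p c + \<sigma> p c) \<longleftrightarrow>
          (\<forall>z\<in>S. \<forall>p\<in>fst z.
             D_z A g F \<Xi> z (\<lambda>q. part01 (\<Xi> q) (\<sigma> q)) p
               = (\<lambda>c. - tangential A g (F p) (\<Xi> p) (nabla_z A g F z (tof_real \<circ> s) p) c)))"
proof -
  interpret variation S A g F \<Xi> s \<sigma>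
    by unfold_locales (use assms in \<open>simp_all add: branched_minimal_immersion_def\<close>)
  show ?thesis using second_variation_comparison by blast
qed

end
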